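(* Let $U\neq\emptyset$ be a connected open set in $\mathbb{R}^d$, $d\ge2$ ($U=\mathbb{R}^d$ is admitted), let $\varphi$ and $f$ be as described in the context, and let $\delta>0$. Then there exists a champagne subregion $U\setminus A$ of $U$, with set of centers $X_A$ and radii $r_x$, $x\in X_A$, such that $A$ is unavoidable and $$\sum_{x\in X_A}\varphi(r_x)\,f(\varphi(r_x))<\delta$$ (in particular, all $\varphi(r_x)$, $x\in X_A$, lie in the domain of $f$).
   Context: $B(x,r)$ and $\overline B(x,r)$ denote open and closed Euclidean balls. Let $\varphi(t):=(\log\frac1t)^{-1}$ (for $t\in(0,1)$) if $d=2$, and $\varphi(t):=t^{d-2}$ if $d\ge3$. The function $f$: Let $k_0\in\mathbb{N}$ and, for $k\ge k_0$, let $m_k\in\mathbb{N}$ (positive integers), $\alpha_k,\beta_k\in(0,\infty)$ with $m_k\le m_{k+1}$, $\alpha_{k+1}\le\alpha_k$, $\beta_k\le\beta_{k+1}$, and $$\alpha_k\le 1/\max\{k,m_k\},\quad 1\le\beta_k\le k,\quad \sum_{k\ge k_0}m_k\alpha_k=\infty,\quad \sum_{k\ge k_0}m_k\alpha_k/\beta_k<1/2.$$ Let $a_k:=\alpha_k/\beta_k$, and let $r_k:=\exp(-\alpha_k^{-1})$ if $d=2$, $r_k:=a_k\alpha_k^{1/(d-2)}$ if $d\ge3$. Fix $k_1\ge k_0$ such that $r_k<a_k/100$ for every $k\ge k_1$ (such $k_1$ exists since $r_k/a_k\to0$). Let $k_2\in\mathbb{N}$, $k_2\ge k_1$, and let $f$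 be a strictly positive increasing real function on $(0,m_{k_2}^{1-d}]$ such that $\sum_{k\ge k_2}\beta_kf(\alpha_k^{d-1})<\infty$. Champagne subregion: Let $X$ be a countable set in $U$ having no accumulation point in $U$, and let $r_x\in(0,1)$, $x\in X$, be such that the closed balls $\overline B(x,r_x)$ (the bubbles) are pairwise disjoint, $\sup_{x\in X}r_x/\mathrm{dist}(x,\partial U)<1$ (with $\mathrm{dist}(x,\emptyset)=\infty$, so the quotient is $0$ if $U=\mathbb{R}^d$) and, if $U$ is unbounded, $r_x\to0$ as $x\to\infty$. Then the union $A$ of all $\overline B(x,r_x)$ is relatively closed in $U$, and $U\setminus A$ is called a champagne subregion of $U$; $X_A:=X$ is the set of centers of the bubbles forming $A$. Unavoidable: For an open set $W$ and $y\in W$, $\mu_y^W$ denotes the harmonic measure at $y$ with respect to $W$ (the distribution of the point in $\partial W\subset\mathbb{R}^d$ at which Brownian motion started at $y$ exits $W$; its total mass may be less than $1$ if $W$ is unbounded). A relatively closed subset $A$ of $U$ is unavoidable if $\mu_y^{U\setminus A}(A)=1$ for every $y\in U\setminus A$. *)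

theory Defs
  imports "HOL-Probability.Probability"
begin

definition phi :: "nat \<Rightarrow> real \<Rightarrow> real" where
  "phi d t = (if d = 2 then 1 / ln (1 / t) else t ^ (d - 2))"

text \<open>The comparison radius \<open>r\<^sub>k\<close> belonging to \<open>\<alpha> = \<alpha>\<^sub>k\<close>, \<open>\<beta> = \<beta>\<^sub>k\<close>; here \<open>\<alpha> / \<beta>\<close> is \<open>a\<^sub>k\<close>.\<close>

definition model_radius :: "nat \<Rightarrow> real \<Rightarrow> real \<Rightarrow> real" where
  "model_radius d \<alpha> \<beta> =
     (if d = 2 then exp (- (1 / \<alpha>)) else (\<alpha> / \<beta>) * \<alpha> powr (1 / real (d - 2)))"


subsection \<open>Champagne subregions\<close>

definition bubbles :: "'a::euclidean_space set \<Rightarrow> ('a \<Rightarrow> real) \<Rightarrow> 'a set" where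
  "bubbles X r = (\<Union>x\<in>X. cball x (r x))"

text \<open>If \<open>U\<close> is the whole space, then \<open>frontier U\<close> is empty, \<open>infdist x {} = 0\<close>, and the quotient
  below is \<open>r x / 0 = 0\<close>, in accordance with the convention that the distance to the empty set
  is infinite. The supremum is taken in the extended reals so that it always exists.\<close>

definition champagne_subregion :: "'a::euclidean_space set \<Rightarrow> 'a set \<Rightarrow> ('a \<Rightarrow> real) \<Rightarrow> bool" where
  "champagne_subregion U X r \<longleftrightarrow>
     X \<subseteq> U \<and> countable X \<and> (\<forall>z\<in>U. \<not> z islimpt X) \<and>
     (\<forall>x\<in>X. 0 < r x \<and> r x < 1) \<and>
     pairwise (\<lambda>x x'. disjnt (cball x (r x)) (cball x' (r x'))) X \<and>
     (SUP x\<in>X. ereal (r x / infdist x (frontier U))) < 1 \<and>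
     (\<not> bounded U \<longrightarrow> (r \<longlongrightarrow> 0) (inf at_infinity (principal X)))"


subsection \<open>Brownian motion and harmonic measure\<close>

text \<open>Standard Brownian motion started at \<open>y\<close>; only times \<open>t \<ge> 0\<close> are relevant. The law of the
  increment over \<open>[s, t]\<close> is the centred Gaussian distribution with covariance \<open>(t - s) I\<close>.\<close>

locale brownian_motion = prob_space M for M :: "'w measure" +
  fixes B :: "real \<Rightarrow> 'w \<Rightarrow> 'a::euclidean_space" and y :: 'a
  assumes measurable_position: "\<And>t. 0 \<le> t \<Longrightarrow> random_variable borel (B t)"
    and start: "\<And>\<omega>. \<omega> \<in> space M \<Longrightarrow> B 0 \<omega> = y"
    and continuous_paths: "\<And>\<omega>. \<omega> \<in> space M \<Longrightarrow> continuous_on {0..} (\<lambda>t. B t \<omega>)"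
    and gaussian_increments: "\<And>s t. 0 \<le> s \<Longrightarrow> s < t \<Longrightarrow>
      distributed M lborel (\<lambda>\<omega>. B t \<omega> - B s \<omega>)
        (\<lambda>x. ennreal (\<Prod>b\<in>Basis. normal_density 0 (sqrt (t - s)) (x \<bullet> b)))"
    and independent_increments: "\<And>t :: nat \<Rightarrow> real. 0 \<le> t 0 \<Longrightarrow> strict_mono t \<Longrightarrow>
      indep_vars (\<lambda>_. borel) (\<lambda>i \<omega>. B (t (Suc i)) \<omega> - B (t i) \<omega>) UNIV"

definition exits :: "(real \<Rightarrow> 'w \<Rightarrow> 'a) \<Rightarrow> 'a set \<Rightarrow> 'w \<Rightarrow> bool" where
  "exits B W \<omega> \<longleftrightarrow> (\<exists>t\<ge>0. B t \<omega> \<notin> W)"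

definition exit_time :: "(real \<Rightarrow> 'w \<Rightarrow> 'a) \<Rightarrow> 'a set \<Rightarrow> 'w \<Rightarrow> real" where
  "exit_time B W \<omega> = Inf {t. 0 \<le> t \<and> B t \<omega> \<notin> W}"

text \<open>The harmonic measure \<open>\<mu>\<^sub>y\<^sup>W\<close>, where \<open>B\<close> is a Brownian motion on \<open>M\<close> started at \<open>y\<close>. Paths that
  never leave \<open>W\<close> do not contribute, so the total mass may be less than 1.\<close>

definition harmonic_measure ::
    "'w measure \<Rightarrow> (real \<Rightarrow> 'w \<Rightarrow> 'a::euclidean_space) \<Rightarrow> 'a set \<Rightarrow> 'a measure" where
  "harmonic_measure M B W =
     distr (restrict_space M {\<omega> \<in> space M. exits B W \<omega>}) borel (\<lambda>\<omega>. B (exit_time B W \<omega>) \<omega>)"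

text \<open>The harmonic measure does not depend on the Brownian motion used to represent it, since the
  law of Brownian motion started at \<open>y\<close> is unique. The sample points are taken in the type
  \<open>real \<Rightarrow> 'a\<close> of paths, which carries the canonical (Wiener) realization.\<close>

definition unavoidable :: "'a::euclidean_space set \<Rightarrow> 'a set \<Rightarrow> bool" where
  "unavoidable U A \<longleftrightarrow>
     closedin (top_of_set U) A \<and>
     (\<forall>y\<in>U - A. \<forall>(M :: (real \<Rightarrow> 'a) measure) B.
        brownian_motion M B y \<longrightarrow> emeasure (harmonic_measure M B (U - A)) A = 1)"

end

theory Submission
  imports Defs
begin

text \<open>
  Since \<open>\<beta>\<^sub>k f(\<alpha>\<^sub>k\<^sup>d\<^sup>-\<^sup>1) \<rightarrow> 0\<close> and \<open>\<beta>\<^sub>k \<ge> 1\<close>, we have \<open>f(t) \<rightarrow> 0\<close> as \<open>t \<rightarrow> 0\<close>.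
  Bubbles are spread over the whole volume of \<open>U\<close>: at scale \<open>\<rho>\<close>, a bubble of radius \<open>r\<close> with
  \<open>\<phi>(r) = const \<cdot> b \<rho>\<^sup>d\<close> in each cell of diameter about \<open>\<rho>\<close> acts on Brownian motion like killing at a
  rate proportional to \<open>b\<close>. The sum of \<open>\<phi>(r\<^sub>x)\<close> over a compact set stays bounded as \<open>\<rho> \<rightarrow> 0\<close>, whereas
  \<open>f(\<phi>(r\<^sub>x)) \<rightarrow> 0\<close>; so a killing rate that is as large as desired near the boundary of \<open>U\<close> has
  arbitrarily small cost.

  Unavoidability follows from a Lyapunov function \<open>W = v - G\<close> (up to a constant), where \<open>v\<close> grows to
  \<open>N\<close> outside a compact set \<open>K\<^sub>N\<close> and is bounded at the starting point independently of \<open>N\<close>, while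
  \<open>0 \<le> G \<le> 2\<^sup>d\<close> is a maximum of cell correctors, truncations of
  \<open>c (\<psi>(|x - p|\<^sup>2) - \<psi>(4\<rho>\<^sup>2)) + b (|x - p|\<^sup>2 - 4\<rho>\<^sup>2)\<close> with \<open>\<psi>(|\<cdot>|\<^sup>2)\<close> the fundamental solution. Off the
  bubbles \<open>G\<close> has Laplacian at least \<open>2db\<close>, which beats that of \<open>v\<close>. Hence \<open>W\<close> decreases in mean
  along Brownian motion off the bubbles, and the probability of leaving \<open>K\<^sub>N\<close> without having met a
  bubble is at most \<open>W(y)/N\<close>. Working with upper second-order expansions at a point, rather than with
  derivatives, makes the class of such functions stable under minima; discretising time makes
  the strong Markov property and stochastic integration unnecessary.
\<close>

section \<open>Gaussian increments and Lyapunov functions\<close>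

definition gauss :: "real \<Rightarrow> 'a::euclidean_space measure" where
  "gauss h = density lborel (\<lambda>x. ennreal (\<Prod>b\<in>Basis. normal_density 0 (sqrt h) (x \<bullet> b)))"

lemma space_gauss [simp]: "space (gauss h) = UNIV"
  and sets_gauss [simp, measurable_cong]: "sets (gauss h) = sets borel"
  by (simp_all add: gauss_def)

text \<open>The density is a product over the coordinates and \<open>lborel\<close> is the image of
  a product of one-dimensional Lebesgue measures, so Fubini factors the integral. The coordinate and
  mixed moments below come from this by putting the constant 1 in the remaining factors.\<close>

lemma gauss_prod:
  fixes f :: "'a::euclidean_space \<Rightarrow> real \<Rightarrow> real"
  assumes f [measurable]: "\<And>b. b \<in> Basis \<Longrightarrow> f b \<in> borel_measurable borel"
    and int: "\<And>b. b \<in> Basis \<Longrightarrow> integrable lborel (\<lambda>t. normal_density 0 (sqrt h) t * f b t)"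
  shows "integrable (gauss h) (\<lambda>x::'a. \<Prod>b\<in>Basis. f b (x \<bullet> b))" (is ?I)
    and "integral\<^sup>L (gauss h) (\<lambda>x::'a. \<Prod>b\<in>Basis. f b (x \<bullet> b))
         = (\<Prod>b\<in>Basis. \<integral>t. normal_density 0 (sqrt h) t * f b t \<partial>lborel)" (is ?E)
proof -
  let ?g = "\<lambda>b t. normal_density 0 (sqrt h) t * f b t"
  interpret P: product_sigma_finite "\<lambda>b::'a. (lborel :: real measure)" ..
  have 1: "integrable (gauss h) F = integrable lborel (\<lambda>x::'a. (\<Prod>b\<in>Basis. normal_density 0 (sqrt h) (x \<bullet> b)) * F x)"
    "integral\<^sup>L (gauss h) F = integral\<^sup>L lborel (\<lambda>x::'a. (\<Prod>b\<in>Basis. normal_density 0 (sqrt h) (x \<bullet> b)) * F x)"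
    if [measurable]: "F \<in> borel_measurable borel" for F :: "'a \<Rightarrow> real"
  proof -
    let ?n = "\<lambda>x::'a. \<Prod>b\<in>Basis. normal_density 0 (sqrt h) (x \<bullet> b)"
    have n: "?n \<in> borel_measurable lborel" "AE x in lborel. 0 \<le> ?n x"
      by (auto intro!: AE_I2 prod_nonneg)
    show "integrable (gauss h) F = integrable lborel (\<lambda>x. ?n x * F x)"
      "integral\<^sup>L (gauss h) F = integral\<^sup>L lborel (\<lambda>x. ?n x * F x)"
      unfolding gauss_def
      by (subst integrable_density[OF _ n], simp, simp, subst integral_density[OF _ n], simp, simp)
  qed
  have 2: "(\<lambda>x::'a. (\<Prod>b\<in>Basis. normal_density 0 (sqrt h) (x \<bullet> b)) * (\<Prod>b\<in>Basis. f b (x \<bullet> b)))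
     = (\<lambda>x. \<Prod>b\<in>Basis. ?g b (x \<bullet> b))"
    by (simp add: prod.distrib)
  have m [measurable]: "(\<lambda>x::'a. \<Prod>b\<in>Basis. f b (x \<bullet> b)) \<in> borel_measurable borel"
    by measurable
  have m': "(\<lambda>x::'a. \<Prod>b\<in>Basis. ?g b (x \<bullet> b)) \<in> borel_measurable borel"
    by measurable
  have s: "(\<Prod>b\<in>Basis. ?g b ((\<Sum>c\<in>Basis. w c *\<^sub>R c) \<bullet> b)) = (\<Prod>b\<in>Basis. ?g b (w b))" for w :: "'a \<Rightarrow> real"
    by (rule prod.cong) auto
  have T: "(\<lambda>w. \<Sum>b\<in>Basis. w b *\<^sub>R b) \<in> measurable (Pi\<^sub>M Basis (\<lambda>b::'a. lborel)) borel"
    by measurable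
  have 3: "integrable lborel (\<lambda>x::'a. \<Prod>b\<in>Basis. ?g b (x \<bullet> b))"
    unfolding lborel_eq[where 'a='a] integrable_distr_eq[OF T m'] s
    by (rule P.product_integrable_prod[OF finite_Basis int])
  have 4: "integral\<^sup>L lborel (\<lambda>x::'a. \<Prod>b\<in>Basis. ?g b (x \<bullet> b)) = (\<Prod>b\<in>Basis. \<integral>t. ?g b t \<partial>lborel)"
    unfolding lborel_eq[where 'a='a] integral_distr[OF T m'] s
    by (rule P.product_integral_prod[OF finite_Basis int])
  show ?I unfolding 1(1)[OF m] 2 by (rule 3)
  show ?E unfolding 1(2)[OF m] 2 by (rule 4)
qed

lemma norm_sq_coords: "(norm z)\<^sup>2 = (\<Sum>b\<in>Basis. (z \<bullet> b)\<^sup>2)" for z :: "'a::euclidean_space"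
  unfolding power2_norm_eq_inner by (subst euclidean_inner) (simp add: power2_eq_square)

context
  fixes h :: real
  assumes h: "h > 0"
begin

lemma prob_space_gauss: "prob_space (gauss h :: 'a::euclidean_space measure)"
proof
  let ?n = "normal_density 0 (sqrt h)"
  have 1: "(\<integral>\<^sup>+t. ennreal (?n t) \<partial>lborel) = 1"
    using h by (subst nn_integral_eq_integral) simp_all
  have "emeasure (gauss h :: 'a measure) (space (gauss h)) = integral\<^sup>N lborel (\<lambda>x::'a. \<Prod>b\<in>Basis. ennreal (?n (x \<bullet> b)))"
    by (simp add: gauss_def emeasure_density prod_ennreal)
  also have "\<dots> = (\<Prod>b\<in>(Basis::'a set). \<integral>\<^sup>+t. ennreal (?n t) \<partial>lborel)"
    by (rule nn_integral_lborel_prod) simp_all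
  finally show "emeasure (gauss h :: 'a measure) (space (gauss h)) = 1"
    by (simp add: 1)
qed

lemma gauss_coord:
  fixes g :: "real \<Rightarrow> real" and b :: "'a::euclidean_space"
  assumes b: "b \<in> Basis" and [measurable]: "g \<in> borel_measurable borel"
    and int: "integrable lborel (\<lambda>t. normal_density 0 (sqrt h) t * g t)"
  shows "integrable (gauss h) (\<lambda>x::'a. g (x \<bullet> b))"
    "integral\<^sup>L (gauss h) (\<lambda>x::'a. g (x \<bullet> b)) = (\<integral>t. normal_density 0 (sqrt h) t * g t \<partial>lborel)"
proof -
  let ?f = "\<lambda>c t. if c = b then g t else 1"
  have e: "(\<Prod>c\<in>Basis. ?f c (x \<bullet> c)) = g (x \<bullet> b)" for x
    using b by (simp add: prod.If_cases Int_absorb1 Collect_conv_if)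
  have i: "(\<integral>t. normal_density 0 (sqrt h) t * ?f c t \<partial>lborel)
     = (if c = b then \<integral>t. normal_density 0 (sqrt h) t * g t \<partial>lborel else 1)" for c
    using h by simp
  have e': "(\<Prod>c\<in>Basis. \<integral>t. normal_density 0 (sqrt h) t * ?f c t \<partial>lborel) = (\<integral>t. normal_density 0 (sqrt h) t * g t \<partial>lborel)"
    unfolding i using b by simp
  have int': "integrable lborel (\<lambda>t. normal_density 0 (sqrt h) t * ?f c t)" for c
    using h int by (cases "c = b") auto
  show "integrable (gauss h) (\<lambda>x::'a. g (x \<bullet> b))"
    using gauss_prod(1)[of ?f h, OF _ int'] unfolding e by simp
  show "integral\<^sup>L (gauss h) (\<lambda>x::'a. g (x \<bullet> b)) = (\<integral>t. normal_density 0 (sqrt h) t * g t \<partial>lborel)"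
    using gauss_prod(2)[of ?f h, OF _ int'] unfolding e e' by simp
qed

lemma gauss_mixed:
  fixes b c :: "'a::euclidean_space"
  assumes b: "b \<in> Basis" "c \<in> Basis" "b \<noteq> c"
  shows "integrable (gauss h) (\<lambda>x::'a. (x \<bullet> b) * (x \<bullet> c))"
    "integral\<^sup>L (gauss h) (\<lambda>x::'a. (x \<bullet> b) * (x \<bullet> c)) = 0"
proof -
  let ?f = "\<lambda>a t. if a = b then t else if a = c then t else (1::real)"
  have e: "(\<Prod>a\<in>Basis. ?f a (x \<bullet> a)) = (x \<bullet> b) * (x \<bullet> c)" for x :: 'a
  proof -
    have "(\<Prod>a\<in>Basis. ?f a (x \<bullet> a)) = (\<Prod>a\<in>Basis. (if a = b then x \<bullet> b else 1) * (if a = c then x \<bullet> c else 1))"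
      using b by (intro prod.cong) auto
    also have "\<dots> = (x \<bullet> b) * (x \<bullet> c)" using b by (simp add: prod.distrib)
    finally show ?thesis .
  qed
  \<comment> \<open>The factor at \<open>b\<close> is odd, so it alone makes the whole product of
    integrals vanish.\<close>
  have z: "(\<integral>t. normal_density 0 (sqrt h) t * ?f b t \<partial>lborel) = 0"
    using integral_normal_moment_nz_1[of "sqrt h" 0] h by simp
  have e': "(\<Prod>a\<in>Basis. \<integral>t. normal_density 0 (sqrt h) t * ?f a t \<partial>lborel) = 0"
    using b(1) z by (intro prod_zero) (auto intro!: bexI[of _ b])
  have int': "integrable lborel (\<lambda>t. normal_density 0 (sqrt h) t * ?f a t)" for a
    using h integrable_normal_moment_nz_1[of "sqrt h" 0] by (cases "a = b"; cases "a = c") auto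
  show "integrable (gauss h) (\<lambda>x::'a. (x \<bullet> b) * (x \<bullet> c))"
    using gauss_prod(1)[of ?f h, OF _ int'] unfolding e by simp
  show "integral\<^sup>L (gauss h) (\<lambda>x::'a. (x \<bullet> b) * (x \<bullet> c)) = 0"
    using gauss_prod(2)[of ?f h, OF _ int'] unfolding e e' by simp
qed

lemma gauss_coord_power:
  fixes b :: "'a::euclidean_space"
  assumes b: "b \<in> Basis"
  shows "integrable (gauss h) (\<lambda>x::'a. (x \<bullet> b) ^ k)"
    "integral\<^sup>L (gauss h) (\<lambda>x::'a. x \<bullet> b) = 0"
    "integral\<^sup>L (gauss h) (\<lambda>x::'a. (x \<bullet> b) ^ 2) = h"
    "integral\<^sup>L (gauss h) (\<lambda>x::'a. (x \<bullet> b) ^ 4) = 3 * h\<^sup>2"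
proof -
  have I: "integrable lborel (\<lambda>t. normal_density 0 (sqrt h) t * t ^ k)" for k
    using integrable_normal_moment[of "sqrt h" 0 k] h by simp
  show "integrable (gauss h) (\<lambda>x::'a. (x \<bullet> b) ^ k)"
    by (rule gauss_coord(1)[OF b _ I]) simp
  show "integral\<^sup>L (gauss h) (\<lambda>x::'a. x \<bullet> b) = 0"
    using gauss_coord(2)[OF b _ I[of 1]] integral_normal_moment_nz_1[of "sqrt h" 0] h by simp
  show "integral\<^sup>L (gauss h) (\<lambda>x::'a. (x \<bullet> b) ^ 2) = h"
    using gauss_coord(2)[OF b _ I[of 2]] integral_normal_moment_even[of "sqrt h" 0 1] h
    by simp
  show "integral\<^sup>L (gauss h) (\<lambda>x::'a. (x \<bullet> b) ^ 4) = 3 * h\<^sup>2"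
    using gauss_coord(2)[OF b _ I[of 4]] integral_normal_moment_even[of "sqrt h" 0 2] h
    by (simp add: fact_numeral power2_eq_square field_simps)
qed

lemma gauss_inner:
  fixes l :: "'a::euclidean_space"
  shows "integrable (gauss h) (\<lambda>z. l \<bullet> z)" "integral\<^sup>L (gauss h) (\<lambda>z. l \<bullet> z) = 0"
proof -
  have e: "(\<lambda>z. l \<bullet> z) = (\<lambda>z. \<Sum>b\<in>Basis. (l \<bullet> b) * (z \<bullet> b))"
    by (rule ext) (rule euclidean_inner)
  have i: "integrable (gauss h) (\<lambda>z::'a. z \<bullet> b)" if "b \<in> Basis" for b
    using gauss_coord_power(1)[OF that, of 1] by simp
  show "integrable (gauss h) (\<lambda>z. l \<bullet> z)" "integral\<^sup>L (gauss h) (\<lambda>z. l \<bullet> z) = 0"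
    by (subst e, use i in \<open>simp add: gauss_coord_power\<close>)+
qed

lemma gauss_inner_sq:
  fixes p :: "'a::euclidean_space"
  shows "integrable (gauss h) (\<lambda>z. (p \<bullet> z)\<^sup>2)" "integral\<^sup>L (gauss h) (\<lambda>z. (p \<bullet> z)\<^sup>2) = h * (norm p)\<^sup>2"
proof -
  have e: "(\<lambda>z. (p \<bullet> z)\<^sup>2) = (\<lambda>z. \<Sum>b\<in>Basis. \<Sum>c\<in>Basis. ((p \<bullet> b) * (p \<bullet> c)) * ((z \<bullet> b) * (z \<bullet> c)))"
  proof
    fix z
    have "(p \<bullet> z)\<^sup>2 = (\<Sum>b\<in>Basis. (p \<bullet> b) * (z \<bullet> b)) * (\<Sum>c\<in>Basis. (p \<bullet> c) * (z \<bullet> c))"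
      unfolding power2_eq_square by (simp only: euclidean_inner[of p z])
    also have "\<dots> = (\<Sum>b\<in>Basis. \<Sum>c\<in>Basis. ((p \<bullet> b) * (p \<bullet> c)) * ((z \<bullet> b) * (z \<bullet> c)))"
      by (simp add: sum_product mult_ac)
    finally show "(p \<bullet> z)\<^sup>2 = \<dots>" .
  qed
  have i: "integrable (gauss h) (\<lambda>z::'a. (z \<bullet> b) * (z \<bullet> c))"
    "integral\<^sup>L (gauss h) (\<lambda>z::'a. (z \<bullet> b) * (z \<bullet> c)) = (if b = c then h else 0)"
    if "b \<in> Basis" "c \<in> Basis" for b c
    using gauss_mixed[OF that] gauss_coord_power(1)[OF that(1), of 2] gauss_coord_power(3)[OF that(1)]
    by (auto simp: power2_eq_square)
  show "integrable (gauss h) (\<lambda>z. (p \<bullet> z)\<^sup>2)"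
    unfolding e by (intro Bochner_Integration.integrable_sum integrable_mult_right i)
  have "integral\<^sup>L (gauss h) (\<lambda>z. (p \<bullet> z)\<^sup>2)
      = (\<Sum>b\<in>Basis. \<Sum>c\<in>Basis. ((p \<bullet> b) * (p \<bullet> c)) * (if b = c then h else 0))"
    unfolding e
    by (subst Bochner_Integration.integral_sum, (intro Bochner_Integration.integrable_sum integrable_mult_right i; assumption),
        rule sum.cong[OF refl], subst Bochner_Integration.integral_sum,
        (intro integrable_mult_right i; assumption), rule sum.cong[OF refl]) (simp add: i)
  also have "\<dots> = h * (norm p)\<^sup>2"
    unfolding norm_sq_coords sum_distrib_left
    by (intro sum.cong refl) (simp add: power2_eq_square if_distrib mult_ac cong: if_cong)
  finally show "integral\<^sup>L (gauss h) (\<lambda>z. (p \<bullet> z)\<^sup>2) = h * (norm p)\<^sup>2" .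
qed

lemma gauss_norm_sq:
  shows "integrable (gauss h) (\<lambda>z::'a::euclidean_space. (norm z)\<^sup>2)"
    "integral\<^sup>L (gauss h) (\<lambda>z::'a. (norm z)\<^sup>2) = h * DIM('a)"
proof -
  have e: "(\<lambda>z::'a. (norm z)\<^sup>2) = (\<lambda>z. \<Sum>b\<in>Basis. (z \<bullet> b) ^ 2)"
    by (simp add: norm_sq_coords)
  show "integrable (gauss h) (\<lambda>z::'a. (norm z)\<^sup>2)"
    "integral\<^sup>L (gauss h) (\<lambda>z::'a. (norm z)\<^sup>2) = h * DIM('a)"
    unfolding e by (simp_all add: gauss_coord_power)
qed

text \<open>Cauchy-Schwarz over the coordinates reduces this to the fourth moments of the
  coordinates. What matters later is the order \<open>h\<^sup>2\<close>, which is negligible against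
  a drift of order \<open>h\<close>.\<close>

lemma gauss_norm_pow4:
  shows "integrable (gauss h) (\<lambda>z::'a::euclidean_space. (norm z) ^ 4)"
    "integral\<^sup>L (gauss h) (\<lambda>z::'a. (norm z) ^ 4) \<le> 3 * (DIM('a))\<^sup>2 * h\<^sup>2"
proof -
  have le: "(norm z) ^ 4 \<le> DIM('a) * (\<Sum>b\<in>Basis. (z \<bullet> b) ^ 4)" for z :: 'a
  proof -
    have "(norm z) ^ 4 = (\<Sum>b\<in>Basis. (z \<bullet> b) ^ 2)\<^sup>2"
      by (simp flip: norm_sq_coords power_mult)
    also have "\<dots> \<le> DIM('a) * (\<Sum>b\<in>Basis. ((z \<bullet> b) ^ 2)\<^sup>2)"
      using sum_squared_le_sum_of_squares[of "\<lambda>b. (z \<bullet> b) ^ 2" "Basis :: 'a set"] by (simp add: mult_ac)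
    finally show ?thesis by simp
  qed
  have i: "integrable (gauss h) (\<lambda>z::'a. DIM('a) * (\<Sum>b\<in>Basis. (z \<bullet> b) ^ 4))"
    by (simp add: gauss_coord_power)
  show I: "integrable (gauss h) (\<lambda>z::'a. (norm z) ^ 4)"
    by (rule Bochner_Integration.integrable_bound[OF i]) (auto intro!: AE_I2 order_trans[OF le abs_ge_self] simp del: sum_distrib_left)
  have "integral\<^sup>L (gauss h) (\<lambda>z::'a. (norm z) ^ 4)
      \<le> integral\<^sup>L (gauss h) (\<lambda>z::'a. DIM('a) * (\<Sum>b\<in>Basis. (z \<bullet> b) ^ 4))"
    by (rule integral_mono[OF I i le])
  also have "\<dots> = 3 * (DIM('a))\<^sup>2 * h\<^sup>2"
    by (simp add: gauss_coord_power power2_eq_square)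
  finally show "integral\<^sup>L (gauss h) (\<lambda>z::'a. (norm z) ^ 4) \<le> 3 * (DIM('a))\<^sup>2 * h\<^sup>2" .
qed

end

text \<open>A one-sided substitute for \<open>\<Delta>W \<le> -2\<close> on \<open>D\<close>: the trace of the quadratic form is half the
  Laplacian. The quartic error absorbs both the cubic Taylor remainder and large \<open>z\<close>.\<close>

definition lyapunov_on :: "'a::euclidean_space set \<Rightarrow> real \<Rightarrow> ('a \<Rightarrow> real) \<Rightarrow> bool" where
  "lyapunov_on D C W \<longleftrightarrow> (\<forall>x\<in>D. \<exists>(l::'a) (p::'a) (k::real) (e::real). k * DIM('a) + e * (norm p)\<^sup>2 \<le> - 1 \<and>
     (\<forall>z. W (x + z) \<le> W x + l \<bullet> z + k * (norm z)\<^sup>2 + e * (p \<bullet> z)\<^sup>2 + C * (norm z) ^ 4))"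

text \<open>Under the Gaussian law the linear term of the expansion integrates to 0, the quadratic
  terms to \<open>h\<close> times the trace, hence to at most \<open>- h\<close>, and the quartic
  term to \<open>O(h\<^sup>2)\<close>. The smallness condition on \<open>h\<close> lets the last eat
  at most half of the drift.\<close>

lemma lyapunov_step:
  fixes W :: "'a::euclidean_space \<Rightarrow> real"
  assumes L: "lyapunov_on D C W" and x: "x \<in> D" and h: "h > 0" "6 * C * (DIM('a))\<^sup>2 * h \<le> 1" and C: "C \<ge> 0"
    and W: "W \<in> borel_measurable borel" "\<And>x. \<bar>W x\<bar> \<le> K"
  shows "(\<integral>z. W (x + z) \<partial>gauss h) \<le> W x - h / 2"
proof -
  interpret prob_space "gauss h :: 'a measure" using h(1) by (rule prob_space_gauss)
  note [measurable] = W(1)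
  obtain l p :: 'a and k e :: real where tr: "k * DIM('a) + e * (norm p)\<^sup>2 \<le> - 1"
    and le: "\<And>z. W (x + z) \<le> W x + l \<bullet> z + k * (norm z)\<^sup>2 + e * (p \<bullet> z)\<^sup>2 + C * (norm z) ^ 4"
    using L x unfolding lyapunov_on_def by blast
  note G = gauss_inner[OF h(1)] gauss_inner_sq[OF h(1)] gauss_norm_sq[OF h(1)] gauss_norm_pow4(1)[OF h(1)]
  have i: "integrable (gauss h) (\<lambda>z. W (x + z))"
    by (rule integrable_const_bound[where B=K]) (use W(2) in auto)
  have "(\<integral>z. W (x + z) \<partial>gauss h)
     \<le> (\<integral>z. W x + l \<bullet> z + k * (norm z)\<^sup>2 + e * (p \<bullet> z)\<^sup>2 + C * (norm z) ^ 4 \<partial>gauss h)"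
    by (rule integral_mono[OF i _ le]) (auto simp: G)
  also have "\<dots> = W x + h * (k * DIM('a) + e * (norm p)\<^sup>2) + C * integral\<^sup>L (gauss h) (\<lambda>z::'a. (norm z) ^ 4)"
  proof -
    have "(\<integral>z. W x + l \<bullet> z + k * (norm z)\<^sup>2 + e * (p \<bullet> z)\<^sup>2 + C * (norm z) ^ 4 \<partial>gauss h)
      = W x + 0 + k * (h * DIM('a)) + e * (h * (norm p)\<^sup>2) + C * integral\<^sup>L (gauss h) (\<lambda>z::'a. (norm z) ^ 4)"
      by (simp add: G prob_space[simplified])
    then show ?thesis by (simp only: distrib_left mult_ac add_ac add_0_right)
  qed
  also have "\<dots> \<le> W x + h * (- 1) + C * (3 * (DIM('a))\<^sup>2 * h\<^sup>2)"
    by (intro add_mono mult_left_mono tr gauss_norm_pow4 h order_refl C) (use h in auto)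
  also have "C * (3 * (DIM('a))\<^sup>2 * h\<^sup>2) = (6 * C * (DIM('a))\<^sup>2 * h) * (h / 2)"
    by (simp add: power2_eq_square)
  also have "\<dots> \<le> 1 * (h / 2)"
    by (rule mult_right_mono) (use h in auto)
  finally show ?thesis by simp
qed

section \<open>Brownian motion observed on a time grid\<close>

text \<open>Independence turns the joint law into a product measure, and Fubini applies. This is the
  form in which the Markov property at a fixed time is used.\<close>

lemma (in prob_space) expectation_indep_var:
  fixes g :: "'b \<times> 'b \<Rightarrow> real"
  assumes ind: "indep_var S Q T X" and g [measurable]: "g \<in> borel_measurable (S \<Otimes>\<^sub>M T)"
    and bd: "\<And>z. \<bar>g z\<bar> \<le> K"
  shows "expectation (\<lambda>\<omega>. g (Q \<omega>, X \<omega>)) = (\<integral>q. \<integral>x. g (q, x) \<partial>distr M T X \<partial>distr M S Q)"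
proof -
  have rv [measurable]: "Q \<in> measurable M S" "X \<in> measurable M T"
    using ind by (auto dest: indep_var_rv1 indep_var_rv2)
  interpret Q: prob_space "distr M S Q" by (rule prob_space_distr) fact
  interpret X: prob_space "distr M T X" by (rule prob_space_distr) fact
  interpret QX: pair_prob_space "distr M S Q" "distr M T X" ..
  have gm: "g \<in> borel_measurable (distr M S Q \<Otimes>\<^sub>M distr M T X)"
    using g by (simp cong: measurable_cong_sets)
  have gi: "integrable (distr M S Q \<Otimes>\<^sub>M distr M T X) g"
    by (rule QX.P.integrable_const_bound[where B=K]) (use bd gm in auto)
  have "expectation (\<lambda>\<omega>. g (Q \<omega>, X \<omega>)) = integral\<^sup>L (distr M (S \<Otimes>\<^sub>M T) (\<lambda>\<omega>. (Q \<omega>, X \<omega>))) g"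
    by (subst integral_distr) auto
  also have "\<dots> = integral\<^sup>L (distr M S Q \<Otimes>\<^sub>M distr M T X) g"
    using ind unfolding indep_var_distribution_eq by simp
  also have "\<dots> = (\<integral>q. \<integral>x. g (q, x) \<partial>distr M T X \<partial>distr M S Q)"
    by (rule QX.integral_fst'[symmetric, OF gi])
  finally show ?thesis .
qed

context brownian_motion
begin

definition surv :: "real \<Rightarrow> 'a set \<Rightarrow> nat \<Rightarrow> 'w set" where
  "surv h D k = {\<omega>\<in>space M. \<forall>j\<le>k. B (real j * h) \<omega> \<in> D}"

text \<open>For disjoint \<open>D\<close> and \<open>H\<close>, a path whose first grid position
  outside \<open>D\<close> is not in \<open>H\<close> (later: a path caught in a bubble) drops out
  of both \<open>surv\<close> and \<open>jump\<close> from then on.\<close>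

definition jump :: "real \<Rightarrow> 'a set \<Rightarrow> 'a set \<Rightarrow> nat \<Rightarrow> 'w set" where
  "jump h D H k = {\<omega>\<in>space M. \<exists>j\<le>k. B (real j * h) \<omega> \<in> H \<and> (\<forall>i<j. B (real i * h) \<omega> \<in> D)}"

lemma surv_sets [measurable]:
  assumes "h \<ge> 0" and [measurable]: "D \<in> sets borel"
  shows "surv h D k \<in> sets M"
proof -
  have [measurable]: "B (real j * h) \<in> borel_measurable M" for j
    using assms by (intro measurable_position) auto
  show ?thesis unfolding surv_def by measurable
qed

lemma jump_sets [measurable]:
  assumes "h \<ge> 0" and [measurable]: "D \<in> sets borel" "H \<in> sets borel"
  shows "jump h D H k \<in> sets M"
proof -
  have [measurable]: "B (real j * h) \<in> borel_measurable M" for j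
    using assms by (intro measurable_position) auto
  show ?thesis unfolding jump_def by measurable
qed

lemma distr_increment:
  assumes h: "h > 0"
  shows "distr M borel (\<lambda>\<omega>. B (real (Suc k) * h) \<omega> - B (real k * h) \<omega>) = gauss h"
proof -
  have "distributed M lborel (\<lambda>\<omega>. B (real (Suc k) * h) \<omega> - B (real k * h) \<omega>)
        (\<lambda>x. ennreal (\<Prod>b\<in>Basis. normal_density 0 (sqrt (real (Suc k) * h - real k * h)) (x \<bullet> b)))"
    using h by (intro gaussian_increments) auto
  then have "distr M lborel (\<lambda>\<omega>. B (real (Suc k) * h) \<omega> - B (real k * h) \<omega>) = gauss h"
    by (simp add: distributed_def gauss_def algebra_simps)
  moreover have "distr M lborel (\<lambda>\<omega>. B (real (Suc k) * h) \<omega> - B (real k * h) \<omega>)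
     = distr M borel (\<lambda>\<omega>. B (real (Suc k) * h) \<omega> - B (real k * h) \<omega>)"
    by (rule distr_cong) auto
  ultimately show ?thesis by simp
qed

text \<open>Survival up to step \<open>k\<close> and the position at step \<open>k\<close> are
  functions of the first \<open>k\<close> increments, while the next increment is independent of
  these and Gaussian. So \<open>lyapunov_step\<close> can be applied at the current position, inside
  the integral over the past.\<close>

lemma surv_step:
  fixes W :: "'a \<Rightarrow> real"
  assumes L: "lyapunov_on D C W" and h: "h > 0" "6 * C * (DIM('a))\<^sup>2 * h \<le> 1" and C: "C \<ge> 0"
    and D [measurable]: "D \<in> sets borel"
    and W [measurable]: "W \<in> borel_measurable borel" and K: "\<And>x. \<bar>W x\<bar> \<le> K"
  shows "expectation (\<lambda>\<omega>. indicator (surv h D k) \<omega> * W (B (real (Suc k) * h) \<omega>))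
     \<le> expectation (\<lambda>\<omega>. indicator (surv h D k) \<omega> * W (B (real k * h) \<omega>)) - h / 2 * prob (surv h D k)"
proof -
  define X where "X i \<omega> = B (real (Suc i) * h) \<omega> - B (real i * h) \<omega>" for i \<omega>
  have meas [measurable]: "B (real j * h) \<in> borel_measurable M" for j
    using h by (intro measurable_position) auto
  have sv [measurable]: "surv h D k \<in> sets M" using h by (intro surv_sets) auto
  have "indep_vars (\<lambda>_. borel) (\<lambda>i \<omega>. B (real (Suc i) * h) \<omega> - B (real i * h) \<omega>) UNIV"
    using h by (intro independent_increments[of "\<lambda>i. real i * h"]) (auto intro!: strict_monoI)
  then have iv: "indep_vars (\<lambda>_. borel) X UNIV" unfolding X_def[abs_def] .
  define Q where "Q \<omega> = restrict (\<lambda>i. X i \<omega>) {..<k}" for \<omega>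
  let ?S = "PiM {..<k} (\<lambda>_. borel :: 'a measure)"
  let ?T = "PiM {k} (\<lambda>_. borel :: 'a measure)"
  \<comment> \<open>The next increment is kept as a family over \<open>{k}\<close>, so that past and
    increment take values in one type, as \<open>indep_var\<close> demands.\<close>
  define R where "R \<omega> = restrict (\<lambda>i. X i \<omega>) {k}" for \<omega>
  have ind: "indep_var ?S Q ?T R"
    unfolding Q_def[abs_def] R_def[abs_def] by (rule indep_var_restrict[OF iv]) auto
  \<comment> \<open>Positions are rebuilt from the increments alone; this makes survival a
    measurable set \<open>E\<close> of increment tuples.\<close>
  define pos where "pos j q = y + (\<Sum>i<j. q i)" for j and q :: "nat \<Rightarrow> 'a"
  have pm [measurable]: "pos j \<in> borel_measurable ?S" if "j \<le> k" for j
  proof -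
    have "(\<lambda>q. q i) \<in> borel_measurable ?S" if "i < j" for i
      using that \<open>j \<le> k\<close> by (intro measurable_component_singleton) auto
    then show ?thesis unfolding pos_def[abs_def] by (intro borel_measurable_add borel_measurable_sum) auto
  qed
  have posQ: "pos j (Q \<omega>) = B (real j * h) \<omega>" if "j \<le> k" "\<omega> \<in> space M" for j \<omega>
  proof -
    have "(\<Sum>i<j. Q \<omega> i) = (\<Sum>i<j. X i \<omega>)"
      using that by (intro sum.cong) (auto simp: Q_def)
    also have "\<dots> = B (real j * h) \<omega> - B (real 0 * h) \<omega>"
      unfolding X_def by (rule sum_lessThan_telescope)
    finally show ?thesis using start[OF that(2)] by (simp add: pos_def)
  qed
  define E where "E = {q\<in>space ?S. \<forall>j\<le>k. pos j q \<in> D}"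
  have E [measurable]: "E \<in> sets ?S"
  proof -
    have "E = (\<Inter>j\<in>{..k}. pos j -` D \<inter> space ?S)" by (auto simp: E_def)
    also have "\<dots> \<in> sets ?S" by (intro sets.finite_INT measurable_sets[OF pm]) auto
    finally show ?thesis .
  qed
  have QE: "indicator E (Q \<omega>) = (indicator (surv h D k) \<omega> :: real)" if "\<omega> \<in> space M" for \<omega>
  proof -
    have "Q \<omega> \<in> space ?S" by (simp add: Q_def space_PiM)
    then show ?thesis using that by (auto simp: E_def surv_def posQ indicator_def)
  qed
  define g where "g = (\<lambda>(q, w). indicator E q * W (pos k q + w k))"
  have gm [measurable]: "g \<in> borel_measurable (?S \<Otimes>\<^sub>M ?T)"
    unfolding g_def using pm[OF order_refl] by measurable
  have gb: "\<bar>g z\<bar> \<le> K" for z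
    using K[of "pos k (fst z) + snd z k"] order_trans[OF abs_ge_zero K[of 0]]
    by (auto simp: g_def indicator_def split: prod.splits)
  have Qm [measurable]: "Q \<in> measurable M ?S" using ind by (rule indep_var_rv1)
  interpret Q: prob_space "distr M ?S Q" by (rule prob_space_distr) fact
  have Rm [measurable]: "R \<in> measurable M ?T" using ind by (rule indep_var_rv2)
  have Xm [measurable]: "X k \<in> borel_measurable M" unfolding X_def[abs_def] by measurable
  have dX: "distr M borel (X k) = gauss h"
    unfolding X_def[abs_def] by (rule distr_increment) fact
  have inner: "(\<integral>w. g (q, w) \<partial>distr M ?T R) = indicator E q * (\<integral>x. W (pos k q + x) \<partial>gauss h)" for q
  proof -
    have "(\<integral>w. W (pos k q + w k) \<partial>distr M ?T R) = (\<integral>\<omega>. W (pos k q + X k \<omega>) \<partial>M)"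
      by (subst integral_distr) (auto simp: R_def)
    also have "\<dots> = (\<integral>x. W (pos k q + x) \<partial>gauss h)"
      unfolding dX[symmetric] by (subst integral_distr) auto
    finally show ?thesis by (simp add: g_def)
  qed
  interpret R: prob_space "distr M ?T R" by (rule prob_space_distr) fact
  have "expectation (\<lambda>\<omega>. indicator (surv h D k) \<omega> * W (B (real (Suc k) * h) \<omega>))
     = expectation (\<lambda>\<omega>. g (Q \<omega>, R \<omega>))"
    by (rule Bochner_Integration.integral_cong) (simp_all add: g_def QE posQ X_def R_def)
  also have "\<dots> = (\<integral>q. \<integral>w. g (q, w) \<partial>distr M ?T R \<partial>distr M ?S Q)"
    by (rule expectation_indep_var[OF ind gm gb])
  also have "\<dots> \<le> (\<integral>q. indicator E q * (W (pos k q) - h / 2) \<partial>distr M ?S Q)"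
  proof (rule integral_mono)
    have b: "\<bar>indicator E q * (W (pos k q) - h / 2)\<bar> \<le> K + h / 2" for q
      using K[of "pos k q"] h(1) order_trans[OF abs_ge_zero K[of 0]] by (auto simp: indicator_def abs_if split: if_splits)
    show "integrable (distr M ?S Q) (\<lambda>q. indicator E q * (W (pos k q) - h / 2))"
      by (rule Q.integrable_const_bound[where B="K + h/2"]) (use b pm[OF order_refl] in auto)
    have "(\<lambda>q. \<integral>w. g (q, w) \<partial>distr M ?T R) \<in> borel_measurable ?S"
      using gm by (intro R.borel_measurable_lebesgue_integral) (simp cong: measurable_cong_sets)
    moreover have "\<bar>\<integral>w. g (q, w) \<partial>distr M ?T R\<bar> \<le> K" if q: "q \<in> space ?S" for q
    proof -
      have gq: "(\<lambda>w. g (q, w)) \<in> borel_measurable ?T"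
        using gm q by (rule measurable_Pair2)
      have "\<bar>\<integral>w. g (q, w) \<partial>distr M ?T R\<bar> \<le> (\<integral>w. \<bar>g (q, w)\<bar> \<partial>distr M ?T R)" by (rule integral_abs_bound)
      also have "\<dots> \<le> (\<integral>w. K \<partial>distr M ?T R)"
        using gq by (intro integral_mono R.integrable_const_bound[where B=K]) (use gb order_trans[OF abs_ge_zero gb] in auto)
      finally show ?thesis using R.prob_space by simp
    qed
    ultimately show "integrable (distr M ?S Q) (\<lambda>q. \<integral>w. g (q, w) \<partial>distr M ?T R)"
      by (intro Q.integrable_const_bound[where B=K]) auto
    show "(\<integral>w. g (q, w) \<partial>distr M ?T R) \<le> indicator E q * (W (pos k q) - h / 2)" for q
    proof (cases "q \<in> E")
      case True
      then have "pos k q \<in> D" by (auto simp: E_def)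
      from lyapunov_step[OF L this h C W K] True show ?thesis by (simp add: inner)
    qed (simp add: inner)
  qed
  also have "\<dots> = expectation (\<lambda>\<omega>. indicator E (Q \<omega>) * (W (pos k (Q \<omega>)) - h / 2))"
    by (subst integral_distr) (use pm[OF order_refl] in auto)
  also have "\<dots> = expectation (\<lambda>\<omega>. indicator (surv h D k) \<omega> * W (B (real k * h) \<omega>) - indicator (surv h D k) \<omega> * (h / 2))"
    by (rule Bochner_Integration.integral_cong) (simp_all add: QE posQ right_diff_distrib)
  also have "\<dots> = expectation (\<lambda>\<omega>. indicator (surv h D k) \<omega> * W (B (real k * h) \<omega>)) - h / 2 * prob (surv h D k)"
  proof -
    have b: "\<bar>indicator (surv h D k) \<omega> * W (B (real k * h) \<omega>)\<bar> \<le> K" for \<omega>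
      using K order_trans[OF abs_ge_zero K[of 0]] by (auto simp: indicator_def)
    have "integrable M (\<lambda>\<omega>. indicator (surv h D k) \<omega> * W (B (real k * h) \<omega>))"
      by (rule integrable_const_bound[where B=K]) (use b in auto)
    moreover have "integrable M (\<lambda>\<omega>. indicator (surv h D k) \<omega> * (h / 2) :: real)"
      by (intro integrable_mult_left integrable_const_bound[where B=1]) auto
    ultimately show ?thesis by (subst Bochner_Integration.integral_diff) auto
  qed
  finally show ?thesis .
qed

text \<open>Iteration of \<open>surv_step\<close>: the initial budget \<open>W y\<close> pays for
  the value still carried by surviving paths, for \<open>N\<close> per path that has passed into
  \<open>H\<close>, and for the time spent in \<open>D\<close>. The time term may use the current
  survival probability because that probability decreases in \<open>k\<close>. Large
  \<open>N\<close> will bound the escape probability; \<open>H\<close> empty will bound the survival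
  probability.\<close>

lemma chain_bound:
  fixes W :: "'a \<Rightarrow> real"
  assumes L: "lyapunov_on D C W" and h: "h > 0" "6 * C * (DIM('a))\<^sup>2 * h \<le> 1" and C: "C \<ge> 0"
    and D [measurable]: "D \<in> sets borel" and H [measurable]: "H \<in> sets borel"
    and W [measurable]: "W \<in> borel_measurable borel" and K: "\<And>x. W x \<le> K"
    and W0: "\<And>x. 0 \<le> W x" and N: "\<And>x. x \<in> H \<Longrightarrow> N \<le> W x" "N \<ge> 0"
    and y: "y \<in> D" and disj: "D \<inter> H = {}"
  shows "expectation (\<lambda>\<omega>. indicator (surv h D k) \<omega> * W (B (real k * h) \<omega>))
    + N * prob (jump h D H k) + h / 2 * k * prob (surv h D k) \<le> W y"
proof (induction k)
  case 0
  have s: "surv h D 0 = space M" using y start by (auto simp: surv_def)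
  have j: "jump h D H 0 = {}" using y start disj by (auto simp: jump_def)
  have "expectation (\<lambda>\<omega>. indicator (surv h D 0) \<omega> * W (B (real 0 * h) \<omega>)) = expectation (\<lambda>\<omega>. W y)"
    by (rule Bochner_Integration.integral_cong) (simp_all add: s start)
  then show ?case by (simp add: j prob_space)
next
  case (Suc k)
  have meas [measurable]: "B (real j * h) \<in> borel_measurable M" for j
    using h by (intro measurable_position) auto
  have sv [measurable]: "surv h D k \<in> sets M" for k using h by (intro surv_sets) auto
  have ju [measurable]: "jump h D H k \<in> sets M" for k using h by (intro jump_sets) auto
  \<comment> \<open>The paths that arrive in \<open>H\<close> exactly at step
    \<open>Suc k\<close>.\<close>
  define F where "F = surv h D k \<inter> {\<omega>\<in>space M. B (real (Suc k) * h) \<omega> \<in> H}"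
  have F [measurable]: "F \<in> sets M" unfolding F_def by measurable
  have iF: "integrable M (indicator F :: 'w \<Rightarrow> real)"
    by (rule integrable_const_bound[where B=1]) auto
  have K': "\<bar>W x\<bar> \<le> K" for x using W0 K by auto
  have int: "integrable M (\<lambda>\<omega>. indicator (surv h D i) \<omega> * W (B (real j * h) \<omega>))" for i j
  proof (rule integrable_const_bound[where B=K])
    show "AE \<omega> in M. norm (indicator (surv h D i) \<omega> * W (B (real j * h) \<omega>)) \<le> K"
      using K' order_trans[OF abs_ge_zero K'[of 0]] by (auto simp: indicator_def)
  qed measurable
  have "expectation (\<lambda>\<omega>. indicator (surv h D (Suc k)) \<omega> * W (B (real (Suc k) * h) \<omega>)) + N * prob F
    = expectation (\<lambda>\<omega>. indicator (surv h D (Suc k)) \<omega> * W (B (real (Suc k) * h) \<omega>) + N * indicator F \<omega>)"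
    using Bochner_Integration.integral_add[OF int[of "Suc k" "Suc k"] integrable_mult_right[OF iF, of N]] by simp
  \<comment> \<open>The new position of a surviving path lies in \<open>D\<close>, in
    \<open>H\<close>, or in neither. The three cases use equality, \<open>N \<le> W\<close> and
    \<open>0 \<le> W\<close> respectively.\<close>
  also have "\<dots> \<le> expectation (\<lambda>\<omega>. indicator (surv h D k) \<omega> * W (B (real (Suc k) * h) \<omega>))"
  proof (rule integral_mono)
    show "integrable M (\<lambda>\<omega>. indicator (surv h D (Suc k)) \<omega> * W (B (real (Suc k) * h) \<omega>) + N * indicator F \<omega>)"
      by (intro Bochner_Integration.integrable_add int integrable_mult_right iF)
    fix \<omega> assume "\<omega> \<in> space M"
    then show "indicator (surv h D (Suc k)) \<omega> * W (B (real (Suc k) * h) \<omega>) + N * indicator F \<omega>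
      \<le> indicator (surv h D k) \<omega> * W (B (real (Suc k) * h) \<omega>)"
      using W0[of "B (real (Suc k) * h) \<omega>"] N(1)[of "B (real (Suc k) * h) \<omega>"] disj
      by (auto simp: F_def indicator_def surv_def le_Suc_eq simp del: of_nat_Suc)
  qed (rule int)
  also have "\<dots> \<le> expectation (\<lambda>\<omega>. indicator (surv h D k) \<omega> * W (B (real k * h) \<omega>)) - h / 2 * prob (surv h D k)"
    by (rule surv_step[OF L h C D W K'])
  finally have 1: "expectation (\<lambda>\<omega>. indicator (surv h D (Suc k)) \<omega> * W (B (real (Suc k) * h) \<omega>)) + N * prob F
     + h / 2 * prob (surv h D k) \<le> expectation (\<lambda>\<omega>. indicator (surv h D k) \<omega> * W (B (real k * h) \<omega>))"
    by simp
  have "jump h D H (Suc k) \<subseteq> jump h D H k \<union> F"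
    by (auto simp: F_def jump_def surv_def le_Suc_eq less_Suc_eq_le simp del: of_nat_Suc)
  then have "prob (jump h D H (Suc k)) \<le> prob (jump h D H k \<union> F)"
    by (intro finite_measure_mono) auto
  also have "\<dots> \<le> prob (jump h D H k) + prob F"
    by (rule measure_Un_le) auto
  finally have 2: "N * prob (jump h D H (Suc k)) \<le> N * prob (jump h D H k) + N * prob F"
    using N(2) by (metis distrib_left mult_left_mono)
  have "prob (surv h D (Suc k)) \<le> prob (surv h D k)"
    by (intro finite_measure_mono) (auto simp: surv_def)
  then have 3: "h / 2 * Suc k * prob (surv h D (Suc k)) \<le> h / 2 * Suc k * prob (surv h D k)"
    using h by (intro mult_left_mono) auto
  also have "\<dots> = h / 2 * k * prob (surv h D k) + h / 2 * prob (surv h D k)"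
    by (simp add: algebra_simps)
  finally show ?case using 1 2 Suc.IH by linarith
qed

text \<open>Openness of \<open>H\<close> lets every sufficiently fine time grid detect the passage into \<open>H\<close>, so the event
  lies in the limit inferior of the grid events.\<close>

lemma escape_bound:
  fixes W :: "'a \<Rightarrow> real"
  assumes L: "lyapunov_on D C W" and C: "C \<ge> 0"
    and D [measurable]: "D \<in> sets borel" and H: "open H"
    and W [measurable]: "W \<in> borel_measurable borel" and K: "\<And>x. W x \<le> K"
    and W0: "\<And>x. 0 \<le> W x" and N: "\<And>x. x \<in> H \<Longrightarrow> N \<le> W x" "N > 0"
    and y: "y \<in> D" and disj: "D \<inter> H = {}"
  obtains Z where "Z \<in> sets M" "prob Z \<le> W y / N"
    "{\<omega>\<in>space M. (\<exists>T\<ge>0. B T \<omega> \<in> H \<and> (\<forall>s\<in>{0..T}. B s \<omega> \<in> D \<union> H))} \<subseteq> Z"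
proof -
  have Hs [measurable]: "H \<in> sets borel" using H by simp
  obtain n0 :: nat where n0: "6 * C * (DIM('a))\<^sup>2 \<le> real n0" using real_arch_simple by blast
  \<comment> \<open>The offset \<open>n0\<close> makes every grid fine enough for
    \<open>chain_bound\<close>; \<open>n\<close> then refines the grid without limit.\<close>
  define h where "h n = 1 / real (n0 + n + 1)" for n
  have h: "h n > 0" "6 * C * (DIM('a))\<^sup>2 * h n \<le> 1" for n
    using n0 by (auto simp: h_def field_simps)
  have ju [measurable]: "jump (h n) D H k \<in> sets M" for n k using h by (intro jump_sets) (auto intro: less_imp_le)
  define J where "J n = (\<Union>k. jump (h n) D H k)" for n
  have J [measurable]: "J n \<in> sets M" for n unfolding J_def by measurable
  have pJ: "prob (J n) \<le> W y / N" for n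
  proof -
    have inc: "incseq (\<lambda>k. jump (h n) D H k)"
      by (auto simp: incseq_def jump_def) (meson order_trans)
    have lim: "(\<lambda>k. prob (jump (h n) D H k)) \<longlonglongrightarrow> prob (J n)"
      unfolding J_def by (rule finite_Lim_measure_incseq[OF _ inc]) auto
    have "prob (jump (h n) D H k) \<le> W y / N" for k
    proof -
      have "expectation (\<lambda>\<omega>. indicator (surv (h n) D k) \<omega> * W (B (real k * h n) \<omega>)) \<ge> 0"
        by (intro integral_nonneg_AE) (auto simp: W0)
      moreover have "h n / 2 * k * prob (surv (h n) D k) \<ge> 0" using h(1)[of n] by simp
      moreover note chain_bound[OF L h C D Hs W K W0 N(1) _ y disj, of n k]
      ultimately have "N * prob (jump (h n) D H k) \<le> W y" using N(2) by linarith
      then show ?thesis using N(2) by (simp add: field_simps)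
    qed
    then show ?thesis by (intro LIMSEQ_le_const2[OF lim]) auto
  qed
  define Z where "Z = (\<Union>n. \<Inter>m\<in>{n..}. J m)"
  have I [measurable]: "(\<Inter>m\<in>{n..}. J m) \<in> sets M" for n by (intro sets.countable_INT') auto
  have lim: "(\<lambda>n. prob (\<Inter>m\<in>{n..}. J m)) \<longlonglongrightarrow> prob Z"
    unfolding Z_def by (rule finite_Lim_measure_incseq) (auto simp: incseq_def)
  have "prob (\<Inter>m\<in>{n..}. J m) \<le> W y / N" for n
    by (rule order_trans[OF finite_measure_mono pJ[of n]]) auto
  then have "prob Z \<le> W y / N" by (intro LIMSEQ_le_const2[OF lim]) auto
  moreover have "Z \<in> sets M" unfolding Z_def by measurable
  moreover have "{\<omega>\<in>space M. (\<exists>T\<ge>0. B T \<omega> \<in> H \<and> (\<forall>s\<in>{0..T}. B s \<omega> \<in> D \<union> H))} \<subseteq> Z"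
  proof safe
    fix \<omega> T assume \<omega>: "\<omega> \<in> space M" and T: "0 \<le> T" "B T \<omega> \<in> H" "\<forall>s\<in>{0..T}. B s \<omega> \<in> D \<union> H"
    have T0: "T > 0" using T start[OF \<omega>] y disj by (cases "T = 0") auto
    have "continuous_on {0..} (\<lambda>t. B t \<omega>)" using \<omega> by (rule continuous_paths)
    moreover have "T \<in> {0..}" using T by simp
    moreover obtain e where e: "e > 0" "ball (B T \<omega>) e \<subseteq> H"
      using H T(2) open_contains_ball by blast
    ultimately obtain d where d': "d > 0" "\<And>t. t \<in> {0..} \<Longrightarrow> dist t T < d \<Longrightarrow> dist (B t \<omega>) (B T \<omega>) < e"
      unfolding continuous_on_iff by meson
    have d: "d > 0" "\<And>t. t \<ge> 0 \<Longrightarrow> dist t T < d \<Longrightarrow> B t \<omega> \<in> H"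
      using d' e(2) by (auto simp: dist_commute subset_iff)
    obtain n1 :: nat where n1: "1 / d < real n1" "1 / T < real n1"
      using reals_Archimedean2[of "max (1/d) (1/T)"] by auto
    have "\<omega> \<in> J m" if m: "m \<ge> n1" for m
    proof -
      have hm: "h m < d" "h m < T"
      proof -
        have "1 / d < real (n0 + m + 1)" "1 / T < real (n0 + m + 1)" using n1 m by linarith+
        then show "h m < d" "h m < T" using d(1) T0 by (auto simp: h_def field_simps)
      qed
      \<comment> \<open>The last grid index not after \<open>T\<close>. Its time is within one step
        of \<open>T\<close>, so the path is in \<open>H\<close> there; the first grid visit
        \<open>j\<close> to \<open>H\<close> therefore exists and precedes \<open>T\<close>, and
        earlier grid positions must be in \<open>D\<close>.\<close>
      define k where "k = nat \<lfloor>T / h m\<rfloor>"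
      have k: "real k * h m \<le> T" "T < real k * h m + h m"
      proof -
        have "real k = of_int \<lfloor>T / h m\<rfloor>" using T(1) h(1)[of m] by (simp add: k_def)
        then have "real k \<le> T / h m" "T / h m < real k + 1" by linarith+
        then show "real k * h m \<le> T" "T < real k * h m + h m"
          using h(1)[of m] by (auto simp: field_simps)
      qed
      have kH: "B (real k * h m) \<omega> \<in> H"
        using k hm h(1)[of m] by (intro d(2)) (auto simp: dist_real_def)
      define j where "j = (LEAST j. B (real j * h m) \<omega> \<in> H)"
      have jH: "B (real j * h m) \<omega> \<in> H" and jk: "j \<le> k"
        unfolding j_def using kH by (auto intro: LeastI Least_le)
      have "B (real i * h m) \<omega> \<in> D" if "i < j" for i
      proof -
        have "real i * h m \<le> real k * h m"
          using that jk h(1)[of m] by (intro mult_right_mono) auto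
        then have "real i * h m \<in> {0..T}"
          using order_trans[OF _ k(1), of "real i * h m"] h(1)[of m] by simp
        then have "B (real i * h m) \<omega> \<in> D \<union> H" by (rule bspec[OF T(3)])
        moreover have "B (real i * h m) \<omega> \<notin> H" using that not_less_Least unfolding j_def by blast
        ultimately show ?thesis by auto
      qed
      then show ?thesis using \<omega> jH unfolding J_def jump_def by auto
    qed
    then show "\<omega> \<in> Z" unfolding Z_def by auto
  qed
  ultimately show thesis using that by blast
qed

text \<open>With \<open>H\<close> empty, \<open>chain_bound\<close> bounds \<open>h / 2 * k\<close>
  times the survival probability by \<open>W y\<close> for every \<open>k\<close>, which forces the
  limit of these probabilities to be 0.\<close>

lemma stay_null:
  fixes W :: "'a \<Rightarrow> real"
  assumes L: "lyapunov_on D C W" and C: "C \<ge> 0"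
    and D [measurable]: "D \<in> sets borel"
    and W [measurable]: "W \<in> borel_measurable borel" and K: "\<And>x. W x \<le> K"
    and W0: "\<And>x. 0 \<le> W x" and y: "y \<in> D"
  obtains Z where "Z \<in> null_sets M" "{\<omega>\<in>space M. (\<forall>t\<ge>0. B t \<omega> \<in> D)} \<subseteq> Z"
proof -
  obtain n0 :: nat where n0: "6 * C * (DIM('a))\<^sup>2 \<le> real n0" using real_arch_simple by blast
  define h where "h = 1 / real (n0 + 1)"
  have h: "h > 0" "6 * C * (DIM('a))\<^sup>2 * h \<le> 1"
    using n0 by (auto simp: h_def field_simps)
  have sv [measurable]: "surv h D k \<in> sets M" for k using h by (intro surv_sets) auto
  define Z where "Z = (\<Inter>k. surv h D k)"
  have Zs: "Z \<in> sets M" unfolding Z_def by measurable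
  have pZ: "h / 2 * k * prob Z \<le> W y" for k :: nat
  proof -
    have "h / 2 * k * prob Z \<le> h / 2 * k * prob (surv h D k)"
      using h by (intro mult_left_mono finite_measure_mono) (auto simp: Z_def)
    moreover have "expectation (\<lambda>\<omega>. indicator (surv h D k) \<omega> * W (B (real k * h) \<omega>)) \<ge> 0"
      by (intro integral_nonneg_AE) (auto simp: W0)
    moreover note chain_bound[OF L h C D _ W K W0, of "{}" 0 k] y
    ultimately show ?thesis by simp
  qed
  have "prob Z = 0"
  proof (rule ccontr)
    assume "prob Z \<noteq> 0"
    then have pos: "h / 2 * prob Z > 0" using h by (simp add: less_le)
    obtain k :: nat where "W y / (h / 2 * prob Z) < real k" using reals_Archimedean2 by blast
    then have "W y < h / 2 * k * prob Z" using pos by (simp add: field_simps)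
    then show False using pZ[of k] by simp
  qed
  then have "Z \<in> null_sets M" using Zs by (simp add: emeasure_eq_measure null_setsI)
  moreover have "{\<omega>\<in>space M. (\<forall>t\<ge>0. B t \<omega> \<in> D)} \<subseteq> Z"
    using h by (auto simp: Z_def surv_def)
  ultimately show thesis by (rule that)
qed

end

section \<open>Exit times and harmonic measure\<close>

context brownian_motion
begin

lemma exit_set_closed:
  assumes "open W" "\<omega> \<in> space M"
  shows "closed {t. 0 \<le> t \<and> B t \<omega> \<notin> W}"
proof -
  have "closed {t \<in> {0..}. B t \<omega> \<in> - W}"
    using continuous_closed_preimage[OF continuous_paths[OF assms(2)], of "- W"] assms(1)
    by (simp add: vimage_def Int_def closed_Compl)
  then show ?thesis by simp
qed

lemma exit_time_props:
  assumes "open W" "\<omega> \<in> space M" "exits B W \<omega>"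
  shows "0 \<le> exit_time B W \<omega>" "B (exit_time B W \<omega>) \<omega> \<notin> W"
    "\<And>t. 0 \<le> t \<Longrightarrow> t < exit_time B W \<omega> \<Longrightarrow> B t \<omega> \<in> W"
    "\<And>t. 0 \<le> t \<Longrightarrow> B t \<omega> \<notin> W \<Longrightarrow> exit_time B W \<omega> \<le> t"
proof -
  let ?S = "{t. 0 \<le> t \<and> B t \<omega> \<notin> W}"
  have ne: "?S \<noteq> {}" using assms(3) by (auto simp: exits_def)
  have bd: "bdd_below ?S" by (rule bdd_belowI[of _ 0]) auto
  have "Inf ?S \<in> ?S" by (rule closed_contains_Inf[OF ne bd exit_set_closed[OF assms(1,2)]])
  then show "0 \<le> exit_time B W \<omega>" "B (exit_time B W \<omega>) \<omega> \<notin> W" by (auto simp: exit_time_def)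
  show le: "exit_time B W \<omega> \<le> t" if "0 \<le> t" "B t \<omega> \<notin> W" for t
    unfolding exit_time_def using that bd by (intro cInf_lower) auto
  show "B t \<omega> \<in> W" if "0 \<le> t" "t < exit_time B W \<omega>" for t
    using le[OF that(1)] that(2) by force
qed

text \<open>By path continuity and compactness of the time interval, the closed complement of
  \<open>W\<close> is hit up to time \<open>t\<close> iff the distance to it gets arbitrarily small
  along a countable dense set of times.\<close>

lemma hit_before_measurable:
  assumes W: "open W" and t: "t \<ge> 0"
  shows "{\<omega>\<in>space M. \<exists>s\<in>{0..t}. B s \<omega> \<notin> W} \<in> sets M"
\<comment> \<open>The distance criterion would fail for \<open>W = UNIV\<close>, since
  \<open>infdist\<close> to the empty set is 0; there the event is simply empty.\<close>
proof (cases "W = UNIV")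
  case False
  define Q where "Q = insert t {q\<in>\<rat>. 0 \<le> q \<and> q \<le> t}"
  have cQ: "countable Q" unfolding Q_def
    by (intro countable_insert countable_subset[OF _ countable_rat]) auto
  have Qt: "q \<in> {0..t}" if "q \<in> Q" for q using that t by (auto simp: Q_def)
  have eq: "(\<exists>s\<in>{0..t}. B s \<omega> \<notin> W) \<longleftrightarrow> (\<forall>n::nat. \<exists>q\<in>Q. infdist (B q \<omega>) (- W) < 1 / real (Suc n))"
    if \<omega>: "\<omega> \<in> space M" for \<omega>
  proof
    let ?f = "\<lambda>s. infdist (B s \<omega>) (- W)"
    have cont: "continuous_on {0..t} ?f"
      by (intro continuous_on_infdist continuous_on_subset[OF continuous_paths[OF \<omega>]]) auto
    have cW: "closed (- W)" "- W \<noteq> {}" using W False by auto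
    {
      assume "\<exists>s\<in>{0..t}. B s \<omega> \<notin> W"
      then obtain s where s: "s \<in> {0..t}" "?f s = 0" by auto
      show "\<forall>n::nat. \<exists>q\<in>Q. ?f q < 1 / real (Suc n)"
      proof
        fix n :: nat
        have "0 < 1 / real (Suc n)" by simp
        then obtain d where d: "d > 0" "\<And>q. q \<in> {0..t} \<Longrightarrow> dist q s < d \<Longrightarrow> dist (?f q) (?f s) < 1 / real (Suc n)"
          using cont s(1) unfolding continuous_on_iff by meson
        show "\<exists>q\<in>Q. ?f q < 1 / real (Suc n)"
        proof (cases "t = 0")
          case True
          then show ?thesis using s by (intro bexI[of _ t]) (auto simp: Q_def)
        next
          case False
          then have "max 0 (s - d) < min t (s + d)" using s t d(1) by auto
          then obtain q where q: "q \<in> \<rat>" "max 0 (s - d) < q" "q < min t (s + d)"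
            using Rats_dense_in_real by blast
          then have "dist q s < d" "q \<in> {0..t}" by (auto simp: dist_real_def)
          from d(2)[OF this(2,1)] s(2) show ?thesis
            using q by (intro bexI[of _ q]) (auto simp: Q_def)
        qed
      qed
    next
      assume A: "\<forall>n::nat. \<exists>q\<in>Q. ?f q < 1 / real (Suc n)"
      obtain s where s: "s \<in> {0..t}" "\<forall>q\<in>{0..t}. ?f s \<le> ?f q"
        using continuous_attains_inf[OF _ _ cont] t by auto
      have "?f s = 0"
      proof (rule ccontr)
        assume "?f s \<noteq> 0"
        then have "?f s > 0" using infdist_nonneg[of "B s \<omega>" "- W"] by linarith
        then obtain n where n: "1 / real (Suc n) < ?f s" using nat_approx_posE by blast
        obtain q where "q \<in> Q" "?f q < 1 / real (Suc n)" using A by blast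
        with s(2) Qt n show False by force
      qed
      then have "B s \<omega> \<in> - W" using in_closed_iff_infdist_zero[OF cW] by blast
      then show "\<exists>s\<in>{0..t}. B s \<omega> \<notin> W" using s(1) by auto
    }
  qed
  have meas: "B q \<in> borel_measurable M" if "q \<in> Q" for q
    using Qt[OF that] by (intro measurable_position) auto
  have "{\<omega>\<in>space M. \<exists>s\<in>{0..t}. B s \<omega> \<notin> W}
      = {\<omega>\<in>space M. \<forall>n::nat. \<exists>q\<in>Q. infdist (B q \<omega>) (- W) < 1 / real (Suc n)}"
    using eq by auto
  also have "\<dots> \<in> sets M"
  proof (intro sets.sets_Collect_countable_All sets.sets_Collect_countable_Ex' cQ)
    fix n :: nat and q assume "q \<in> Q"
    have [measurable]: "(\<lambda>\<omega>. infdist (B q \<omega>) (- W)) \<in> borel_measurable M"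
      by (rule borel_measurable_continuous_on[OF _ meas[OF \<open>q \<in> Q\<close>]]) (intro continuous_intros)
    show "{\<omega> \<in> space M. infdist (B q \<omega>) (- W) < 1 / real (Suc n)} \<in> sets M"
      by measurable
  qed
  finally show ?thesis .
qed simp

lemma exits_measurable:
  assumes W: "open W"
  shows "{\<omega>\<in>space M. exits B W \<omega>} \<in> sets M"
proof -
  have "{\<omega>\<in>space M. exits B W \<omega>} = (\<Union>n::nat. {\<omega>\<in>space M. \<exists>s\<in>{0..real n}. B s \<omega> \<notin> W})"
    by (auto simp: exits_def) (meson atLeastAtMost_iff real_arch_simple)
  also have "\<dots> \<in> sets M" using hit_before_measurable[OF W] by auto
  finally show ?thesis .
qed

text \<open>The exit time is measurable by \<open>hit_before_measurable\<close>. Rounding it up to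
  multiples of \<open>1 / Suc n\<close> gives times with countably many values, at which the
  position is measurable; by continuity these positions converge to the exit position.\<close>

lemma exit_position_measurable:
  assumes W: "open W"
  shows "(\<lambda>\<omega>. B (exit_time B W \<omega>) \<omega>) \<in> borel_measurable (restrict_space M {\<omega>\<in>space M. exits B W \<omega>})"
    (is "_ \<in> borel_measurable ?R")
proof -
  have sp: "space ?R = {\<omega>\<in>space M. exits B W \<omega>}" by (auto simp: space_restrict_space)
  have [measurable]: "exit_time B W \<in> borel_measurable ?R"
    unfolding borel_measurable_iff_le
  proof
    fix a :: real
    show "{\<omega> \<in> space ?R. exit_time B W \<omega> \<le> a} \<in> sets ?R"
    proof (cases "a \<ge> 0")
      case True
      have "{\<omega> \<in> space ?R. exit_time B W \<omega> \<le> a} = {\<omega>\<in>space M. exits B W \<omega>} \<inter> {\<omega>\<in>space M. \<exists>s\<in>{0..a}. B s \<omega> \<notin> W}"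
      proof -
        have "exit_time B W \<omega> \<le> a \<longleftrightarrow> (\<exists>s\<in>{0..a}. B s \<omega> \<notin> W)" if "\<omega> \<in> space M" "exits B W \<omega>" for \<omega>
        proof
          assume "exit_time B W \<omega> \<le> a"
          then show "\<exists>s\<in>{0..a}. B s \<omega> \<notin> W"
            using exit_time_props(1,2)[OF W that] by (intro bexI[of _ "exit_time B W \<omega>"]) auto
        next
          assume "\<exists>s\<in>{0..a}. B s \<omega> \<notin> W"
          then show "exit_time B W \<omega> \<le> a"
            using exit_time_props(4)[OF W that] by force
        qed
        then show ?thesis unfolding sp by blast
      qed
      then show ?thesis using hit_before_measurable[OF W True] by (auto simp: sets_restrict_space)
    next
      case False
      then have "{\<omega> \<in> space ?R. exit_time B W \<omega> \<le> a} = {}"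
        unfolding sp using exit_time_props(1)[OF W] by force
      then show ?thesis by (simp only: sets.empty_sets)
    qed
  qed
  define k where "k n \<omega> = nat \<lceil>exit_time B W \<omega> * real (Suc n)\<rceil>" for n \<omega>
  have [measurable]: "k n \<in> measurable ?R (count_space UNIV)" for n
    unfolding k_def[abs_def] by measurable
  show ?thesis
  proof (rule borel_measurable_LIMSEQ_metric)
    show "(\<lambda>\<omega>. B (real (k n \<omega>) / real (Suc n)) \<omega>) \<in> borel_measurable ?R" for n
    proof (rule measurable_compose_countable[where f="\<lambda>i \<omega>. B (real i / real (Suc n)) \<omega>"])
      show "B (real i / real (Suc n)) \<in> borel_measurable ?R" for i
        by (intro measurable_restrict_space1 measurable_position) auto
    qed measurable
    fix \<omega> assume "\<omega> \<in> space ?R"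
    then have \<omega>: "\<omega> \<in> space M" "exits B W \<omega>" unfolding sp by auto
    let ?t = "exit_time B W \<omega>"
    have t: "?t \<ge> 0" by (rule exit_time_props(1)[OF W \<omega>])
    have k: "?t \<le> real (k n \<omega>) / real (Suc n)" "real (k n \<omega>) / real (Suc n) \<le> ?t + 1 / real (Suc n)" for n
    proof -
      have "real (k n \<omega>) = of_int \<lceil>?t * real (Suc n)\<rceil>"
        using t by (simp add: k_def)
      then have "?t * real (Suc n) \<le> real (k n \<omega>)" "real (k n \<omega>) \<le> ?t * real (Suc n) + 1"
        by linarith+
      note le = this
      have c: "real (Suc n) > 0" by simp
      show "?t \<le> real (k n \<omega>) / real (Suc n)" using le(1) c by (simp only: pos_le_divide_eq)
      have "?t + 1 / real (Suc n) = (?t * real (Suc n) + 1) / real (Suc n)"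
        by (subst add_divide_distrib) simp
      then show "real (k n \<omega>) / real (Suc n) \<le> ?t + 1 / real (Suc n)"
        using divide_right_mono[OF le(2) less_imp_le[OF c]] by (simp only:)
    qed
    have up: "(\<lambda>n. ?t + 1 / real (Suc n)) \<longlonglongrightarrow> ?t"
      using tendsto_add[OF tendsto_const LIMSEQ_Suc[OF lim_1_over_n], of ?t] by simp
    have lim: "(\<lambda>n. real (k n \<omega>) / real (Suc n)) \<longlonglongrightarrow> ?t"
      by (rule real_tendsto_sandwich[OF _ _ tendsto_const up]) (simp_all only: k eventually_True)
    show "(\<lambda>n. B (real (k n \<omega>) / real (Suc n)) \<omega>) \<longlonglongrightarrow> B ?t \<omega>"
      by (rule continuous_on_tendsto_compose[OF continuous_paths[OF \<omega>(1)] lim]) (use t in auto)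
  qed
qed

lemma harmonic_measure_eq_1:
  assumes W: "open W" and A [measurable]: "A \<in> sets borel"
    and Z: "Z \<in> null_sets M" "{\<omega>\<in>space M. \<not> (exits B W \<omega> \<and> B (exit_time B W \<omega>) \<omega> \<in> A)} \<subseteq> Z"
  shows "emeasure (harmonic_measure M B W) A = 1"
proof -
  let ?E = "{\<omega>\<in>space M. exits B W \<omega>}" and ?G = "{\<omega>\<in>space M. exits B W \<omega> \<and> B (exit_time B W \<omega>) \<omega> \<in> A}"
  let ?X = "\<lambda>\<omega>. B (exit_time B W \<omega>) \<omega>"
  note E = exits_measurable[OF W] and X = exit_position_measurable[OF W]
  have G: "?X -` A \<inter> space (restrict_space M ?E) = ?G" by (auto simp: space_restrict_space)
  have "?G \<in> sets (restrict_space M ?E)"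
    using measurable_sets[OF X A] unfolding G .
  then have Gs: "?G \<in> sets M" using E by (subst (asm) sets_restrict_space_iff) auto
  have "emeasure (harmonic_measure M B W) A = emeasure (restrict_space M ?E) ?G"
    unfolding harmonic_measure_def using X A by (simp add: emeasure_distr G)
  also have "\<dots> = emeasure M ?G" using E by (intro emeasure_restrict_space) auto
  also have "AE \<omega> in M. \<omega> \<in> ?G"
    using Z by (intro AE_I'[OF Z(1)]) auto
  then have "emeasure M ?G = 1" using Gs by (simp add: emeasure_eq_1_AE)
  finally show ?thesis .
qed

text \<open>A path that fails to exit into \<open>A\<close> either enters the complement of
  \<open>K N\<close> before meeting \<open>A\<close>, or stays in \<open>K N - A\<close> forever.
  The second event is null by \<open>stay_null\<close>; the first has probability at most
  \<open>b / N\<close> by \<open>escape_bound\<close>, with \<open>b\<close> independent of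
  \<open>N\<close>. Intersecting over \<open>N\<close> leaves a null set.\<close>

lemma harmonic_measure_eq_1_lyapunov:
  assumes U: "open (U - A)" "A \<subseteq> U" and A [measurable]: "A \<in> sets borel" and y: "y \<in> U - A"
    and K: "\<And>N. closed (K N)" "\<And>N. K N \<subseteq> U" "\<And>N. N \<ge> N0 \<Longrightarrow> y \<in> K N"
    and lyap: "\<And>N. N \<ge> N0 \<Longrightarrow> \<exists>C W c. C \<ge> 0 \<and> lyapunov_on (K N - A) C W \<and> W \<in> borel_measurable borel \<and>
      (\<forall>x. 0 \<le> W x \<and> W x \<le> c) \<and> (\<forall>x. x \<notin> K N \<longrightarrow> real N \<le> W x) \<and> W y \<le> b"
  shows "emeasure (harmonic_measure M B (U - A)) A = 1"
proof -
  let ?bad = "{\<omega>\<in>space M. \<not> (exits B (U - A) \<omega> \<and> B (exit_time B (U - A) \<omega>) \<omega> \<in> A)}"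
  have "\<exists>Z. Z \<in> sets M \<and> prob Z \<le> b / real N \<and> ?bad \<subseteq> Z" if N: "N \<ge> max N0 1" for N
  proof -
    have "N0 \<le> N" using N by simp
    from lyap[OF this] obtain C W c where W': "C \<ge> 0" "lyapunov_on (K N - A) C W" "W \<in> borel_measurable borel"
      "\<forall>x. 0 \<le> W x \<and> W x \<le> c" "\<forall>x. x \<notin> K N \<longrightarrow> real N \<le> W x" "W y \<le> b"
      by blast
    have W: "C \<ge> 0" "lyapunov_on (K N - A) C W" "W \<in> borel_measurable borel"
      "\<And>x. 0 \<le> W x" "\<And>x. W x \<le> c" "\<And>x. x \<in> - K N \<Longrightarrow> real N \<le> W x" "W y \<le> b"
      using W' by simp_all
    have D: "K N - A \<in> sets borel" "open (- K N)" "y \<in> K N - A" "(K N - A) \<inter> (- K N) = {}" "real N > 0"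
      using K(1)[of N] K(3)[of N] y N by auto
    obtain Z1 where Z1: "Z1 \<in> sets M" "prob Z1 \<le> W y / real N"
      "{\<omega>\<in>space M. (\<exists>T\<ge>0. B T \<omega> \<in> - K N \<and> (\<forall>s\<in>{0..T}. B s \<omega> \<in> (K N - A) \<union> (- K N)))} \<subseteq> Z1"
      using escape_bound[OF W(2,1) D(1,2) W(3,5,4,6) D(5,3,4)] by blast
    obtain Z2 where Z2: "Z2 \<in> null_sets M" "{\<omega>\<in>space M. (\<forall>t\<ge>0. B t \<omega> \<in> K N - A)} \<subseteq> Z2"
      using stay_null[OF W(2,1) D(1) W(3,5,4) D(3)] by blast
    have "?bad \<subseteq> Z1 \<union> Z2"
    proof
      fix \<omega> assume b: "\<omega> \<in> ?bad"
      then have \<omega>: "\<omega> \<in> space M" by simp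
      show "\<omega> \<in> Z1 \<union> Z2"
      proof (cases "exits B (U - A) \<omega>")
        case True
        let ?T = "exit_time B (U - A) \<omega>"
        note T = exit_time_props[OF U(1) \<omega> True]
        \<comment> \<open>An exit from \<open>U - A\<close> that misses \<open>A\<close> must leave
          \<open>U\<close>, hence also \<open>K N\<close>.\<close>
        have n: "B ?T \<omega> \<notin> U" using b True T(2) by auto
        have "B s \<omega> \<in> (K N - A) \<union> (- K N)" if "s \<in> {0..?T}" for s
        proof (cases "s = ?T")
          case True
          then show ?thesis using n K(2) by auto
        next
          case False
          then show ?thesis using T(3)[of s] that by auto
        qed
        moreover have "B ?T \<omega> \<in> - K N" using n K(2) by auto
        ultimately have "\<omega> \<in> Z1"
          using \<omega> T(1) by (intro subsetD[OF Z1(3)] CollectI conjI exI[of _ ?T] ballI)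
        then show ?thesis ..
      next
        case False
        then have in': "\<And>t. t \<ge> 0 \<Longrightarrow> B t \<omega> \<in> U - A" by (auto simp: exits_def)
        show ?thesis
        proof (cases "\<forall>t\<ge>0. B t \<omega> \<in> K N")
          case True
          then have "\<omega> \<in> Z2" using \<omega> in' by (intro subsetD[OF Z2(2)]) auto
          then show ?thesis ..
        next
          case False
          then obtain T where "T \<ge> 0" "B T \<omega> \<in> - K N" by auto
          moreover have "\<forall>s\<in>{0..T}. B s \<omega> \<in> (K N - A) \<union> (- K N)" using in' by auto
          ultimately have "\<omega> \<in> Z1"
            using \<omega> by (intro subsetD[OF Z1(3)] CollectI conjI exI[of _ T])
          then show ?thesis ..
        qed
      qed
    qed
    moreover have "prob (Z1 \<union> Z2) \<le> b / real N"
    proof -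
      have "prob (Z1 \<union> Z2) \<le> prob Z1 + prob Z2" using Z1 Z2 by (intro measure_Un_le) auto
      also have "prob Z2 = 0" using Z2(1) by (auto simp: measure_def)
      also have "prob Z1 + 0 \<le> b / real N"
        using Z1(2) W(7) D(5) by (simp add: field_simps)
      finally show ?thesis .
    qed
    ultimately show ?thesis using Z1 Z2 by (intro exI[of _ "Z1 \<union> Z2"]) auto
  qed
  then have "\<forall>N\<in>{max N0 1..}. \<exists>Z. Z \<in> sets M \<and> prob Z \<le> b / real N \<and> ?bad \<subseteq> Z"
    by blast
  from bchoice[OF this] obtain Z where
    "\<forall>N\<in>{max N0 1..}. Z N \<in> sets M \<and> prob (Z N) \<le> b / real N \<and> ?bad \<subseteq> Z N" ..
  then have Z: "\<And>N. N \<ge> max N0 1 \<Longrightarrow> Z N \<in> sets M \<and> prob (Z N) \<le> b / real N \<and> ?bad \<subseteq> Z N"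
    by blast
  define Z' where "Z' = (\<Inter>N\<in>{max N0 1..}. Z N)"
  have Zs: "Z' \<in> sets M" unfolding Z'_def using Z by (intro sets.countable_INT') auto
  have "(\<lambda>N. b / real N) \<longlonglongrightarrow> 0" by (rule lim_const_over_n)
  moreover have "\<exists>N0. \<forall>N\<ge>N0. prob Z' \<le> b / real N"
  proof (intro exI[of _ "max N0 1"] allI impI)
    fix N assume N: "max N0 1 \<le> N"
    then have "prob Z' \<le> prob (Z N)" using Z by (intro finite_measure_mono) (auto simp: Z'_def)
    then show "prob Z' \<le> b / real N" using Z[OF N] by auto
  qed
  ultimately have "prob Z' \<le> 0" by (rule LIMSEQ_le_const)
  then have "Z' \<in> null_sets M" using Zs measure_nonneg[of M Z'] by (intro null_setsI) (simp_all add: emeasure_eq_measure)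
  moreover have "?bad \<subseteq> Z'" unfolding Z'_def
    by (rule INT_greatest) (use Z in \<open>simp only: atLeast_iff\<close>)
  ultimately show ?thesis by (rule harmonic_measure_eq_1[OF U(1) A])
qed

end

section \<open>Cell correctors\<close>

text \<open>The factor that gives the first derivatives of both cases of \<open>newton\<close> one
  common formula, \<open>newton'\<close>.\<close>

definition newton_const :: "nat \<Rightarrow> real" where
  "newton_const d = (if d = 2 then 1 / 2 else real d / 2 - 1)"

text \<open>The fundamental solution written in the squared radius \<open>s\<close>: it is
  \<open>- ln |x|\<close> for \<open>d = 2\<close> and \<open>|x|\<close> to the power
  \<open>2 - d\<close> otherwise. The squared radius is a polynomial in the step \<open>z\<close>,
  so Taylor expansion in one real variable is enough.\<close>

definition newton :: "nat \<Rightarrow> real \<Rightarrow> real" where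
  "newton d s = (if d = 2 then - ln s / 2 else s powr (1 - real d / 2))"

definition newton' :: "nat \<Rightarrow> real \<Rightarrow> real" where
  "newton' d s = - newton_const d * s powr (- (real d / 2))"

definition newton'' :: "nat \<Rightarrow> real \<Rightarrow> real" where
  "newton'' d s = newton_const d * (real d / 2) * s powr (- (real d / 2 + 1))"

definition newton''' :: "nat \<Rightarrow> real \<Rightarrow> real" where
  "newton''' d s = - newton_const d * (real d / 2) * (real d / 2 + 1) * s powr (- (real d / 2 + 2))"

lemma newton_const_pos: "d \<ge> 2 \<Longrightarrow> newton_const d > 0"
  by (auto simp: newton_const_def)

lemma newton_phi:
  assumes "d \<ge> 2" "t > 0"
  shows "phi d t = 1 / newton d (t\<^sup>2)"
proof (cases "d = 2")
  case True
  then show ?thesis using assms by (simp add: phi_def newton_def ln_div ln_realpow)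
next
  case False
  have "(t\<^sup>2) powr (1 - real d / 2) = t powr (2 * (1 - real d / 2))"
    using assms by (simp add: powr_powr flip: powr_numeral)
  also have "2 * (1 - real d / 2) = - real (d - 2)"
    using assms by (simp add: of_nat_diff)
  also have "t powr (- real (d - 2)) = 1 / t ^ (d - 2)"
    unfolding powr_minus powr_realpow[OF assms(2)] by (simp add: inverse_eq_divide)
  finally show ?thesis using False by (simp add: phi_def newton_def)
qed

lemma newton_deriv:
  assumes "d \<ge> 2" "s > 0"
  shows "(newton d has_real_derivative newton' d s) (at s)"
    "(newton' d has_real_derivative newton'' d s) (at s)"
    "(newton'' d has_real_derivative newton''' d s) (at s)"
proof -
  show "(newton d has_real_derivative newton' d s) (at s)"
  proof (cases "d = 2")
    case True
    have "((\<lambda>s. - ln s / 2) has_real_derivative - (1 / s) / 2) (at s)"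
      using assms by (auto intro!: derivative_eq_intros)
    then show ?thesis using True assms
      by (simp add: newton_def[abs_def] newton'_def newton_const_def powr_minus inverse_eq_divide mult.commute)
  next
    case False
    have "((\<lambda>s. s powr (1 - real d / 2)) has_real_derivative (1 - real d / 2) * s powr (1 - real d / 2 - 1)) (at s)"
      using assms(2) by (rule has_real_derivative_powr)
    then show ?thesis using False
      by (simp add: newton_def[abs_def] newton'_def newton_const_def)
  qed
  show "(newton' d has_real_derivative newton'' d s) (at s)"
    unfolding newton'_def[abs_def] newton''_def
    by (rule DERIV_cong[OF DERIV_cmult[OF has_real_derivative_powr[OF assms(2)]]]) simp
  show "(newton'' d has_real_derivative newton''' d s) (at s)"
    unfolding newton''_def[abs_def] newton'''_def
    by (rule DERIV_cong[OF DERIV_cmult[OF has_real_derivative_powr[OF assms(2)]]]) (simp add: algebra_simps)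
qed

text \<open>The left-hand side is half the Laplacian of the radial function
  \<open>newton d (|x|^2)\<close> at \<open>|x|^2 = s\<close>.\<close>

lemma newton_harmonic:
  assumes "s > 0"
  shows "real d * newton' d s + 2 * s * newton'' d s = 0"
proof -
  have "s * s powr (- (real d / 2 + 1)) = s powr (1 + - (real d / 2 + 1))"
    using assms by (intro powr_mult_base) simp
  then have *: "s * s powr (- (real d / 2 + 1)) = s powr (- (real d / 2))" by simp
  have "real d * newton' d s + 2 * s * newton'' d s
      = newton_const d * real d * (s * s powr (- (real d / 2 + 1)) - s powr (- (real d / 2)))"
    unfolding newton'_def newton''_def by (simp only: right_diff_distrib) (simp only: field_simps, simp)
  then show ?thesis by (simp add: * del: minus_add_distrib)
qed

lemma powr_neg_antimono: "0 < m \<Longrightarrow> m \<le> s \<Longrightarrow> a \<ge> 0 \<Longrightarrow> s powr (- a) \<le> m powr (- a)" for m :: real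
  by (rule powr_mono2') auto

text \<open>The third derivative decreases in absolute value, so its value at \<open>m\<close>
  bounds the Taylor remainder uniformly over both points.\<close>

lemma newton_taylor:
  assumes d: "d \<ge> 2" and m: "m > 0"
  obtains C where "C \<ge> 0" "\<And>s u. s \<ge> m \<Longrightarrow> u \<ge> m \<Longrightarrow>
    newton d u \<ge> newton d s + newton' d s * (u - s) + newton'' d s / 2 * (u - s)\<^sup>2 - C * \<bar>u - s\<bar> ^ 3"
proof -
  define C where "C = \<bar>newton''' d m\<bar> / 6"
  have le: "newton d u \<ge> newton d s + newton' d s * (u - s) + newton'' d s / 2 * (u - s)\<^sup>2 - C * \<bar>u - s\<bar> ^ 3"
    if su: "s \<ge> m" "u \<ge> m" for s u
  proof (cases "u = s")
    case False
    let ?diff = "\<lambda>i::nat. if i = 0 then newton d else if i = 1 then newton' d else if i = 2 then newton'' d else newton''' d"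
    have D: "\<forall>(i::nat) t. i < 3 \<and> min s u \<le> t \<and> t \<le> max s u \<longrightarrow> DERIV (?diff i) t :> ?diff (Suc i) t"
    proof (intro allI impI)
      fix i :: nat and t assume *: "(i::nat) < 3 \<and> min s u \<le> t \<and> t \<le> max s u"
      then have t: "t > 0" using su m by auto
      from * consider "i = 0" | "i = 1" | "i = 2" by linarith
      then show "DERIV (?diff i) t :> ?diff (Suc i) t"
        by cases (use newton_deriv[OF d t] in auto)
    qed
    obtain t where t: "if u < s then u < t \<and> t < s else s < t \<and> t < u"
      and eq: "newton d u = (\<Sum>i<3. (?diff i s / fact i) * (u - s) ^ i) + (?diff 3 t / fact 3) * (u - s) ^ 3"
      using Taylor[of 3 ?diff "newton d" "min s u" "max s u" s u] D False by auto
    have tm: "t \<ge> m" using t su by (auto split: if_splits)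
    have "newton d u = newton d s + newton' d s * (u - s) + newton'' d s / 2 * (u - s)\<^sup>2 + newton''' d t / 6 * (u - s) ^ 3"
      using eq by (simp add: eval_nat_numeral)
    moreover have "\<bar>newton''' d t\<bar> \<le> \<bar>newton''' d m\<bar>"
      unfolding newton'''_def abs_mult
      using powr_neg_antimono[OF m tm, of "real d / 2 + 2"]
      by (intro mult_left_mono) auto
    then have "\<bar>newton''' d t / 6 * (u - s) ^ 3\<bar> \<le> C * \<bar>u - s\<bar> ^ 3"
      unfolding abs_mult power_abs C_def by (intro mult_right_mono) auto
    ultimately show ?thesis by linarith
  qed auto
  show thesis by (rule that[of C]) (use le in \<open>auto simp: C_def\<close>)
qed

text \<open>The coefficient for which the derivative of \<open>cell_profile\<close> vanishes exactly
  at \<open>s = 9 * \<rho>\<^sup>2\<close>. The profile then decreases up to radius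
  \<open>3 * \<rho>\<close> and changes sign at radius \<open>2 * \<rho>\<close>; the zone between
  is a buffer around the region where the corrector is positive.\<close>

definition cap_level :: "nat \<Rightarrow> real \<Rightarrow> real \<Rightarrow> real" where
  "cap_level d b \<rho> = b * (3 * \<rho>) ^ d / newton_const d"

definition cell_profile :: "nat \<Rightarrow> real \<Rightarrow> real \<Rightarrow> real \<Rightarrow> real" where
  "cell_profile d b \<rho> s = cap_level d b \<rho> * (newton d s - newton d (4 * \<rho>\<^sup>2)) + b * (s - 4 * \<rho>\<^sup>2)"

text \<open>The jump to 0 at the inner and outer radius is harmless: a step \<open>z\<close> that reaches it from the region
  where the corrector matters has norm bounded below, and is paid for by the remainder \<open>C |z|\<^sup>3\<close>.\<close>

definition corrector :: "nat \<Rightarrow> real \<Rightarrow> real \<Rightarrow> real \<Rightarrow> 'a::euclidean_space \<Rightarrow> real" where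
  "corrector d b \<rho> r y = (if r / 2 \<le> norm y \<and> norm y < 3 * \<rho> then cell_profile d b \<rho> ((norm y)\<^sup>2) else 0)"

lemma cap_level_pos: "d \<ge> 2 \<Longrightarrow> b > 0 \<Longrightarrow> \<rho> > 0 \<Longrightarrow> cap_level d b \<rho> > 0"
  using newton_const_pos[of d] by (simp add: cap_level_def)

lemma corrector_measurable [measurable]: "corrector d b \<rho> r \<in> borel_measurable borel"
  unfolding corrector_def[abs_def] cell_profile_def newton_def by measurable

context
  fixes d :: nat and b \<rho> :: real
  assumes d: "d \<ge> 2" and b: "b > 0" and \<rho>: "\<rho> > 0"
begin

lemma profile_slope:
  assumes s: "s > 0"
  shows "(cell_profile d b \<rho> has_real_derivative cap_level d b \<rho> * newton' d s + b) (at s)"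
    and "s < 9 * \<rho>\<^sup>2 \<Longrightarrow> cap_level d b \<rho> * newton' d s + b < 0"
proof -
  show "(cell_profile d b \<rho> has_real_derivative cap_level d b \<rho> * newton' d s + b) (at s)"
    unfolding cell_profile_def[abs_def]
    by (rule derivative_eq_intros newton_deriv(1)[OF d s] refl | simp)+
  assume "s < 9 * \<rho>\<^sup>2"
  then have "s powr (real d / 2) < (9 * \<rho>\<^sup>2) powr (real d / 2)"
    using s d by (intro powr_less_mono2) auto
  also have "9 * \<rho>\<^sup>2 = (3 * \<rho>) powr 2" using \<rho> by (simp add: power2_eq_square)
  also have "\<dots> powr (real d / 2) = (3 * \<rho>) ^ d"
    using \<rho> by (simp add: powr_powr powr_realpow del: powr_numeral)
  finally have lt: "s powr (real d / 2) < (3 * \<rho>) ^ d" .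
  have "cap_level d b \<rho> * newton' d s = - (b * ((3 * \<rho>) ^ d / s powr (real d / 2)))"
    using newton_const_pos[OF d] by (simp add: cap_level_def newton'_def powr_minus field_simps)
  moreover have "(3 * \<rho>) ^ d / s powr (real d / 2) > 1" using lt s by simp
  then have "b * ((3 * \<rho>) ^ d / s powr (real d / 2)) > b * 1" using b by (intro mult_strict_left_mono)
  ultimately show "cap_level d b \<rho> * newton' d s + b < 0" by linarith
qed

lemma profile_pos:
  assumes s: "0 < s" "s < 4 * \<rho>\<^sup>2"
  shows "cell_profile d b \<rho> s > 0"
proof -
  have "cell_profile d b \<rho> s > cell_profile d b \<rho> (4 * \<rho>\<^sup>2)"
  proof (rule DERIV_neg_imp_decreasing[OF s(2)])
    fix x assume x: "s \<le> x" "x \<le> 4 * \<rho>\<^sup>2"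
    have "x < 9 * \<rho>\<^sup>2" using x \<rho> zero_less_power[of \<rho> 2] by linarith
    then show "\<exists>y. (cell_profile d b \<rho> has_real_derivative y) (at x) \<and> y < 0"
      using profile_slope[of x] x s by auto
  qed
  then show ?thesis by (simp add: cell_profile_def)
qed

lemma profile_nonpos:
  assumes s: "4 * \<rho>\<^sup>2 \<le> s" "s < 9 * \<rho>\<^sup>2"
  shows "cell_profile d b \<rho> s \<le> 0"
proof -
  have "cell_profile d b \<rho> s \<le> cell_profile d b \<rho> (4 * \<rho>\<^sup>2)"
  proof (rule DERIV_nonpos_imp_nonincreasing[OF s(1)])
    fix x assume x: "4 * \<rho>\<^sup>2 \<le> x" "x \<le> s"
    have "x > 0" using x \<rho> zero_less_power[of \<rho> 2] by linarith
    then show "\<exists>y. (cell_profile d b \<rho> has_real_derivative y) (at x) \<and> y \<le> 0"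
      using profile_slope[of x] x s by (auto intro: less_imp_le)
  qed
  then show ?thesis by (simp add: cell_profile_def)
qed

lemma corrector_pos:
  assumes "r > 0" "r / 2 \<le> norm y" "norm y < 2 * \<rho>"
  shows "corrector d b \<rho> r y > 0"
proof -
  have "(norm y)\<^sup>2 < (2 * \<rho>)\<^sup>2" using assms by (intro power_strict_mono) auto
  moreover have "norm y > 0" using assms by linarith
  ultimately show ?thesis
    using profile_pos[of "(norm y)\<^sup>2"] assms \<rho> by (auto simp: corrector_def power2_eq_square)
qed

lemma corrector_pos_D:
  assumes "corrector d b \<rho> r y > 0"
  shows "norm y < 2 * \<rho>" "r / 2 \<le> norm y" "corrector d b \<rho> r y = cell_profile d b \<rho> ((norm y)\<^sup>2)"
proof -
  have *: "r / 2 \<le> norm y \<and> norm y < 3 * \<rho>" using assms by (auto simp: corrector_def split: if_splits)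
  then show "r / 2 \<le> norm y" and eq: "corrector d b \<rho> r y = cell_profile d b \<rho> ((norm y)\<^sup>2)"
    by (auto simp: corrector_def)
  show "norm y < 2 * \<rho>"
  proof (rule ccontr)
    assume "\<not> norm y < 2 * \<rho>"
    then have "(2 * \<rho>)\<^sup>2 \<le> (norm y)\<^sup>2" using \<rho> by (intro power_mono) auto
    moreover have "(norm y)\<^sup>2 < (3 * \<rho>)\<^sup>2" using * by (intro power_strict_mono) auto
    ultimately have "cell_profile d b \<rho> ((norm y)\<^sup>2) \<le> 0"
      by (intro profile_nonpos) (auto simp: power2_eq_square)
    then show False using assms eq by simp
  qed
qed

text \<open>The profile is largest at the inner radius \<open>r / 2\<close>, and
  \<open>2 * \<rho> \<le> 1\<close> makes the subtracted constant nonnegative. Since the coefficient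
  equals \<open>phi d r\<close>, the reciprocal of \<open>newton d (r\<^sup>2)\<close>, halving the
  radius costs a factor \<open>2 ^ (d - 2)\<close> for \<open>d > 2\<close>, and an additive
  \<open>ln 2\<close> times the coefficient for \<open>d = 2\<close>.\<close>

lemma corrector_le:
  assumes r: "0 < r" "r < 1" and \<rho>1: "2 * \<rho> \<le> 1" and c: "phi d r = cap_level d b \<rho>" "cap_level d b \<rho> \<le> 1"
  shows "corrector d b \<rho> r y \<le> 2 ^ d"
proof (cases "corrector d b \<rho> r y > 0")
  case True
  note D = corrector_pos_D[OF True]
  let ?c = "cap_level d b \<rho>"
  have c0: "?c > 0" using cap_level_pos[OF d b \<rho>] .
  have n4: "newton d (4 * \<rho>\<^sup>2) \<ge> 0"
  proof (cases "d = 2")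
    case True
    have "(2 * \<rho>)\<^sup>2 \<le> 1" using \<rho>1 \<rho> power_le_one[of "2 * \<rho>" 2] by (simp del: power_mult_distrib)
    then show ?thesis using True \<rho> by (simp add: newton_def power2_eq_square mult_ac)
  qed (simp add: newton_def)
  have ny: "norm y > 0" using D(2) r by linarith
  have anti: "newton d ((norm y)\<^sup>2) \<le> newton d ((r / 2)\<^sup>2)"
  proof (cases "(r / 2)\<^sup>2 = (norm y)\<^sup>2")
    case False
    have le: "(r / 2)\<^sup>2 \<le> (norm y)\<^sup>2" using D(2) r by (intro power_mono) auto
    show ?thesis
    proof (rule DERIV_nonpos_imp_nonincreasing[OF le])
      fix x assume "(r / 2)\<^sup>2 \<le> x" "x \<le> (norm y)\<^sup>2"
      then have "x > 0" using r by (smt (verit) zero_less_power half_gt_zero)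
      then show "\<exists>y. (newton d has_real_derivative y) (at x) \<and> y \<le> 0"
        using newton_deriv(1)[OF d] newton_const_pos[OF d]
        by (intro exI[of _ "newton' d x"]) (auto simp: newton'_def)
    qed
  qed simp
  have "(norm y)\<^sup>2 \<le> (2 * \<rho>)\<^sup>2" using D(1) by (intro power_mono) auto
  then have "b * ((norm y)\<^sup>2 - 4 * \<rho>\<^sup>2) \<le> 0" using b by (simp add: mult_le_0_iff power2_eq_square)
  moreover have "?c * (newton d ((norm y)\<^sup>2) - newton d (4 * \<rho>\<^sup>2)) \<le> ?c * newton d ((r / 2)\<^sup>2)"
    using c0 n4 anti by (intro mult_left_mono) auto
  ultimately have 1: "corrector d b \<rho> r y \<le> ?c * newton d ((r / 2)\<^sup>2)"
    unfolding D(3) cell_profile_def by linarith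
  have "?c * newton d ((r / 2)\<^sup>2) \<le> 2 ^ d"
  proof (cases "d = 2")
    case True
    have ph: "?c = 1 / ln (1 / r)" using c(1) True by (simp add: phi_def)
    then have "ln (1 / r) \<noteq> 0" using c0 by (intro notI) simp
    then have cl: "?c * ln (1 / r) = 1" unfolding ph by simp
    have "newton d ((r / 2)\<^sup>2) = ln (1 / r) + ln 2"
      using True r by (simp add: newton_def ln_div ln_realpow)
    then have "?c * newton d ((r / 2)\<^sup>2) = 1 + ?c * ln 2" using cl by (simp add: distrib_left)
    also have "\<dots> \<le> 1 + 1 * 1" using c(2) c0 ln_2_less_1 by (intro add_mono mult_mono) auto
    finally show ?thesis using True by simp
  next
    case False
    have "newton d ((r / 2)\<^sup>2) = 1 / phi d (r / 2)"
      using newton_phi[OF d, of "r / 2"] r by simp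
    also have "phi d (r / 2) = phi d r / 2 ^ (d - 2)"
      using False by (simp add: phi_def power_divide)
    finally have "?c * newton d ((r / 2)\<^sup>2) = 2 ^ (d - 2)" using c c0 by simp
    then show ?thesis by (simp add: power_increasing)
  qed
  with 1 show ?thesis by linarith
next
  case False
  then show ?thesis by (smt (verit) zero_le_power)
qed

text \<open>Expand the profile in the squared radius, whose increment is
  \<open>2 * (x \<bullet> z) + (norm z)\<^sup>2\<close>. By harmonicity the fundamental solution
  contributes nothing to the trace, and only the term with \<open>b\<close> remains. The constant
  \<open>C\<close> is uniform in \<open>x\<close>, which \<open>lyapunov_on\<close>
  requires.\<close>

lemma corrector_expansion:
  assumes r: "0 < r" and M: "\<And>y::'a::euclidean_space. corrector d b \<rho> r y \<le> M"
  obtains C where "C \<ge> 0" "\<And>x::'a. r \<le> norm x \<Longrightarrow> corrector d b \<rho> r x > 0 \<Longrightarrow>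
     \<exists>(l::'a) (k::real) (e::real). k * d + e * (norm x)\<^sup>2 = - (b * d) \<and>
      (\<forall>z. - max 0 (corrector d b \<rho> r (x + z)) \<le> - corrector d b \<rho> r x + l \<bullet> z
          + k * (norm z)\<^sup>2 + e * (x \<bullet> z)\<^sup>2 + C * (norm z) ^ 3)"
proof -
  let ?c = "cap_level d b \<rho>" and ?m = "(r / 2)\<^sup>2"
  have c0: "?c > 0" using cap_level_pos[OF d b \<rho>] .
  have m0: "?m > 0" using r by simp
  obtain C0 where C0: "C0 \<ge> 0" "\<And>s u. s \<ge> ?m \<Longrightarrow> u \<ge> ?m \<Longrightarrow>
    newton d u \<ge> newton d s + newton' d s * (u - s) + newton'' d s / 2 * (u - s)\<^sup>2 - C0 * \<bar>u - s\<bar> ^ 3"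
    using newton_taylor[OF d m0] by blast
  \<comment> \<open>\<open>P1\<close> and \<open>P2\<close> bound the first-order coefficient
    \<open>k\<close> and the second derivative \<open>newton''\<close> over all admissible
    \<open>x\<close>.\<close>
  define P1 where "P1 = ?c * newton_const d * ?m powr (- (real d / 2))"
  define P2 where "P2 = newton'' d ?m"
  \<comment> \<open>Shortest step from an admissible \<open>x\<close> across a cut-off: at least
    \<open>r / 2\<close> inwards, since \<open>r \<le> norm x\<close>, and at least
    \<open>\<rho>\<close> outwards, since \<open>norm x < 2 * \<rho>\<close>.\<close>
  define \<gamma> where "\<gamma> = min (r / 2) \<rho>"
  \<comment> \<open>Error for steps inside the annulus: the mixed term of the squared increment, and
    the Taylor remainder, where the increment is at most \<open>9 * \<rho> * norm z\<close> because
    \<open>norm x < 2 * \<rho>\<close> and \<open>norm z \<le> 5 * \<rho>\<close>.\<close>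
  define C1 where "C1 = ?c * P2 * (4 * \<rho>) + ?c * C0 * (9 * \<rho>) ^ 3"
  \<comment> \<open>Error for steps across a cut-off: height, linear term and quadratic term, each
    made cubic by means of \<open>\<gamma> \<le> norm z\<close>.\<close>
  define C2 where "C2 = max 0 M / \<gamma> ^ 3 + 4 * \<rho> * P1 / \<gamma>\<^sup>2 + 8 * ?c * P2 * \<rho>\<^sup>2 / \<gamma>"
  have A: "newton_const d > 0" using newton_const_pos[OF d] .
  have \<gamma>: "\<gamma> > 0" using r \<rho> by (simp add: \<gamma>_def)
  have P: "P1 \<ge> 0" "P2 \<ge> 0" using c0 A by (auto simp: P1_def P2_def newton''_def)
  have C1: "C1 \<ge> 0" using c0 P C0 \<rho> by (simp add: C1_def)
  have C2: "C2 \<ge> 0" using c0 P \<gamma> \<rho> by (simp add: C2_def)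
  show thesis
  proof (rule that[of "C1 + C2"])
    show "C1 + C2 \<ge> 0" using C1 C2 by simp
    fix x :: 'a assume x: "r \<le> norm x" "corrector d b \<rho> r x > 0"
    note D = corrector_pos_D[OF x(2)]
    define s where "s = (norm x)\<^sup>2"
    have sm: "s \<ge> ?m" unfolding s_def using D(2) r by (intro power_mono) auto
    have s0: "s > 0" using sm m0 by linarith
    have s9: "s < 9 * \<rho>\<^sup>2"
    proof -
      have "s < (2 * \<rho>)\<^sup>2" unfolding s_def using D(1) by (intro power_strict_mono) auto
      then show ?thesis using \<rho> by (simp add: power2_eq_square) (smt (verit) mult_pos_pos)
    qed
    \<comment> \<open>\<open>k\<close> is minus the slope of the profile; it multiplies the full
      increment of the squared radius, which accounts for \<open>l\<close> as well. \<open>e\<close>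
      comes from the second-order term, where the squared increment is
      \<open>4 * (x \<bullet> z)\<^sup>2\<close> up to cubic errors.\<close>
    define k where "k = - (?c * newton' d s + b)"
    define e where "e = - 2 * ?c * newton'' d s"
    define l where "l = (2 * k) *\<^sub>R x"
    have k: "0 \<le> k" "k \<le> P1"
    proof -
      show "0 \<le> k" using profile_slope(2)[OF s0 s9] by (simp add: k_def)
      have "s powr (- (real d / 2)) \<le> ?m powr (- (real d / 2))"
        by (rule powr_neg_antimono[OF m0 sm]) simp
      then have "?c * newton_const d * s powr (- (real d / 2)) \<le> P1"
        unfolding P1_def using c0 A by (intro mult_left_mono) auto
      then show "k \<le> P1" using b by (simp add: k_def newton'_def mult_ac)
    qed
    have n2: "0 \<le> newton'' d s" "newton'' d s \<le> P2"
    proof -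
      show "0 \<le> newton'' d s" using A by (simp add: newton''_def)
      have "s powr (- (real d / 2 + 1)) \<le> ?m powr (- (real d / 2 + 1))"
        by (rule powr_neg_antimono[OF m0 sm]) simp
      then show "newton'' d s \<le> P2"
        unfolding P2_def newton''_def using A by (intro mult_left_mono) auto
    qed
    show "\<exists>(l::'a) (k::real) (e::real). k * d + e * (norm x)\<^sup>2 = - (b * d) \<and>
      (\<forall>z. - max 0 (corrector d b \<rho> r (x + z)) \<le> - corrector d b \<rho> r x + l \<bullet> z
          + k * (norm z)\<^sup>2 + e * (x \<bullet> z)\<^sup>2 + (C1 + C2) * (norm z) ^ 3)"
    proof (rule exI[of _ l], rule exI[of _ k], rule exI[of _ e], intro conjI allI)
      have "k * d + e * s = - ?c * (real d * newton' d s + 2 * s * newton'' d s) - b * d"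
        by (simp add: k_def e_def algebra_simps)
      then show "k * d + e * (norm x)\<^sup>2 = - (b * d)" using newton_harmonic[OF s0] by (simp add: s_def)
    next
      fix z :: 'a
      have xz: "\<bar>x \<bullet> z\<bar> \<le> 2 * \<rho> * norm z"
      proof -
        have "\<bar>x \<bullet> z\<bar> \<le> norm x * norm z" by (rule Cauchy_Schwarz_ineq2)
        also have "\<dots> \<le> 2 * \<rho> * norm z" using D(1) by (intro mult_right_mono) auto
        finally show ?thesis .
      qed
      show "- max 0 (corrector d b \<rho> r (x + z)) \<le> - corrector d b \<rho> r x + l \<bullet> z
          + k * (norm z)\<^sup>2 + e * (x \<bullet> z)\<^sup>2 + (C1 + C2) * (norm z) ^ 3"
      proof (cases "r / 2 \<le> norm (x + z) \<and> norm (x + z) < 3 * \<rho>")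
        case True
        define u where "u = (norm (x + z))\<^sup>2"
        define \<delta> where "\<delta> = u - s"
        have um: "u \<ge> ?m" unfolding u_def using True r by (intro power_mono) auto
        have \<delta>: "\<delta> = 2 * (x \<bullet> z) + (norm z)\<^sup>2"
          by (simp add: \<delta>_def u_def s_def power2_norm_eq_inner inner_add_left inner_add_right inner_commute)
        have nz: "norm z \<le> 5 * \<rho>"
          using norm_triangle_ineq4[of "x + z" x] True D(1) by simp
        have "\<bar>\<delta>\<bar> \<le> 2 * \<bar>x \<bullet> z\<bar> + norm z * norm z"
          unfolding \<delta> by (rule order_trans[OF abs_triangle_ineq]) (simp add: abs_mult power2_eq_square)
        also have "\<dots> \<le> 2 * (2 * \<rho> * norm z) + 5 * \<rho> * norm z"
          using xz nz by (intro add_mono mult_right_mono) auto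
        finally have "\<bar>\<delta>\<bar> \<le> 9 * \<rho> * norm z" by simp
        then have "\<bar>\<delta>\<bar> ^ 3 \<le> (9 * \<rho> * norm z) ^ 3" by (intro power_mono) auto
        then have \<delta>3: "\<bar>\<delta>\<bar> ^ 3 \<le> (9 * \<rho>) ^ 3 * norm z ^ 3" by (simp only: power_mult_distrib)
        have \<delta>2: "\<delta>\<^sup>2 \<ge> 4 * (x \<bullet> z)\<^sup>2 - 8 * \<rho> * norm z ^ 3"
        proof -
          have "\<delta>\<^sup>2 = 4 * (x \<bullet> z)\<^sup>2 + 4 * (x \<bullet> z) * (norm z)\<^sup>2 + ((norm z)\<^sup>2)\<^sup>2"
            unfolding \<delta> by (simp add: power2_eq_square algebra_simps)
          moreover have "\<bar>4 * (x \<bullet> z) * (norm z)\<^sup>2\<bar> \<le> 8 * \<rho> * norm z ^ 3"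
          proof -
            have "\<bar>4 * (x \<bullet> z) * (norm z)\<^sup>2\<bar> = 4 * (norm z)\<^sup>2 * \<bar>x \<bullet> z\<bar>" by (simp add: abs_mult)
            also have "\<dots> \<le> 4 * (norm z)\<^sup>2 * (2 * \<rho> * norm z)" using xz by (intro mult_left_mono) auto
            also have "\<dots> = 8 * \<rho> * norm z ^ 3" by (simp add: power2_eq_square power3_eq_cube)
            finally show ?thesis .
          qed
          ultimately show ?thesis by (smt (verit) zero_le_power2)
        qed
        have t1: "newton d u \<ge> newton d s + newton' d s * \<delta> + newton'' d s / 2 * \<delta>\<^sup>2 - C0 * \<bar>\<delta>\<bar> ^ 3"
          using C0(2)[OF sm um] by (simp add: \<delta>_def)
        have t2: "newton'' d s / 2 * \<delta>\<^sup>2 \<ge> newton'' d s / 2 * (4 * (x \<bullet> z)\<^sup>2 - 8 * \<rho> * norm z ^ 3)"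
          using \<delta>2 n2 by (intro mult_left_mono) auto
        have t3: "newton'' d s * (4 * \<rho> * norm z ^ 3) \<le> P2 * (4 * \<rho> * norm z ^ 3)"
          using n2 \<rho> by (intro mult_right_mono) auto
        have t4: "C0 * \<bar>\<delta>\<bar> ^ 3 \<le> C0 * ((9 * \<rho>) ^ 3 * norm z ^ 3)"
          using C0(1) \<delta>3 by (intro mult_left_mono)
        have "newton d u - newton d s \<ge> newton' d s * \<delta> + 2 * newton'' d s * (x \<bullet> z)\<^sup>2
            - (P2 * (4 * \<rho> * norm z ^ 3) + C0 * ((9 * \<rho>) ^ 3 * norm z ^ 3))"
          using t1 t2 t3 t4 by (simp add: algebra_simps)
        then have "?c * (newton d u - newton d s) \<ge> ?c * (newton' d s * \<delta> + 2 * newton'' d s * (x \<bullet> z)\<^sup>2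
            - (P2 * (4 * \<rho> * norm z ^ 3) + C0 * ((9 * \<rho>) ^ 3 * norm z ^ 3)))"
          using c0 by (intro mult_left_mono) auto
        moreover have "cell_profile d b \<rho> u - cell_profile d b \<rho> s = ?c * (newton d u - newton d s) + b * \<delta>"
          by (simp add: cell_profile_def \<delta>_def algebra_simps)
        moreover have "l \<bullet> z + k * (norm z)\<^sup>2 = k * \<delta>"
          by (simp add: l_def \<delta> algebra_simps)
        moreover have "?c * (newton' d s * \<delta> + 2 * newton'' d s * (x \<bullet> z)\<^sup>2
            - (P2 * (4 * \<rho> * norm z ^ 3) + C0 * ((9 * \<rho>) ^ 3 * norm z ^ 3))) + b * \<delta>
            = - (k * \<delta>) - e * (x \<bullet> z)\<^sup>2 - C1 * norm z ^ 3"
          by (simp add: k_def e_def C1_def algebra_simps)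
        moreover have "corrector d b \<rho> r (x + z) = cell_profile d b \<rho> u"
          using True by (simp add: corrector_def u_def)
        moreover have "corrector d b \<rho> r x = cell_profile d b \<rho> s" using D(3) by (simp add: s_def)
        moreover have "C2 * norm z ^ 3 \<ge> 0" using C2 by simp
        ultimately show ?thesis by (simp add: distrib_right)
      next
        case False
        then have cz: "corrector d b \<rho> r (x + z) = 0" by (auto simp: corrector_def)
        have z\<gamma>: "\<gamma> \<le> norm z"
        proof (cases "norm (x + z) < r / 2")
          case True
          then show ?thesis using norm_triangle_ineq4[of "x + z" z] x(1) by (simp add: \<gamma>_def)
        next
          case False
          with \<open>\<not> (_ \<and> _)\<close> have "norm (x + z) \<ge> 3 * \<rho>" by simp
          then show ?thesis using norm_triangle_ineq[of x z] D(1) by (simp add: \<gamma>_def)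
        qed
        have z0: "norm z > 0" using z\<gamma> \<gamma> by linarith
        have a1: "max 0 M \<le> max 0 M / \<gamma> ^ 3 * norm z ^ 3"
        proof -
          have "\<gamma> ^ 3 \<le> norm z ^ 3" using z\<gamma> \<gamma> by (intro power_mono) auto
          then have "max 0 M * \<gamma> ^ 3 \<le> max 0 M * norm z ^ 3" by (intro mult_left_mono) auto
          then show ?thesis using \<gamma> by (simp add: pos_le_divide_eq del: max.bounded_iff)
        qed
        have a2: "4 * \<rho> * P1 * norm z \<le> 4 * \<rho> * P1 / \<gamma>\<^sup>2 * norm z ^ 3"
        proof -
          have "\<gamma>\<^sup>2 \<le> (norm z)\<^sup>2" using z\<gamma> \<gamma> by (intro power_mono) auto
          then have "(4 * \<rho> * P1 * norm z) * \<gamma>\<^sup>2 \<le> (4 * \<rho> * P1 * norm z) * (norm z)\<^sup>2"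
            using \<rho> P by (intro mult_left_mono) auto
          then show ?thesis using \<gamma> by (simp add: field_simps power2_eq_square power3_eq_cube)
        qed
        have a3: "8 * ?c * P2 * \<rho>\<^sup>2 * (norm z)\<^sup>2 \<le> 8 * ?c * P2 * \<rho>\<^sup>2 / \<gamma> * norm z ^ 3"
        proof -
          have "(8 * ?c * P2 * \<rho>\<^sup>2 * (norm z)\<^sup>2) * \<gamma> \<le> (8 * ?c * P2 * \<rho>\<^sup>2 * (norm z)\<^sup>2) * norm z"
            using z\<gamma> c0 P by (intro mult_left_mono) auto
          then show ?thesis using \<gamma> by (simp add: field_simps power2_eq_square power3_eq_cube)
        qed
        have l: "l \<bullet> z \<ge> - (4 * \<rho> * P1 * norm z)"
        proof -
          have "\<bar>l \<bullet> z\<bar> = 2 * k * \<bar>x \<bullet> z\<bar>" using k by (simp add: l_def abs_mult)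
          also have "\<dots> \<le> 2 * P1 * (2 * \<rho> * norm z)" using k xz P by (intro mult_mono) auto
          finally show ?thesis by (simp add: mult_ac)
        qed
        have e: "e * (x \<bullet> z)\<^sup>2 \<ge> - (8 * ?c * P2 * \<rho>\<^sup>2 * (norm z)\<^sup>2)"
        proof -
          have "(x \<bullet> z)\<^sup>2 \<le> (2 * \<rho> * norm z)\<^sup>2" using xz by (metis abs_ge_zero power2_abs power_mono)
          then have "2 * ?c * newton'' d s * (x \<bullet> z)\<^sup>2 \<le> 2 * ?c * P2 * (2 * \<rho> * norm z)\<^sup>2"
            using n2 c0 P by (intro mult_mono) auto
          then show ?thesis by (simp add: e_def power_mult_distrib mult_ac)
        qed
        have "k * (norm z)\<^sup>2 \<ge> 0" using k by simp
        moreover have "corrector d b \<rho> r x \<le> max 0 M" using M[of x] by simp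
        moreover have "C2 * norm z ^ 3 = max 0 M / \<gamma> ^ 3 * norm z ^ 3 + 4 * \<rho> * P1 / \<gamma>\<^sup>2 * norm z ^ 3
           + 8 * ?c * P2 * \<rho>\<^sup>2 / \<gamma> * norm z ^ 3"
          by (simp add: C2_def distrib_right)
        moreover have "C1 * norm z ^ 3 \<ge> 0" using C1 by simp
        ultimately have "0 \<le> - corrector d b \<rho> r x + l \<bullet> z
          + k * (norm z)\<^sup>2 + e * (x \<bullet> z)\<^sup>2 + (C1 + C2) * (norm z) ^ 3"
          using a1 a2 a3 l e unfolding distrib_right by linarith
        then show ?thesis by (simp add: cz)
      qed
    qed
  qed
qed

end

section \<open>Lyapunov functions for systems of bubbles\<close>

definition dist_well :: "'a::euclidean_space set \<Rightarrow> real \<Rightarrow> 'a \<Rightarrow> real" where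
  "dist_well K L x = min 1 (L * (infdist x K)\<^sup>2)"

lemma dist_well_bounds: "L \<ge> 0 \<Longrightarrow> 0 \<le> dist_well K L x" "dist_well K L x \<le> 1"
  by (auto simp: dist_well_def)

text \<open>The squared distance is a minimum of the functions \<open>|x - p|^2\<close> over
  \<open>p\<close> in \<open>K\<close>. Freezing the nearest point of \<open>x\<close> gives a
  quadratic upper bound that is exact at \<open>x\<close>; where the truncation is active, the
  constant 1 serves.\<close>

lemma dist_well_semiconcave:
  fixes K :: "'a::euclidean_space set"
  assumes K: "closed K" "K \<noteq> {}" and L: "L \<ge> 0"
  obtains l where "\<And>z. dist_well K L (x + z) \<le> dist_well K L x + l \<bullet> z + L * (norm z)\<^sup>2"
proof (cases "L * (infdist x K)\<^sup>2 \<le> 1")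
  case True
  obtain p where p: "p \<in> K" "infdist x K = dist x p" using infdist_attains_inf[OF K] by blast
  have "dist_well K L (x + z) \<le> dist_well K L x + ((2 * L) *\<^sub>R (x - p)) \<bullet> z + L * (norm z)\<^sup>2" for z
  proof -
    have "infdist (x + z) K \<le> norm (x - p + z)"
      using infdist_le[OF p(1), of "x + z"] by (simp add: dist_norm algebra_simps)
    then have "(infdist (x + z) K)\<^sup>2 \<le> (norm (x - p + z))\<^sup>2"
      by (intro power_mono infdist_nonneg)
    also have "\<dots> = (norm (x - p))\<^sup>2 + 2 * ((x - p) \<bullet> z) + (norm z)\<^sup>2"
      by (simp add: power2_norm_eq_inner inner_add_left inner_add_right inner_commute)
    finally have "L * (infdist (x + z) K)\<^sup>2 \<le> L * ((norm (x - p))\<^sup>2 + 2 * ((x - p) \<bullet> z) + (norm z)\<^sup>2)"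
      using L by (rule mult_left_mono)
    moreover have "dist_well K L x = L * (norm (x - p))\<^sup>2"
      using True by (simp add: dist_well_def p(2) dist_norm)
    ultimately show ?thesis by (simp add: dist_well_def algebra_simps min_le_iff_disj)
  qed
  then show thesis by (rule that)
next
  case False
  then have "dist_well K L x = 1" by (simp add: dist_well_def)
  then show thesis
    using L by (intro that[of 0]) (auto simp: dist_well_def min_le_iff_disj)
qed

text \<open>Completing a square. The quadratic share will be charged to the trace, leaving only a
  quartic error as in \<open>lyapunov_on\<close>.\<close>

lemma cube_le_quartic:
  fixes C t \<eta> :: real
  assumes "\<eta> > 0"
  shows "C * t ^ 3 \<le> \<eta> * t\<^sup>2 + C\<^sup>2 / (4 * \<eta>) * t ^ 4"
proof -
  have "0 \<le> (2 * \<eta> * t - C * t\<^sup>2)\<^sup>2 / (4 * \<eta>)" using assms by simp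
  also have "\<dots> = \<eta> * t\<^sup>2 + C\<^sup>2 / (4 * \<eta>) * t ^ 4 - C * t ^ 3"
    using assms by (simp add: field_simps power2_eq_square power3_eq_cube power4_eq_xxxx)
  finally show ?thesis by simp
qed

section \<open>Compact exhaustions and the growing part of the Lyapunov function\<close>

locale exhaustion =
  fixes U :: "'a::euclidean_space set" and K :: "nat \<Rightarrow> 'a set" and e :: "nat \<Rightarrow> real"
  assumes compact_K: "\<And>n. compact (K n)" and nonempty_K: "\<And>n. K n \<noteq> {}" and K_subset: "\<And>n. K n \<subseteq> U"
    and e_pos: "\<And>n. e n > 0" and gap: "\<And>n x. x \<in> K n \<Longrightarrow> ball x (e n) \<subseteq> K (Suc n)"
    and exhausts: "U \<subseteq> (\<Union>n. K n)"
begin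

lemma K_mono: "m \<le> n \<Longrightarrow> K m \<subseteq> K n"
  by (rule lift_Suc_mono_le) (use gap e_pos in \<open>auto simp: subset_iff\<close>)

text \<open>The scale for which \<open>well n\<close> reaches 1 at distance \<open>e n\<close> from
  \<open>K n\<close>, and so everywhere off \<open>K (Suc n)\<close>.\<close>

definition L :: "nat \<Rightarrow> real" where "L n = 1 / (e n)\<^sup>2"

definition well :: "nat \<Rightarrow> 'a \<Rightarrow> real" where "well n = dist_well (K n) (L n)"

definition wells :: "nat \<Rightarrow> 'a \<Rightarrow> real" where "wells N x = (\<Sum>m<N. well m x)"

text \<open>Upper bound for the quadratic coefficient of \<open>wells N\<close> at points of
  \<open>K j\<close>, the same for all \<open>N\<close>.\<close>

definition curv :: "nat \<Rightarrow> real" where "curv j = (\<Sum>m\<le>j. L m)"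

lemma L_pos: "L n > 0"
  using e_pos[of n] by (simp add: L_def)

lemma curv_pos: "curv j + 2 > 0"
  using sum_nonneg[of "{..j}" L] less_imp_le[OF L_pos] by (simp add: curv_def add_nonneg_pos)

lemma well_bounds: "0 \<le> well n x" "well n x \<le> 1"
  using dist_well_bounds(1)[of "L n" "K n" x] dist_well_bounds(2)[of "K n" "L n" x] L_pos[of n] by (auto simp: well_def)

lemma well_zero: "x \<in> K n \<Longrightarrow> well n x = 0"
  by (simp add: well_def dist_well_def)

lemma well_one:
  assumes "x \<notin> K (Suc n)"
  shows "well n x = 1"
proof -
  obtain p where p: "p \<in> K n" "infdist x (K n) = dist x p"
    using infdist_attains_inf[OF compact_imp_closed[OF compact_K] nonempty_K] by blast
  have "e n \<le> infdist x (K n)" using gap[OF p(1)] assms p(2) by (force simp: dist_commute)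
  then have "(e n)\<^sup>2 \<le> (infdist x (K n))\<^sup>2" using e_pos[of n] by (intro power_mono) auto
  then show ?thesis using e_pos[of n] by (simp add: well_def dist_well_def L_def)
qed

lemma wells_measurable [measurable]: "wells N \<in> borel_measurable borel"
proof -
  have "(\<lambda>x. infdist x (K m)) \<in> borel_measurable borel" for m
    by (intro borel_measurable_continuous_onI continuous_intros)
  then show ?thesis unfolding wells_def[abs_def] well_def dist_well_def[abs_def] by measurable
qed

lemma wells_bounds: "0 \<le> wells N x" "wells N x \<le> real N"
  using sum_mono[of "{..<N}" "\<lambda>m. well m x" "\<lambda>_. 1"] well_bounds
  by (auto simp: wells_def intro: sum_nonneg)

lemma wells_outside:
  assumes "x \<notin> K N"
  shows "wells N x = real N"
proof -
  have "well m x = 1" if "m < N" for m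
    using that assms K_mono[of "Suc m" N] by (intro well_one) auto
  then show ?thesis by (simp add: wells_def)
qed

text \<open>On \<open>K n\<close> only the first \<open>n\<close> wells can be nonzero. The bound is
  independent of \<open>N\<close>, as is needed at the starting point.\<close>

lemma wells_inside:
  assumes "x \<in> K n"
  shows "wells N x \<le> real n"
proof -
  have "well m x = 0" if "n \<le> m" for m
    using assms K_mono[OF that] by (intro well_zero) auto
  then have "wells N x = (\<Sum>m\<in>{..<N} \<inter> {..<n}. well m x)"
    unfolding wells_def by (intro sum.mono_neutral_right) (auto intro: ccontr simp: not_le[symmetric])
  also have "\<dots> \<le> (\<Sum>m<n. well m x)"
    by (intro sum_mono2) (auto simp: well_bounds)
  also have "\<dots> \<le> (\<Sum>m<n. 1)"
    by (intro sum_mono well_bounds)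
  finally show ?thesis by simp
qed

text \<open>At a point of \<open>K j\<close>, a well with \<open>m > j\<close> vanishes on the whole
  ball of radius \<open>e (m - 1)\<close>, so it contributes only a cubic error. Only the wells with
  \<open>m \<le> j\<close> contribute curvature.\<close>

lemma wells_expansion:
  obtains C where "C \<ge> 0" "\<And>j x. x \<in> K j \<Longrightarrow>
    \<exists>l. \<forall>z. wells N (x + z) \<le> wells N x + l \<bullet> z + curv j * (norm z)\<^sup>2 + C * (norm z) ^ 3"
proof -
  \<comment> \<open>For \<open>m = 0\<close> truncated subtraction gives \<open>e 0\<close>; that
    index always falls under \<open>m \<le> j\<close>, where the summand is mere slack.\<close>
  define C where "C = (\<Sum>m<N. 1 / (e (m - 1)) ^ 3)"
  have c0: "0 \<le> 1 / (e m) ^ 3" for m using e_pos[of m] by simp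
  show thesis
  proof (rule that[of C])
    show "C \<ge> 0" unfolding C_def by (intro sum_nonneg c0)
    fix j x assume x: "x \<in> K j"
    have "\<exists>l. \<forall>z. well m (x + z) \<le> well m x + l \<bullet> z + (if m \<le> j then L m else 0) * (norm z)\<^sup>2
        + 1 / (e (m - 1)) ^ 3 * (norm z) ^ 3" for m
    proof (cases "m \<le> j")
      case True
      obtain l where l: "\<And>z. well m (x + z) \<le> well m x + l \<bullet> z + L m * (norm z)\<^sup>2"
        unfolding well_def
        using dist_well_semiconcave[OF compact_imp_closed[OF compact_K] nonempty_K less_imp_le[OF L_pos]] by blast
      have "0 \<le> 1 / (e (m - 1)) ^ 3 * (norm z) ^ 3" for z :: 'a by (intro mult_nonneg_nonneg c0) auto
      then show ?thesis using l True by (intro exI[of _ l]) (smt (verit))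
    next
      case False
      then have xm: "x \<in> K (m - 1)" "x \<in> K m" using x K_mono[of j] by (auto simp: subset_iff)
      have "well m (x + z) \<le> 1 / (e (m - 1)) ^ 3 * (norm z) ^ 3" for z
      proof (cases "norm z < e (m - 1)")
        case True
        then have "x + z \<in> ball x (e (m - 1))" by (simp add: dist_norm)
        then have "x + z \<in> K m" using gap[OF xm(1)] False by auto
        then show ?thesis using c0[of "m - 1"] by (simp add: well_zero)
      next
        case False
        then have "(e (m - 1)) ^ 3 \<le> (norm z) ^ 3" using e_pos[of "m - 1"] by (intro power_mono) auto
        then have "1 \<le> 1 / (e (m - 1)) ^ 3 * (norm z) ^ 3" using e_pos[of "m - 1"] by (simp add: field_simps)
        then show ?thesis using well_bounds(2)[of m "x + z"] by linarith
      qed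
      then show ?thesis using False xm(2) by (intro exI[of _ 0]) (auto simp: well_zero)
    qed
    then obtain l where l: "\<And>m z. well m (x + z) \<le> well m x + l m \<bullet> z + (if m \<le> j then L m else 0) * (norm z)\<^sup>2
        + 1 / (e (m - 1)) ^ 3 * (norm z) ^ 3" by metis
    show "\<exists>l. \<forall>z. wells N (x + z) \<le> wells N x + l \<bullet> z + curv j * (norm z)\<^sup>2 + C * (norm z) ^ 3"
    proof (rule exI[of _ "\<Sum>m<N. l m"], rule allI)
      fix z
      have "wells N (x + z) \<le> (\<Sum>m<N. well m x + l m \<bullet> z + (if m \<le> j then L m else 0) * (norm z)\<^sup>2
        + 1 / (e (m - 1)) ^ 3 * (norm z) ^ 3)"
        unfolding wells_def by (rule sum_mono) (rule l)
      also have "\<dots> = wells N x + (\<Sum>m<N. l m) \<bullet> z + (\<Sum>m<N. if m \<le> j then L m else 0) * (norm z)\<^sup>2 + C * (norm z) ^ 3"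
        by (simp add: sum.distrib wells_def inner_sum_left sum_distrib_right C_def)
      also have "(\<Sum>m<N. if m \<le> j then L m else 0) \<le> curv j"
      proof -
        have "(\<Sum>m<N. if m \<le> j then L m else 0) = (\<Sum>m\<in>{..<N} \<inter> {..j}. L m)"
          by (simp add: sum.If_cases Int_def atMost_def)
        also have "\<dots> \<le> curv j" unfolding curv_def
          by (rule sum_mono2) (auto intro: less_imp_le[OF L_pos])
        finally show ?thesis .
      qed
      finally show "wells N (x + z) \<le> wells N x + (\<Sum>m<N. l m) \<bullet> z + curv j * (norm z)\<^sup>2 + C * (norm z) ^ 3"
        by (simp add: mult_right_mono)
    qed
  qed
qed

end

text \<open>The curvature at level \<open>n\<close> is taken two steps further out because a point at which a cell of
  level \<open>n\<close> is active need only lie in \<open>K (n + 2)\<close>.\<close>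

locale bubble_system = exhaustion U K e for U :: "'a::euclidean_space set" and K e +
  fixes \<rho> r :: "nat \<Rightarrow> real" and X :: "nat \<Rightarrow> 'a set"
  assumes dim: "DIM('a) \<ge> 2"
    and \<rho>_pos: "\<And>n. \<rho> n > 0" and \<rho>_antimono: "\<And>m n. m \<le> n \<Longrightarrow> \<rho> n \<le> \<rho> m"
    and \<rho>_le: "\<And>n. 2 * \<rho> n \<le> 1" "\<And>n. 2 * \<rho> n \<le> e (Suc n)"
    and r_pos: "\<And>n. r n > 0" and r_le: "\<And>n. 4 * r n \<le> \<rho> n"
    and phi_r: "\<And>n. phi DIM('a) (r n) = cap_level DIM('a) (curv (n + 2) + 2) (\<rho> n)"
    and cap_le: "\<And>n. cap_level DIM('a) (curv (n + 2) + 2) (\<rho> n) \<le> 1"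
    and finite_X: "\<And>n. finite (X n)" and X_subset: "\<And>n. X n \<subseteq> K (Suc n)"
    and covers: "\<And>n. K (Suc n) \<subseteq> (\<Union>m\<le>n. \<Union>p\<in>X m. ball p (\<rho> m))"
    and separated: "\<And>m n p q. m \<le> n \<Longrightarrow> p \<in> X m \<Longrightarrow> q \<in> X n \<Longrightarrow> (m, p) \<noteq> (n, q) \<Longrightarrow> \<rho> m \<le> dist p q"
begin

definition A :: "'a set" where "A = (\<Union>n. \<Union>p\<in>X n. cball p (r n))"

definition cells :: "nat \<Rightarrow> (nat \<times> 'a) set" where "cells N = (SIGMA n:{..<N}. X n)"

definition corr :: "nat \<times> 'a \<Rightarrow> 'a \<Rightarrow> real" where
  "corr c x = corrector DIM('a) (curv (fst c + 2) + 2) (\<rho> (fst c)) (r (fst c)) (x - snd c)"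

definition cell_max :: "nat \<Rightarrow> 'a \<Rightarrow> real" where
  "cell_max N x = Max (insert 0 ((\<lambda>c. corr c x) ` cells N))"

text \<open>The constant \<open>2 ^ DIM('a)\<close> bounds all correctors and thus keeps
  \<open>lyap\<close> nonnegative.\<close>

definition lyap :: "nat \<Rightarrow> 'a \<Rightarrow> real" where
  "lyap N x = 2 ^ DIM('a) + wells N x - cell_max N x"

lemma finite_cells [simp]: "finite (cells N)"
  using finite_X by (auto simp: cells_def)

lemma corr_le: "corr c x \<le> 2 ^ DIM('a)"
proof -
  have "r n < 1" for n using r_le[of n] \<rho>_le(1)[of n] \<rho>_pos[of n] by linarith
  then show ?thesis unfolding corr_def
    using corrector_le[OF dim curv_pos \<rho>_pos r_pos _ \<rho>_le(1) phi_r cap_le] by simp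
qed

lemma cell_max_bounds: "0 \<le> cell_max N x" "cell_max N x \<le> 2 ^ DIM('a)"
  unfolding cell_max_def by (auto simp: corr_le)

lemma corr_le_cell_max: "c \<in> cells N \<Longrightarrow> max 0 (corr c x) \<le> cell_max N x"
  unfolding cell_max_def by auto

lemma cell_max_measurable [measurable]: "cell_max N \<in> borel_measurable borel"
proof -
  have [measurable]: "corr c \<in> borel_measurable borel" for c
    unfolding corr_def[abs_def] by measurable
  have eq: "cell_max N x = Max ((\<lambda>f. f x) ` insert (\<lambda>_. 0) (corr ` cells N))" for x
    by (simp add: cell_max_def image_image)
  show ?thesis unfolding eq[abs_def]
    by (rule borel_measurable_Max) auto
qed

lemma lyap_bounds: "0 \<le> lyap N x" "lyap N x \<le> 2 ^ DIM('a) + real N" "wells N x \<le> lyap N x" "lyap N x \<le> 2 ^ DIM('a) + wells N x"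
  using cell_max_bounds[of N x] wells_bounds[of N x] by (auto simp: lyap_def)

text \<open>Cells of level below \<open>N\<close> cover \<open>K N\<close> with radii
  \<open>\<rho> m\<close>, half the radius up to which the corrector is positive. Hence off the
  bubbles the maximum is positive and is attained by a genuine cell, not by the inserted 0.\<close>

lemma cell_max_attained:
  assumes x: "x \<in> K N - A" and N: "N \<ge> 1"
  obtains n p where "n < N" "p \<in> X n" "r n \<le> norm (x - p)" "corr (n, p) x > 0" "cell_max N x = corr (n, p) x"
proof -
  obtain N' where N': "N = Suc N'" using N by (cases N) auto
  then obtain m q where q: "m < N" "q \<in> X m" "dist q x < \<rho> m"
    using covers[of N'] x by (auto simp: less_Suc_eq_le)
  have nA: "r n < norm (x - p)" if "p \<in> X n" for n p
    using x that unfolding A_def by (force simp: dist_norm norm_minus_commute)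
  have "corr (m, q) x > 0"
    unfolding corr_def using nA[OF q(2)] q(3) r_pos[of m] \<rho>_pos[of m]
    by (intro corrector_pos[OF dim curv_pos \<rho>_pos]) (auto simp: dist_norm norm_minus_commute)
  moreover have "(m, q) \<in> cells N" using q by (auto simp: cells_def)
  ultimately have pos: "cell_max N x > 0" using corr_le_cell_max[of "(m, q)" N x] by auto
  have "cell_max N x \<in> insert 0 ((\<lambda>c. corr c x) ` cells N)"
    unfolding cell_max_def by (rule Max_in) auto
  with pos obtain c where c: "c \<in> cells N" "cell_max N x = corr c x" by auto
  show thesis
    using c pos nA[of "snd c" "fst c"] by (intro that[of "fst c" "snd c"]) (auto simp: cells_def)
qed

text \<open>At \<open>x\<close> the maximum is replaced by one cell that attains it: this is exact
  at \<open>x\<close> and an upper bound for \<open>lyap\<close> elsewhere, so no smoothness of the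
  maximum enters.\<close>

lemma lyapunov_lyap:
  assumes N: "N \<ge> 1"
  obtains C where "C \<ge> 0" "lyapunov_on (K N - A) C (lyap N)"
proof -
  obtain Cw where Cw: "Cw \<ge> 0" "\<And>j x. x \<in> K j \<Longrightarrow>
    \<exists>l. \<forall>z. wells N (x + z) \<le> wells N x + l \<bullet> z + curv j * (norm z)\<^sup>2 + Cw * (norm z) ^ 3"
    using wells_expansion[of N] by blast
  have "\<exists>C\<ge>0. \<forall>x::'a. r n \<le> norm x \<longrightarrow> corrector DIM('a) (curv (n + 2) + 2) (\<rho> n) (r n) x > 0 \<longrightarrow>
     (\<exists>(l::'a) (k::real) (c::real). k * DIM('a) + c * (norm x)\<^sup>2 = - ((curv (n + 2) + 2) * DIM('a)) \<and>
      (\<forall>z. - max 0 (corrector DIM('a) (curv (n + 2) + 2) (\<rho> n) (r n) (x + z))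
          \<le> - corrector DIM('a) (curv (n + 2) + 2) (\<rho> n) (r n) x + l \<bullet> z
          + k * (norm z)\<^sup>2 + c * (x \<bullet> z)\<^sup>2 + C * (norm z) ^ 3))" for n
  proof -
    have "corrector DIM('a) (curv (n + 2) + 2) (\<rho> n) (r n) y \<le> 2 ^ DIM('a)" for y :: 'a
      using corr_le[of "(n, 0)" y] by (simp add: corr_def)
    from corrector_expansion[OF dim curv_pos \<rho>_pos r_pos this] show ?thesis by metis
  qed
  then obtain Cc where Cc0: "\<And>n. Cc n \<ge> 0" and Cc: "\<And>n x. r n \<le> norm x \<Longrightarrow> corrector DIM('a) (curv (n + 2) + 2) (\<rho> n) (r n) x > 0 \<Longrightarrow>
     (\<exists>(l::'a) (k::real) (c::real). k * DIM('a) + c * (norm x)\<^sup>2 = - ((curv (n + 2) + 2) * DIM('a)) \<and>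
      (\<forall>z. - max 0 (corrector DIM('a) (curv (n + 2) + 2) (\<rho> n) (r n) (x + z))
          \<le> - corrector DIM('a) (curv (n + 2) + 2) (\<rho> n) (r n) x + l \<bullet> z
          + k * (norm z)\<^sup>2 + c * (x \<bullet> z)\<^sup>2 + Cc n * (norm z) ^ 3))"
    by metis
  define C where "C = Cw + (\<Sum>n<N. Cc n)"
  \<comment> \<open>Absorbing the cubic error costs \<open>\<eta> * DIM('a) = 1\<close> in the
    trace. The cell supplies \<open>curv (n + 2) + 2\<close> per dimension, of which the wells use
    \<open>curv (n + 2)\<close>; the trace left is \<open>1 - 2 * DIM('a)\<close>.\<close>
  define \<eta> where "\<eta> = 1 / real DIM('a)"
  have \<eta>: "\<eta> > 0" "\<eta> * DIM('a) = 1" using dim by (auto simp: \<eta>_def)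
  have "lyapunov_on (K N - A) (C\<^sup>2 / (4 * \<eta>)) (lyap N)"
    unfolding lyapunov_on_def
  proof
    fix x assume x: "x \<in> K N - A"
    obtain n p where np: "n < N" "p \<in> X n" "r n \<le> norm (x - p)" "corr (n, p) x > 0" "cell_max N x = corr (n, p) x"
      using cell_max_attained[OF x N] by blast
    have "norm (x - p) < 2 * \<rho> n"
      using corrector_pos_D(1)[OF dim curv_pos \<rho>_pos] np(4) by (simp add: corr_def)
    then have "x \<in> ball p (e (Suc n))" using \<rho>_le(2)[of n] by (simp add: dist_norm norm_minus_commute)
    moreover have "p \<in> K (Suc n)" using X_subset[of n] np(2) by auto
    ultimately have xK: "x \<in> K (n + 2)" using gap[of p "Suc n"] by auto
    obtain l1 where l1: "\<And>z. wells N (x + z) \<le> wells N x + l1 \<bullet> z + curv (n + 2) * (norm z)\<^sup>2 + Cw * (norm z) ^ 3"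
      using Cw(2)[OF xK] by blast
    obtain l2 :: 'a and k c :: real where tr: "k * DIM('a) + c * (norm (x - p))\<^sup>2 = - ((curv (n + 2) + 2) * DIM('a))"
      and l2: "\<And>z. - max 0 (corr (n, p) (x + z)) \<le> - corr (n, p) x + l2 \<bullet> z
          + k * (norm z)\<^sup>2 + c * ((x - p) \<bullet> z)\<^sup>2 + Cc n * (norm z) ^ 3"
      using Cc[OF np(3)] np(4) unfolding corr_def by (auto simp: algebra_simps)
    have Cn: "Cw + Cc n \<le> C"
      unfolding C_def using np(1) Cc0 by (intro add_left_mono member_le_sum) auto
    show "\<exists>(l::'a) (p::'a) (k::real) (c::real). k * DIM('a) + c * (norm p)\<^sup>2 \<le> - 1 \<and> (\<forall>z. lyap N (x + z) \<le> lyap N x + l \<bullet> z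
        + k * (norm z)\<^sup>2 + c * (p \<bullet> z)\<^sup>2 + C\<^sup>2 / (4 * \<eta>) * norm z ^ 4)"
    proof (rule exI[of _ "l1 + l2"], rule exI[of _ "x - p"], rule exI[of _ "k + curv (n + 2) + \<eta>"], rule exI[of _ c], intro conjI allI)
      have "(k + curv (n + 2) + \<eta>) * DIM('a) + c * (norm (x - p))\<^sup>2 = 1 - 2 * real DIM('a)"
        using tr \<eta>(2) by (simp add: algebra_simps)
      then show "(k + curv (n + 2) + \<eta>) * DIM('a) + c * (norm (x - p))\<^sup>2 \<le> - 1" using dim by simp
      fix z
      have "lyap N (x + z) = 2 ^ DIM('a) + wells N (x + z) - cell_max N (x + z)" by (simp add: lyap_def)
      also have "\<dots> \<le> 2 ^ DIM('a) + wells N (x + z) + (- max 0 (corr (n, p) (x + z)))"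
        using corr_le_cell_max[of "(n, p)" N "x + z"] np by (auto simp: cells_def)
      also have "\<dots> \<le> 2 ^ DIM('a) + (wells N x + l1 \<bullet> z + curv (n + 2) * (norm z)\<^sup>2 + Cw * (norm z) ^ 3)
         + (- corr (n, p) x + l2 \<bullet> z + k * (norm z)\<^sup>2 + c * ((x - p) \<bullet> z)\<^sup>2 + Cc n * (norm z) ^ 3)"
        by (intro add_mono order_refl l1 l2)
      also have "\<dots> = lyap N x + (l1 + l2) \<bullet> z + (k + curv (n + 2)) * (norm z)\<^sup>2 + c * ((x - p) \<bullet> z)\<^sup>2 + (Cw + Cc n) * (norm z) ^ 3"
        by (simp add: lyap_def np(5) inner_add_left algebra_simps)
      also have "(Cw + Cc n) * (norm z) ^ 3 \<le> C * (norm z) ^ 3"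
        using Cn by (intro mult_right_mono) auto
      also have "C * (norm z) ^ 3 \<le> \<eta> * (norm z)\<^sup>2 + C\<^sup>2 / (4 * \<eta>) * (norm z) ^ 4"
        by (rule cube_le_quartic) (rule \<eta>)
      finally show "lyap N (x + z) \<le> lyap N x + (l1 + l2) \<bullet> z + (k + curv (n + 2) + \<eta>) * (norm z)\<^sup>2
         + c * ((x - p) \<bullet> z)\<^sup>2 + C\<^sup>2 / (4 * \<eta>) * norm z ^ 4"
        by (simp add: algebra_simps)
    qed
  qed
  then show thesis using \<eta> by (intro that[of "C\<^sup>2 / (4 * \<eta>)"]) auto
qed

section \<open>Local finiteness of the bubbles, unavoidability and the champagne conditions\<close>

definition centers :: "'a set" where "centers = (\<Union>n. X n)"

definition level :: "'a \<Rightarrow> nat" where "level p = (LEAST n. p \<in> X n)"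

text \<open>A center occurring at two levels would violate \<open>separated\<close>, its distance to
  itself being 0.\<close>

lemma level_eq:
  assumes "p \<in> X n"
  shows "level p = n"
proof -
  have "p \<in> X (level p)" "level p \<le> n" unfolding level_def using assms by (auto intro: LeastI Least_le)
  with separated[of "level p" n p p] assms \<rho>_pos[of "level p"] show ?thesis by force
qed

lemma bubbles_eq: "bubbles centers (\<lambda>p. r (level p)) = A"
  by (auto simp: bubbles_def centers_def A_def level_eq)

text \<open>Cells of level at most \<open>j\<close> already cover \<open>K (Suc j)\<close>, and
  later centers keep outside those cells. This is the source of local finiteness.\<close>

lemma center_notin:
  assumes p: "p \<in> X n" and n: "n > j"
  shows "p \<notin> K (Suc j)"
proof
  assume "p \<in> K (Suc j)"
  then obtain m q where "m \<le> j" "q \<in> X m" "dist q p < \<rho> m" using covers[of j] by auto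
  then show False using separated[of m n q p] p n by auto
qed

lemma bubble_subset:
  assumes "p \<in> X n"
  shows "cball p (r n) \<subseteq> K (n + 2)"
proof -
  have "cball p (r n) \<subseteq> ball p (e (Suc n))"
    using r_le[of n] r_pos[of n] \<rho>_le(2)[of n] by auto
  then show ?thesis using gap[of p "Suc n"] X_subset[of n] assms by auto
qed

lemma A_subset: "A \<subseteq> U"
  using bubble_subset K_subset unfolding A_def by blast

text \<open>A bubble of level above \<open>j\<close> that meets \<open>K (Suc j)\<close> has its
  center in \<open>K (j + 2)\<close>, because its radius is below \<open>e (Suc j)\<close>. Hence
  \<open>center_notin\<close> is applied one index further out, and \<open>n > Suc j\<close> is
  assumed.\<close>

lemma bubble_disjoint_K:
  assumes p: "p \<in> X n" and n: "n > Suc j"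
  shows "cball p (r n) \<inter> K (Suc j) = {}"
proof (rule ccontr)
  assume "cball p (r n) \<inter> K (Suc j) \<noteq> {}"
  then obtain y where y: "dist p y \<le> r n" "y \<in> K (Suc j)" by auto
  have "r n < e (Suc j)"
    using r_le[of n] \<rho>_antimono[of j n] n \<rho>_le(2)[of j] \<rho>_pos[of n] by linarith
  then have "p \<in> ball y (e (Suc j))" using y(1) by (simp add: dist_commute)
  then have "p \<in> K (Suc (Suc j))" using gap[OF y(2)] by auto
  then show False using center_notin[OF p, of "Suc j"] n by auto
qed

lemma ball_in_U:
  assumes "z \<in> U"
  obtains j where "z \<in> K j" "ball z (e j) \<subseteq> K (Suc j)"
  using assms exhausts gap by blast

lemma open_diff: "open (U - A)"
proof (rule openI)
  fix z assume z: "z \<in> U - A"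
  then obtain j where j: "z \<in> K j" "ball z (e j) \<subseteq> K (Suc j)" using ball_in_U by blast
  \<comment> \<open>Only these finitely many bubbles can meet \<open>K (Suc j)\<close>, hence the
    ball around \<open>z\<close>.\<close>
  define F where "F = (\<Union>n\<le>Suc j. \<Union>p\<in>X n. cball p (r n))"
  have "closed F" unfolding F_def by (intro closed_UN) (auto simp: finite_X)
  then have "open (ball z (e j) - F)" by (intro open_Diff) auto
  moreover have "z \<in> ball z (e j) - F" using z e_pos by (auto simp: F_def A_def)
  ultimately obtain \<epsilon> where \<epsilon>: "\<epsilon> > 0" "ball z \<epsilon> \<subseteq> ball z (e j) - F" using open_contains_ball by blast
  have "ball z (e j) - F \<subseteq> U - A"
  proof
    fix x assume x: "x \<in> ball z (e j) - F"
    then have xK: "x \<in> K (Suc j)" using j by auto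
    have "x \<notin> A"
    proof
      assume "x \<in> A"
      then obtain n p where np: "p \<in> X n" "x \<in> cball p (r n)" by (auto simp: A_def)
      then have "n > Suc j" using x by (auto simp: F_def not_le[symmetric])
      then show False using bubble_disjoint_K[OF np(1), of j] np(2) xK by blast
    qed
    then show "x \<in> U - A" using xK K_subset by auto
  qed
  then show "\<exists>T>0. ball z T \<subseteq> U - A" using \<epsilon> by blast
qed

lemma open_U: "open U"
proof (rule openI)
  fix z assume "z \<in> U"
  then obtain j where "z \<in> K j" "ball z (e j) \<subseteq> K (Suc j)" using ball_in_U by blast
  then show "\<exists>T>0. ball z T \<subseteq> U" using e_pos K_subset by blast
qed

lemma closedin_A: "closedin (top_of_set U) A"
proof -
  have "U - (U - A) = A" using A_subset by auto
  moreover have "closedin (top_of_set U) (U - (U - A))"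
    using open_diff open_U by (intro closedin_diff) (auto simp: open_openin_trans openin_open_eq)
  ultimately show ?thesis by simp
qed

lemma A_borel: "A \<in> sets borel"
proof -
  have "A = U - (U - A)" using A_subset by auto
  also have "\<dots> \<in> sets borel" using open_diff open_U by auto
  finally show ?thesis .
qed

lemma unavoidable_A: "unavoidable U A"
  unfolding unavoidable_def
proof (intro conjI ballI allI impI closedin_A)
  fix y and M :: "(real \<Rightarrow> 'a) measure" and B
  assume y: "y \<in> U - A" and "brownian_motion M B y"
  then interpret brownian_motion M B y by simp
  obtain n where n: "y \<in> K n" using y exhausts by auto
  show "emeasure (harmonic_measure M B (U - A)) A = 1"
  proof (rule harmonic_measure_eq_1_lyapunov[where K=K and ?N0.0="max n 1" and b="2 ^ DIM('a) + real n"])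
    fix N assume N: "max n 1 \<le> N"
    then obtain C where C: "C \<ge> 0" "lyapunov_on (K N - A) C (lyap N)" using lyapunov_lyap by auto
    have "lyap N \<in> borel_measurable borel" unfolding lyap_def[abs_def] by measurable
    moreover have "real N \<le> lyap N x" if "x \<notin> K N" for x
      using lyap_bounds(3)[of N x] wells_outside[OF that] by simp
    moreover have "lyap N y \<le> 2 ^ DIM('a) + real n"
      using lyap_bounds(4)[of N y] wells_inside[OF n, of N] by simp
    ultimately show "\<exists>C W c. C \<ge> 0 \<and> lyapunov_on (K N - A) C W \<and> W \<in> borel_measurable borel \<and>
      (\<forall>x. 0 \<le> W x \<and> W x \<le> c) \<and> (\<forall>x. x \<notin> K N \<longrightarrow> real N \<le> W x) \<and> W y \<le> 2 ^ DIM('a) + real n"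
      using C lyap_bounds(1,2)[of N] by blast
  qed (use open_diff A_subset A_borel y K_subset compact_imp_closed[OF compact_K] n K_mono in \<open>auto simp: subset_iff\<close>)
qed

lemma countable_centers: "countable centers"
  unfolding centers_def using finite_X by (intro countable_UN) (auto intro: countable_finite)

lemma not_islimpt_centers:
  assumes z: "z \<in> U"
  shows "\<not> z islimpt centers"
proof
  assume lim: "z islimpt centers"
  obtain j where j: "z \<in> K j" "ball z (e j) \<subseteq> K (Suc j)" using ball_in_U z by blast
  have "centers \<inter> ball z (e j) \<subseteq> (\<Union>n\<le>j. X n)"
    using center_notin j by (force simp: centers_def not_le[symmetric])
  moreover have "finite (\<Union>n\<le>j. X n)" using finite_X by auto
  ultimately have "finite (centers \<inter> ball z (e j))" by (rule finite_subset)
  then show False using lim e_pos[of j] unfolding islimpt_eq_infinite_ball by blast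
qed

lemma champagne:
  assumes \<rho>: "\<rho> \<longlonglongrightarrow> 0"
  shows "champagne_subregion U centers (\<lambda>p. r (level p))"
  unfolding champagne_subregion_def
proof (intro conjI ballI impI)
  show "centers \<subseteq> U" using X_subset K_subset by (auto simp: centers_def)
  show "countable centers" by (rule countable_centers)
  show "\<not> z islimpt centers" if "z \<in> U" for z using not_islimpt_centers[OF that] .
  show "0 < r (level x)" "r (level x) < 1" for x
    using r_pos[of "level x"] r_le[of "level x"] \<rho>_le(1)[of "level x"] by linarith+
  have far: "disjnt (cball p (r m)) (cball q (r n))"
    if "m \<le> n" "p \<in> X m" "q \<in> X n" "(m, p) \<noteq> (n, q)" for m n p q
  proof -
    have "\<rho> m \<le> dist p q" using separated that by blast
    moreover have "r m + r n < \<rho> m"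
      using r_le[of m] r_le[of n] \<rho>_antimono[OF that(1)] \<rho>_pos[of m] by linarith
    ultimately have lt: "r m + r n < dist p q" by linarith
    show ?thesis unfolding disjnt_def
    proof (rule ccontr)
      assume "cball p (r m) \<inter> cball q (r n) \<noteq> {}"
      then obtain x where "dist p x \<le> r m" "dist q x \<le> r n" by auto
      then show False using lt dist_triangle2[of p q x] by linarith
    qed
  qed
  show "pairwise (\<lambda>x x'. disjnt (cball x (r (level x))) (cball x' (r (level x')))) centers"
  proof (rule pairwiseI)
    fix p q assume "p \<in> centers" "q \<in> centers" and ne: "p \<noteq> q"
    then obtain m n where mn: "p \<in> X m" "q \<in> X n" by (auto simp: centers_def)
    then have lv: "level p = m" "level q = n" by (auto simp: level_eq)
    show "disjnt (cball p (r (level p))) (cball q (r (level q)))"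
      unfolding lv using far[of m n p q] far[of n m q p] mn ne
      by (cases "m \<le> n") (auto simp: disjnt_sym)
  qed
  have "ereal (r (level x) / infdist x (frontier U)) \<le> ereal (1 / 2)" if x: "x \<in> centers" for x
  proof -
    obtain n where n: "x \<in> X n" using x unfolding centers_def by blast
    then have lv: "level x = n" by (rule level_eq)
    show ?thesis
    \<comment> \<open>The ball of radius \<open>e (Suc n)\<close> around a center of level
      \<open>n\<close> stays in the open set \<open>U\<close>, and
      \<open>2 * r n \<le> e (Suc n)\<close>. With empty frontier the quotient is 0 by the
      convention for division by 0.\<close>
    proof (cases "frontier U = {}")
      case False
      have "e (Suc n) \<le> infdist x (frontier U)"
        unfolding infdist_notempty[OF False]
      proof (rule cINF_greatest[OF False])
        fix y assume y: "y \<in> frontier U"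
        have "ball x (e (Suc n)) \<subseteq> U"
          using gap[of x "Suc n"] X_subset[of n] n K_subset by blast
        moreover have "y \<notin> U" using y open_U by (simp add: frontier_def interior_open)
        ultimately show "e (Suc n) \<le> dist x y" by (meson mem_ball not_le subset_iff)
      qed
      moreover have "2 * r n \<le> e (Suc n)"
        using r_le[of n] \<rho>_le(2)[of n] r_pos[of n] by linarith
      ultimately show ?thesis using e_pos[of "Suc n"] lv by (simp add: divide_le_eq)
    qed (simp add: infdist_def)
  qed
  then have "(SUP x\<in>centers. ereal (r (level x) / infdist x (frontier U))) \<le> ereal (1 / 2)"
    by (rule SUP_least)
  also have "\<dots> < 1" by simp
  finally show "(SUP x\<in>centers. ereal (r (level x) / infdist x (frontier U))) < 1" .
  show "((\<lambda>p. r (level p)) \<longlongrightarrow> 0) (inf at_infinity (principal centers))"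
  proof (rule tendstoI)
    fix \<epsilon> :: real assume "\<epsilon> > 0"
    then obtain N where N: "\<And>n. n \<ge> N \<Longrightarrow> \<rho> n < \<epsilon>"
      using order_tendstoD(2)[OF \<rho>] by (auto simp: eventually_sequentially)
    \<comment> \<open>Centers of level below \<open>N\<close> form a bounded set, so a center far
      out has a high level and thus a small radius.\<close>
    have "finite (\<Union>n<N. X n)" using finite_X by auto
    then obtain b where b: "\<And>x. x \<in> (\<Union>n<N. X n) \<Longrightarrow> norm x \<le> b"
      using finite_imp_bounded bounded_iff by metis
    have "dist (r (level x)) 0 < \<epsilon>" if x: "norm x \<ge> b + 1" "x \<in> centers" for x
    proof -
      obtain n where n: "x \<in> X n" using x(2) unfolding centers_def by blast
      have "n \<ge> N" using b[of x] n x(1) by force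
      then show ?thesis using N[of n] level_eq[OF n] r_le[of n] r_pos[of n] by (simp add: dist_real_def)
    qed
    then show "\<forall>\<^sub>F x in inf at_infinity (principal centers). dist (r (level x)) 0 < \<epsilon>"
      unfolding eventually_inf_principal eventually_at_infinity by blast
  qed
qed

end

section \<open>Existence of bubble systems\<close>

definition cap_radius :: "nat \<Rightarrow> real \<Rightarrow> real" where
  "cap_radius d c = (if d = 2 then exp (- (1 / c)) else c powr (1 / real (d - 2)))"

lemma cap_radius_pos: "c > 0 \<Longrightarrow> cap_radius d c > 0"
  by (simp add: cap_radius_def)

lemma phi_cap_radius:
  assumes "d \<ge> 2" "c > 0"
  shows "phi d (cap_radius d c) = c"
proof (cases "d = 2")
  case True
  then show ?thesis using assms by (simp add: phi_def cap_radius_def ln_div)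
next
  case False
  have "(c powr (1 / real (d - 2))) ^ (d - 2) = (c powr (1 / real (d - 2))) powr real (d - 2)"
    by (rule powr_realpow[symmetric]) (use assms in simp)
  also have "\<dots> = c" using False assms by (simp add: powr_powr)
  finally show ?thesis using False by (simp add: phi_def cap_radius_def)
qed

text \<open>The level is of order \<open>\<rho> ^ d\<close>, which for small \<open>\<rho>\<close>
  is far below the value of \<open>phi d\<close> at \<open>\<rho> / 4\<close>; so the bubble is
  small compared with its cell.\<close>

lemma cap_radius_small:
  assumes d: "d \<ge> 2" and b: "b > 0" and t: "t > 0"
  obtains \<rho>0 where "\<rho>0 > 0" "\<And>\<rho>. 0 < \<rho> \<Longrightarrow> \<rho> \<le> \<rho>0 \<Longrightarrow> cap_level d b \<rho> \<le> t"
    "\<And>\<rho>. 0 < \<rho> \<Longrightarrow> \<rho> \<le> \<rho>0 \<Longrightarrow> 4 * cap_radius d (cap_level d b \<rho>) \<le> \<rho>"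
proof -
  define \<kappa> where "\<kappa> = b * 3 ^ d / newton_const d"
  have \<kappa>: "\<kappa> > 0" using b newton_const_pos[OF d] by (simp add: \<kappa>_def)
  have cap: "cap_level d b \<rho> = \<kappa> * \<rho> ^ d" for \<rho>
    by (simp add: cap_level_def \<kappa>_def power_mult_distrib)
  \<comment> \<open>The bound 1 gives \<open>\<rho> ^ d \<le> \<rho>\<close>, the second bound then
    keeps the level below \<open>t\<close>, and the third makes the radius at most
    \<open>\<rho> / 4\<close>.\<close>
  define \<rho>0 where "\<rho>0 = min 1 (min (t / \<kappa>) (1 / (\<kappa> * 4 ^ d)))"
  show thesis
  proof (rule that[of \<rho>0])
    show "\<rho>0 > 0" using t \<kappa> by (simp add: \<rho>0_def)
    fix \<rho> :: real assume \<rho>: "0 < \<rho>" "\<rho> \<le> \<rho>0"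
    then have le: "\<rho> \<le> 1" "\<kappa> * \<rho> \<le> t" "\<kappa> * \<rho> * 4 ^ d \<le> 1"
      using \<kappa> by (auto simp: \<rho>0_def field_simps)
    have "\<rho> ^ d \<le> \<rho> ^ 1" using \<rho> le d by (intro power_decreasing) auto
    then have "\<kappa> * \<rho> ^ d \<le> \<kappa> * \<rho>" using \<kappa> by simp
    then show "cap_level d b \<rho> \<le> t" using le(2) unfolding cap by linarith
    define c where "c = \<kappa> * \<rho> ^ d"
    have c: "c > 0" using \<kappa> \<rho> by (simp add: c_def)
    have small: "c \<le> (\<rho> / 4) ^ (d - 2)" "d = 2 \<Longrightarrow> 4 * c \<le> \<rho>"
    proof -
      have e: "\<rho> ^ d = \<rho> ^ (d - 2) * (\<rho> * \<rho>)"
        using d by (metis power_add power2_eq_square le_add_diff_inverse2)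
      have "\<kappa> * \<rho> * \<rho> \<le> \<kappa> * \<rho> * 1" using le \<kappa> \<rho> by (intro mult_left_mono) auto
      also have "\<dots> \<le> 1 / 4 ^ d" using le(3) by (simp add: field_simps)
      also have "\<dots> \<le> 1 / 4 ^ (d - 2)" by (intro divide_left_mono power_increasing) auto
      finally have "\<rho> ^ (d - 2) * (\<kappa> * \<rho> * \<rho>) \<le> \<rho> ^ (d - 2) * (1 / 4 ^ (d - 2))"
        using \<rho> by (intro mult_left_mono) auto
      then show "c \<le> (\<rho> / 4) ^ (d - 2)"
        by (simp add: c_def e power_divide mult_ac)
      assume "d = 2"
      then have "\<kappa> * \<rho> * 16 * \<rho> \<le> 1 * \<rho>" using le(3) \<rho> by (intro mult_right_mono) auto
      moreover have "c = \<kappa> * \<rho> * \<rho>" using \<open>d = 2\<close> by (simp add: c_def power2_eq_square)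
      moreover have "c > 0" by fact
      ultimately show "4 * c \<le> \<rho>" by linarith
    qed
    have "4 * cap_radius d c \<le> \<rho>"
    proof (cases "d = 2")
      case True
      have "1 + 1 / c \<le> exp (1 / c)" by (rule exp_ge_add_one_self)
      then have "1 \<le> c * exp (1 / c)" using c by (simp add: field_simps)
      then have "exp (- (1 / c)) \<le> c" by (simp add: exp_minus field_simps)
      then show ?thesis using small(2) True by (simp add: cap_radius_def)
    next
      case False
      have "c powr (1 / real (d - 2)) \<le> ((\<rho> / 4) ^ (d - 2)) powr (1 / real (d - 2))"
        using small(1) c by (intro powr_mono2) auto
      also have "\<dots> = \<rho> / 4"
        using \<rho> False d by (simp add: powr_powr flip: powr_realpow)
      finally show ?thesis using False by (simp add: cap_radius_def)
    qed
    then show "4 * cap_radius d (cap_level d b \<rho>) \<le> \<rho>" by (simp add: cap c_def)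
  qed
qed

text \<open>Volume packing: the balls of radius \<open>\<rho> / 2\<close> around the points are
  disjoint and lie in the ball of radius \<open>R + 1\<close>, as
  \<open>\<rho> \<le> 2\<close>.\<close>

lemma card_separated_le:
  fixes X :: "'a::euclidean_space set"
  assumes fin: "finite X" and sub: "X \<subseteq> cball 0 R" and R: "R \<ge> 0" and \<rho>: "0 < \<rho>" "\<rho> \<le> 2"
    and sep: "\<And>p q. p \<in> X \<Longrightarrow> q \<in> X \<Longrightarrow> p \<noteq> q \<Longrightarrow> \<rho> \<le> dist p q"
  shows "real (card X) \<le> (2 * (R + 1) / \<rho>) ^ DIM('a)"
proof -
  let ?v = "unit_ball_vol (real DIM('a))"
  have v: "?v > 0" by (rule unit_ball_vol_pos) simp
  have disj: "disjoint_family_on (\<lambda>p. ball p (\<rho> / 2)) X"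
    unfolding disjoint_family_on_def
  proof (intro ballI impI)
    fix p q assume "p \<in> X" "q \<in> X" "p \<noteq> q"
    then have d: "\<rho> \<le> dist p q" by (rule sep)
    show "ball p (\<rho> / 2) \<inter> ball q (\<rho> / 2) = {}"
    proof (rule ccontr)
      assume "ball p (\<rho> / 2) \<inter> ball q (\<rho> / 2) \<noteq> {}"
      then obtain x where "dist p x < \<rho> / 2" "dist q x < \<rho> / 2" by auto
      then show False using d dist_triangle2[of p q x] by linarith
    qed
  qed
  have "measure lborel (\<Union>p\<in>X. ball p (\<rho> / 2)) = (\<Sum>p\<in>X. measure lborel (ball p (\<rho> / 2)))"
    using emeasure_bounded_finite[OF bounded_ball]
    by (intro measure_finite_Union fin disj) (auto simp: less_top[symmetric])
  also have "\<dots> = real (card X) * (?v * (\<rho> / 2) ^ DIM('a))"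
    using \<rho> by (simp add: content_ball)
  finally have 1: "measure lborel (\<Union>p\<in>X. ball p (\<rho> / 2)) = real (card X) * (?v * (\<rho> / 2) ^ DIM('a))" .
  have "(\<Union>p\<in>X. ball p (\<rho> / 2)) \<subseteq> ball 0 (R + 1)"
  proof
    fix x assume "x \<in> (\<Union>p\<in>X. ball p (\<rho> / 2))"
    then obtain p where p: "p \<in> X" "dist p x < \<rho> / 2" by auto
    then have "norm p \<le> R" using sub by auto
    then show "x \<in> ball 0 (R + 1)"
      using p(2) \<rho> dist_triangle[of 0 x p] by (simp add: dist_norm norm_minus_commute)
  qed
  moreover have "(\<Union>p\<in>X. ball p (\<rho> / 2)) \<in> sets borel" by (intro borel_open open_UN) auto
  ultimately have "measure lborel (\<Union>p\<in>X. ball p (\<rho> / 2)) \<le> measure lborel (ball (0::'a) (R + 1))"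
    using emeasure_bounded_finite[OF bounded_ball, of "0::'a" "R + 1"]
    by (intro measure_mono_fmeasurable) (auto simp: fmeasurable_def)
  also have "\<dots> = ?v * (R + 1) ^ DIM('a)" using R by (simp add: content_ball)
  finally have "?v * (real (card X) * (\<rho> / 2) ^ DIM('a)) \<le> ?v * (R + 1) ^ DIM('a)"
    unfolding 1 by (simp add: mult_ac)
  then have "real (card X) * (\<rho> / 2) ^ DIM('a) \<le> (R + 1) ^ DIM('a)" using v by simp
  then have "real (card X) \<le> (R + 1) ^ DIM('a) / (\<rho> / 2) ^ DIM('a)"
    using \<rho> by (subst pos_le_divide_eq) auto
  also have "\<dots> = ((R + 1) / (\<rho> / 2)) ^ DIM('a)" by (rule power_divide[symmetric])
  also have "(R + 1) / (\<rho> / 2) = 2 * (R + 1) / \<rho>" by simp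
  finally show ?thesis .
qed

definition max_separated :: "real \<Rightarrow> 'a::metric_space set \<Rightarrow> 'a set \<Rightarrow> bool" where
  "max_separated \<rho> S X \<longleftrightarrow> finite X \<and> X \<subseteq> S \<and> (\<forall>p\<in>X. \<forall>q\<in>X. p \<noteq> q \<longrightarrow> \<rho> \<le> dist p q) \<and> S \<subseteq> (\<Union>p\<in>X. ball p \<rho>)"

text \<open>Packing bounds the cardinality of separated subsets, so one of largest cardinality
  exists; a point of \<open>S\<close> outside its balls could be added to it.\<close>

lemma max_separated_exists:
  fixes S :: "'a::euclidean_space set"
  assumes S: "bounded S" and \<rho>: "0 < \<rho>" "\<rho> \<le> 2"
  shows "\<exists>X. max_separated \<rho> S X"
proof -
  obtain a where "\<And>x. x \<in> S \<Longrightarrow> norm x \<le> a" using S by (auto simp: bounded_iff)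
  then obtain R where R: "R \<ge> 0" "S \<subseteq> cball 0 R"
    by (intro that[of "max 0 a"]) force+
  define P where "P X \<longleftrightarrow> finite X \<and> X \<subseteq> S \<and> (\<forall>p\<in>X. \<forall>q\<in>X. p \<noteq> q \<longrightarrow> \<rho> \<le> dist p q)" for X
  have "card X \<le> nat \<lceil>(2 * (R + 1) / \<rho>) ^ DIM('a)\<rceil>" if "P X" for X
  proof -
    have "real (card X) \<le> (2 * (R + 1) / \<rho>) ^ DIM('a)"
      using that R unfolding P_def by (intro card_separated_le \<rho>) auto
    also have "\<dots> \<le> real (nat \<lceil>(2 * (R + 1) / \<rho>) ^ DIM('a)\<rceil>)" by (rule real_nat_ceiling_ge)
    finally show ?thesis by (simp only: of_nat_le_iff)
  qed
  moreover have "P {}" by (simp add: P_def)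
  ultimately obtain X where X: "P X" "\<And>Y. P Y \<Longrightarrow> card Y \<le> card X"
    using ex_has_greatest_nat[of P "{}" card "Suc (nat \<lceil>(2 * (R + 1) / \<rho>) ^ DIM('a)\<rceil>)"] by (auto simp: less_Suc_eq_le)
  have "S \<subseteq> (\<Union>p\<in>X. ball p \<rho>)"
  proof
    fix s assume s: "s \<in> S"
    show "s \<in> (\<Union>p\<in>X. ball p \<rho>)"
    proof (rule ccontr)
      assume n: "s \<notin> (\<Union>p\<in>X. ball p \<rho>)"
      then have far: "\<rho> \<le> dist p s" if "p \<in> X" for p using that by (auto simp: not_less)
      then have "s \<notin> X" using \<rho> by force
      moreover have "P (insert s X)" using X(1) s far by (auto simp: P_def dist_commute)
      ultimately show False using X(2)[of "insert s X"] X(1) by (simp add: P_def)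
    qed
  qed
  then show ?thesis using X(1) unfolding P_def max_separated_def by blast
qed

section \<open>Construction of the exhaustion and of the cells\<close>

lemma exhaustion_exists:
  fixes U :: "'a::euclidean_space set"
  assumes U: "U \<noteq> {}" "open U"
  obtains K e where "exhaustion U K e"
proof -
  obtain u where u: "u \<in> U" using U by blast
  obtain C where C: "\<And>n. compact (C n)" "\<And>n. C n \<subseteq> U" "\<And>n. C n \<subseteq> interior (C (Suc n))"
    "\<Union>(range C) = U" "\<And>K. compact K \<Longrightarrow> K \<subseteq> U \<Longrightarrow> \<exists>N. \<forall>n\<ge>N. K \<subseteq> C n"
    using open_Union_compact_subsets[OF U(2)] by metis
  obtain N where N: "\<And>n. n \<ge> N \<Longrightarrow> u \<in> C n" using C(5)[of "{u}"] u by auto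
  \<comment> \<open>The shift by \<open>N\<close> puts \<open>u\<close> into every set, so that all
    are nonempty.\<close>
  define K where "K n = C (N + n)" for n
  have "\<exists>\<epsilon>>0. (\<Union>x\<in>K n. ball x \<epsilon>) \<subseteq> interior (K (Suc n))" for n
    using compact_subset_open_imp_ball_epsilon_subset[OF C(1) open_interior C(3), of "N + n"]
    unfolding K_def add_Suc_right by metis
  then obtain e where e: "\<And>n. e n > 0" "\<And>n. (\<Union>x\<in>K n. ball x (e n)) \<subseteq> interior (K (Suc n))"
    by metis
  have "exhaustion U K e"
  proof
    show "compact (K n)" "K n \<noteq> {}" "K n \<subseteq> U" "0 < e n" for n
      using C N[of "N + n"] e by (auto simp: K_def)
    show "ball x (e n) \<subseteq> K (Suc n)" if "x \<in> K n" for n x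
      using e(2)[of n] that interior_subset by blast
    show "U \<subseteq> (\<Union>n. K n)"
    proof
      fix x assume "x \<in> U"
      then obtain N' where "\<And>n. n \<ge> N' \<Longrightarrow> x \<in> C n" using C(5)[of "{x}"] by auto
      then have "x \<in> K N'" by (simp add: K_def)
      then show "x \<in> (\<Union>n. K n)" by blast
    qed
  qed
  then show thesis by (rule that)
qed

text \<open>At level \<open>n\<close> only the part of \<open>K (Suc n)\<close> not yet covered by earlier cells is filled; this keeps
  bubbles of different levels apart.\<close>

context exhaustion
begin

lemma bubble_system_exists:
  fixes t :: "nat \<Rightarrow> real"
  assumes dim: "DIM('a) \<ge> 2" and t: "\<And>n. t n > 0" "\<And>n. t n \<le> 1"
  obtains \<rho> r X where "bubble_system U K e \<rho> r X" "\<rho> \<longlonglongrightarrow> 0"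
    "\<And>n. cap_level DIM('a) (curv (n + 2) + 2) (\<rho> n) \<le> t n"
proof -
  have "\<exists>\<rho>0>0. \<forall>\<rho>. 0 < \<rho> \<longrightarrow> \<rho> \<le> \<rho>0 \<longrightarrow> cap_level DIM('a) (curv (n + 2) + 2) \<rho> \<le> t n \<and>
      4 * cap_radius DIM('a) (cap_level DIM('a) (curv (n + 2) + 2) \<rho>) \<le> \<rho>" for n
    using cap_radius_small[OF dim curv_pos t(1), of "n + 2" n] by metis
  then obtain \<rho>0 where \<rho>0: "\<And>n. \<rho>0 n > 0"
    "\<And>n \<rho>. 0 < \<rho> \<Longrightarrow> \<rho> \<le> \<rho>0 n \<Longrightarrow> cap_level DIM('a) (curv (n + 2) + 2) \<rho> \<le> t n \<and>
      4 * cap_radius DIM('a) (cap_level DIM('a) (curv (n + 2) + 2) \<rho>) \<le> \<rho>"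
    by metis
  \<comment> \<open>All upper bounds on the scale at level \<open>n\<close> at once, with
    \<open>1 / Suc n\<close> to force convergence to 0. The running minimum \<open>\<rho>\<close>
    then makes the scales decrease.\<close>
  define \<sigma> where "\<sigma> n = Min {\<rho>0 n, 1 / 2, e (Suc n) / 2, 1 / real (Suc n)}" for n
  define \<rho> where "\<rho> n = Min (\<sigma> ` {..n})" for n
  have \<sigma>: "\<sigma> n > 0" "\<sigma> n \<le> \<rho>0 n" "\<sigma> n \<le> 1 / 2" "\<sigma> n \<le> e (Suc n) / 2" "\<sigma> n \<le> 1 / real (Suc n)" for n
    using \<rho>0(1)[of n] e_pos[of "Suc n"] by (auto simp: \<sigma>_def)
  have \<rho>\<sigma>: "\<rho> n \<le> \<sigma> n" and \<rho>: "\<rho> n > 0" for n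
    using \<sigma>(1) by (auto simp: \<rho>_def)
  have anti: "\<rho> n \<le> \<rho> m" if "m \<le> n" for m n
    unfolding \<rho>_def using that by (intro Min_antimono) auto
  define c where "c n = cap_level DIM('a) (curv (n + 2) + 2) (\<rho> n)" for n
  have c: "c n > 0" "c n \<le> t n" "4 * cap_radius DIM('a) (c n) \<le> \<rho> n" for n
    using cap_level_pos[OF dim curv_pos \<rho>] \<rho>0(2)[OF \<rho>[of n]] \<rho>\<sigma>[of n] \<sigma>(2)[of n] by (auto simp: c_def)
  define F where "F n Z = (SOME X. max_separated (\<rho> n) (K (Suc n) - Z) X)" for n and Z :: "'a set"
  have F: "max_separated (\<rho> n) (K (Suc n) - Z) (F n Z)" for n Z
    unfolding F_def
  proof (rule someI_ex, rule max_separated_exists)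
    show "bounded (K (Suc n) - Z)" using compact_imp_bounded[OF compact_K] by (rule bounded_subset) auto
    show "\<rho> n \<le> 2" using \<rho>\<sigma>[of n] \<sigma>(3)[of n] by linarith
  qed (rule \<rho>)
  \<comment> \<open>\<open>Z n\<close> is the region covered by cells of level below
    \<open>n\<close>. Choosing \<open>X n\<close> outside it yields the separation between different
    levels; maximality yields the covering.\<close>
  define Z where "Z = rec_nat {} (\<lambda>n Z. Z \<union> (\<Union>p\<in>F n Z. ball p (\<rho> n)))"
  have Z0: "Z 0 = {}" and ZS: "Z (Suc n) = Z n \<union> (\<Union>p\<in>F n (Z n). ball p (\<rho> n))" for n
    by (simp_all add: Z_def)
  define X where "X n = F n (Z n)" for n
  have X: "max_separated (\<rho> n) (K (Suc n) - Z n) (X n)" for n unfolding X_def by (rule F)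
  note X = X[unfolded max_separated_def]
  have Z: "Z n = (\<Union>m<n. \<Union>p\<in>X m. ball p (\<rho> m))" for n
    by (induction n) (auto simp: Z0 ZS X_def lessThan_Suc)
  have "bubble_system U K e \<rho> (\<lambda>n. cap_radius DIM('a) (c n)) X"
  proof
    fix n
    show "2 \<le> DIM('a)" "0 < \<rho> n" by fact+
    show "2 * \<rho> n \<le> 1" "2 * \<rho> n \<le> e (Suc n)"
      using \<rho>\<sigma>[of n] \<sigma>(3,4)[of n] by linarith+
    show "0 < cap_radius DIM('a) (c n)" using c(1) by (rule cap_radius_pos)
    show "4 * cap_radius DIM('a) (c n) \<le> \<rho> n" by (rule c)
    show "phi DIM('a) (cap_radius DIM('a) (c n)) = cap_level DIM('a) (curv (n + 2) + 2) (\<rho> n)"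
      using phi_cap_radius[OF dim c(1)] by (simp add: c_def)
    show "cap_level DIM('a) (curv (n + 2) + 2) (\<rho> n) \<le> 1"
      using c(2)[of n] t(2)[of n] by (simp add: c_def)
    show "finite (X n)" "X n \<subseteq> K (Suc n)" using X[of n] by auto
    have "K (Suc n) \<subseteq> Z n \<union> (\<Union>p\<in>X n. ball p (\<rho> n))" using X[of n] by auto
    also have "\<dots> = Z (Suc n)" by (simp add: ZS X_def)
    finally show "K (Suc n) \<subseteq> (\<Union>m\<le>n. \<Union>p\<in>X m. ball p (\<rho> m))"
      by (simp add: Z lessThan_Suc_atMost)
  next
    show "\<rho> n \<le> \<rho> m" if "m \<le> n" for m n using that by (rule anti)
    fix m n p q assume mn: "m \<le> n" and pq: "p \<in> X m" "q \<in> X n" "(m, p) \<noteq> (n, q)"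
    show "\<rho> m \<le> dist p q"
    proof (cases "m = n")
      case True
      then show ?thesis using X[of n] pq by auto
    next
      case False
      have "q \<notin> Z n" using X[of n] pq(2) by auto
      then show ?thesis using False mn pq(1) by (auto simp: Z not_less)
    qed
  qed
  moreover have "\<rho> \<longlonglongrightarrow> 0"
  proof (rule real_tendsto_sandwich[OF _ _ tendsto_const LIMSEQ_Suc[OF lim_1_over_n]])
    show "\<forall>\<^sub>F n in sequentially. 0 \<le> \<rho> n" using \<rho> by (intro always_eventually allI less_imp_le)
    show "\<forall>\<^sub>F n in sequentially. \<rho> n \<le> 1 / real (Suc n)"
      using \<rho>\<sigma> \<sigma>(5) order_trans by (intro always_eventually allI) blast
  qed
  moreover have "cap_level DIM('a) (curv (n + 2) + 2) (\<rho> n) \<le> t n" for n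
    using c(2)[of n] by (simp add: c_def)
  ultimately show thesis by (rule that)
qed

end

section \<open>Cost of the bubbles\<close>

context bubble_system
begin

text \<open>By packing, the number of cells is at most of order \<open>\<rho> n\<close> to the power
  \<open>- DIM('a)\<close>, and \<open>phi\<close> of the radius is proportional to
  \<open>\<rho> n ^ DIM('a)\<close>. The scale cancels.\<close>

lemma cost_le:
  assumes R: "R \<ge> 0" "K (Suc n) \<subseteq> cball 0 R"
  shows "real (card (X n)) * phi DIM('a) (r n)
     \<le> (2 * (R + 1)) ^ DIM('a) * ((curv (n + 2) + 2) * 3 ^ DIM('a) / newton_const DIM('a))"
proof -
  have sep: "\<rho> n \<le> dist p q" if "p \<in> X n" "q \<in> X n" "p \<noteq> q" for p q
    using separated[of n n p q] that by auto
  have "real (card (X n)) \<le> (2 * (R + 1) / \<rho> n) ^ DIM('a)"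
    using X_subset[of n] R \<rho>_le(1)[of n]
    by (intro card_separated_le finite_X \<rho>_pos sep) auto
  then have "real (card (X n)) * phi DIM('a) (r n) \<le> (2 * (R + 1) / \<rho> n) ^ DIM('a) * phi DIM('a) (r n)"
    using cap_level_pos[OF dim curv_pos \<rho>_pos, of "n + 2" n] by (intro mult_right_mono) (auto simp: phi_r)
  also have "\<dots> = (2 * (R + 1)) ^ DIM('a) * ((curv (n + 2) + 2) * 3 ^ DIM('a) / newton_const DIM('a))"
    using \<rho>_pos[of n] by (simp add: phi_r cap_level_def power_divide power_mult_distrib)
  finally show ?thesis .
qed

text \<open>Grouping by level, every finite partial sum is at most half of \<open>\<delta>\<close>;
  the factor 2 to spare gives the strict inequality.\<close>

lemma summable_on_centers:
  fixes g :: "real \<Rightarrow> real"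
  assumes g: "\<And>n. 0 \<le> g (r n)" and le: "\<And>n. real (card (X n)) * g (r n) \<le> \<delta> / 2 ^ (n + 2)" and \<delta>: "\<delta> > 0"
  shows "(\<lambda>p. g (r (level p))) summable_on centers" "(\<Sum>\<^sub>\<infinity>p\<in>centers. g (r (level p))) < \<delta>"
proof -
  have bound: "(\<Sum>p\<in>F. g (r (level p))) \<le> \<delta> / 2" if F: "finite F" "F \<subseteq> centers" for F
  proof -
    obtain M where M: "level ` F \<subseteq> {..<M}"
      using finite_nat_iff_bounded[of "level ` F"] F(1) by auto
    have "F \<subseteq> (\<Union>n<M. X n)"
    proof
      fix p assume p: "p \<in> F"
      then obtain n where n: "p \<in> X n" using F(2) by (auto simp: centers_def)
      then have "n < M" using M p level_eq[OF n] by auto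
      then show "p \<in> (\<Union>n<M. X n)" using n by auto
    qed
    then have "(\<Sum>p\<in>F. g (r (level p))) \<le> (\<Sum>p\<in>(\<Union>n<M. X n). g (r (level p)))"
      using finite_X g by (intro sum_mono2) auto
    also have "\<dots> = (\<Sum>n<M. \<Sum>p\<in>X n. g (r (level p)))"
      using finite_X level_eq by (intro sum.UNION_disjoint) (auto, blast)
    also have "\<dots> = (\<Sum>n<M. real (card (X n)) * g (r n))"
      by (intro sum.cong refl) (simp add: level_eq)
    also have "\<dots> \<le> (\<Sum>n<M. \<delta> / 2 ^ (n + 2))" by (intro sum_mono le)
    also have "\<dots> = \<delta> / 4 * (\<Sum>n<M. (1 / 2) ^ n)"
      by (simp add: sum_distrib_left power_divide mult.commute)
    also have "(\<Sum>n<M. (1 / 2 :: real) ^ n) \<le> 2"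
      by (simp add: geometric_sum)
    finally show ?thesis using \<delta> by simp
  qed
  show s: "(\<lambda>p. g (r (level p))) summable_on centers"
    by (rule nonneg_bdd_above_summable_on) (use g in \<open>auto intro!: bdd_aboveI[where M="\<delta> / 2"] bound\<close>)
  have "(\<Sum>\<^sub>\<infinity>p\<in>centers. g (r (level p))) \<le> \<delta> / 2"
    by (rule infsum_le_finite_sums[OF s bound])
  then show "(\<Sum>\<^sub>\<infinity>p\<in>centers. g (r (level p))) < \<delta>" using \<delta> by linarith
qed

end

section \<open>Choice of thresholds from \<open>f\<close>, and assembly\<close>

theorem theorem6p1:
  fixes U :: "'a::euclidean_space set"
    and m :: "nat \<Rightarrow> nat" and \<alpha> \<beta> :: "nat \<Rightarrow> real"
    and k0 k1 k2 :: nat and f :: "real \<Rightarrow> real" and \<delta> :: real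
  assumes dim: "DIM('a) \<ge> 2"
    and U: "U \<noteq> {}" "connected U" "open U"
    and m_pos: "\<And>k. k \<ge> k0 \<Longrightarrow> m k > 0"
    and \<alpha>_pos: "\<And>k. k \<ge> k0 \<Longrightarrow> \<alpha> k > 0"
    and m_mono: "\<And>k. k \<ge> k0 \<Longrightarrow> m k \<le> m (k + 1)"
    and \<alpha>_antimono: "\<And>k. k \<ge> k0 \<Longrightarrow> \<alpha> (k + 1) \<le> \<alpha> k"
    and \<beta>_mono: "\<And>k. k \<ge> k0 \<Longrightarrow> \<beta> k \<le> \<beta> (k + 1)"
    and \<alpha>_le: "\<And>k. k \<ge> k0 \<Longrightarrow> \<alpha> k \<le> 1 / real (max k (m k))"
    and \<beta>_bounds: "\<And>k. k \<ge> k0 \<Longrightarrow> 1 \<le> \<beta> k \<and> \<beta> k \<le> real k"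
    and divergent: "\<not> summable (\<lambda>k. real (m (k + k0)) * \<alpha> (k + k0))"
    and convergent: "summable (\<lambda>k. real (m (k + k0)) * \<alpha> (k + k0) / \<beta> (k + k0))"
      "(\<Sum>k. real (m (k + k0)) * \<alpha> (k + k0) / \<beta> (k + k0)) < 1 / 2"
    and k1: "k1 \<ge> k0" "\<And>k. k \<ge> k1 \<Longrightarrow> model_radius DIM('a) (\<alpha> k) (\<beta> k) < (\<alpha> k / \<beta> k) / 100"
    and k2: "k2 \<ge> k1"
    and f_pos: "\<And>t. t \<in> {0<..1 / real (m k2) ^ (DIM('a) - 1)} \<Longrightarrow> f t > 0"
    and f_mono: "mono_on {0<..1 / real (m k2) ^ (DIM('a) - 1)} f"
    and f_summable: "summable (\<lambda>k. \<beta> (k + k2) * f (\<alpha> (k + k2) ^ (DIM('a) - 1)))"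
    and \<delta>: "\<delta> > 0"
  shows "\<exists>X r. champagne_subregion U X r \<and> unavoidable U (bubbles X r) \<and>
    (\<forall>x\<in>X. phi DIM('a) (r x) \<in> {0<..1 / real (m k2) ^ (DIM('a) - 1)}) \<and>
    (\<lambda>x. phi DIM('a) (r x) * f (phi DIM('a) (r x))) summable_on X \<and>
    (\<Sum>\<^sub>\<infinity>x\<in>X. phi DIM('a) (r x) * f (phi DIM('a) (r x))) < \<delta>"
proof -
  let ?d = "DIM('a)" and ?T = "1 / real (m k2) ^ (DIM('a) - 1)"
  have ge: "k \<ge> k0" if "k \<ge> k2" for k using that k1(1) k2 by linarith
  have m_le: "m k2 \<le> m k" if "k \<ge> k2" for k
    using that by (induction rule: dec_induct) (use m_mono ge in \<open>fastforce+\<close>)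
  have dom: "0 < \<alpha> k ^ (?d - 1)" "\<alpha> k ^ (?d - 1) \<le> ?T" if k: "k \<ge> k2" for k
  proof -
    show "0 < \<alpha> k ^ (?d - 1)" using \<alpha>_pos[OF ge[OF k]] by simp
    have "\<alpha> k \<le> 1 / real (m k2)"
    proof -
      have "1 / real (max k (m k)) \<le> 1 / real (m k2)"
        using m_le[OF k] m_pos[OF ge[OF order_refl]] by (intro divide_left_mono) auto
      then show ?thesis using \<alpha>_le[OF ge[OF k]] by linarith
    qed
    then have "\<alpha> k ^ (?d - 1) \<le> (1 / real (m k2)) ^ (?d - 1)"
      using \<alpha>_pos[OF ge[OF k]] by (intro power_mono) auto
    then show "\<alpha> k ^ (?d - 1) \<le> ?T" by (simp add: power_divide)
  qed
  \<comment> \<open>One index \<open>j\<close> with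
    \<open>\<beta> j * f (\<alpha> j ^ (?d - 1)) < \<epsilon>\<close> suffices:
    \<open>1 \<le> \<beta> j\<close> bounds \<open>f\<close> there by \<open>\<epsilon>\<close>, and
    monotonicity carries the bound to all smaller positive arguments.\<close>
  have small: "\<exists>t>0. t \<le> 1 \<and> t \<le> ?T \<and> (\<forall>s. 0 < s \<longrightarrow> s \<le> t \<longrightarrow> f s \<le> \<epsilon>)" if \<epsilon>: "\<epsilon> > 0" for \<epsilon>
  proof -
    obtain k where "\<beta> (k + k2) * f (\<alpha> (k + k2) ^ (?d - 1)) < \<epsilon>"
      using order_tendstoD(2)[OF summable_LIMSEQ_zero[OF f_summable] \<epsilon>]
      by (auto simp: eventually_sequentially)
    moreover define j where "j = k + k2"
    ultimately have j: "j \<ge> k2" "\<beta> j * f (\<alpha> j ^ (?d - 1)) < \<epsilon>" by auto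
    define a where "a = \<alpha> j ^ (?d - 1)"
    have a: "a \<in> {0<..?T}" using dom[OF j(1)] by (simp add: a_def)
    have "1 * f a \<le> \<beta> j * f a"
      using \<beta>_bounds[OF ge[OF j(1)]] f_pos[OF a] by (intro mult_right_mono) auto
    then have fa: "f a \<le> \<epsilon>" using j(2) by (simp add: a_def)
    have "f s \<le> \<epsilon>" if "0 < s" "s \<le> min 1 a" for s
      using mono_onD[OF f_mono, of s a] that a fa by auto
    then show ?thesis using a by (intro exI[of _ "min 1 a"]) auto
  qed
  obtain K e where "exhaustion U K e" using exhaustion_exists[OF U(1,3)] by blast
  then interpret exhaustion U K e .
  have "\<exists>R\<ge>0. K (Suc n) \<subseteq> cball 0 R" for n
    using compact_imp_bounded[OF compact_K] bounded_subset_ballD[of "K (Suc n)" 0]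
    by (metis ball_subset_cball less_imp_le order_trans)
  then obtain R where R: "\<And>n. R n \<ge> 0" "\<And>n. K (Suc n) \<subseteq> cball 0 (R n)" by metis
  \<comment> \<open>The bound of \<open>cost_le\<close>. It depends on the exhaustion alone, so the
    threshold \<open>t n\<close> for \<open>phi\<close>, and through it the scale at level
    \<open>n\<close>, can be chosen afterwards to make the cost of level \<open>n\<close> at most
    \<open>\<delta> / 2 ^ (n + 2)\<close>.\<close>
  define D where "D n = (2 * (R n + 1)) ^ ?d * ((curv (n + 2) + 2) * 3 ^ ?d / newton_const ?d)" for n
  have D: "D n > 0" for n
    using R(1)[of n] curv_pos newton_const_pos[OF dim] by (simp add: D_def add_nonneg_pos)
  have "\<exists>t>0. t \<le> 1 \<and> t \<le> ?T \<and> (\<forall>s. 0 < s \<longrightarrow> s \<le> t \<longrightarrow> f s \<le> \<delta> / 2 ^ (n + 2) / D n)" for n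
    using D \<delta> by (intro small divide_pos_pos) auto
  then obtain t where t: "\<And>n. t n > 0" "\<And>n. t n \<le> 1" "\<And>n. t n \<le> ?T"
    "\<And>n s. 0 < s \<Longrightarrow> s \<le> t n \<Longrightarrow> f s \<le> \<delta> / 2 ^ (n + 2) / D n" by metis
  obtain \<rho> r X where sys: "bubble_system U K e \<rho> r X" and \<rho>: "\<rho> \<longlonglongrightarrow> 0"
    and cap: "\<And>n. cap_level ?d (curv (n + 2) + 2) (\<rho> n) \<le> t n"
    using bubble_system_exists[of t, OF dim t(1,2)] by metis
  interpret bubble_system U K e \<rho> r X by (rule sys)
  have ph: "0 < phi ?d (r n)" "phi ?d (r n) \<le> t n" for n
    using cap_level_pos[OF dim curv_pos \<rho>_pos] cap[of n] by (auto simp: phi_r)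
  have ph_dom: "phi ?d (r n) \<in> {0<..?T}" for n using ph[of n] t(3)[of n] by auto
  let ?g = "\<lambda>s. phi ?d s * f (phi ?d s)"
  have g0: "0 \<le> ?g (r n)" for n using ph(1)[of n] f_pos[OF ph_dom[of n]] by simp
  have "real (card (X n)) * ?g (r n) \<le> \<delta> / 2 ^ (n + 2)" for n
  proof -
    have "real (card (X n)) * ?g (r n) = real (card (X n)) * phi ?d (r n) * f (phi ?d (r n))" by simp
    also have "\<dots> \<le> D n * (\<delta> / 2 ^ (n + 2) / D n)"
      using cost_le[OF R, of n] t(4)[OF ph] f_pos[OF ph_dom[of n]] D[of n]
      by (intro mult_mono) (auto simp: D_def)
    finally show ?thesis using D[of n] by simp
  qed
  note sum = summable_on_centers[of ?g, OF g0 this \<delta>]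
  show ?thesis
    using champagne[OF \<rho>] unavoidable_A ph_dom sum
    by (intro exI[of _ centers] exI[of _ "\<lambda>p. r (level p)"]) (simp add: bubbles_eq)
qed

end
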